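(* Let $n\ge 3$ and $r\ge 2$ be integers. Then $\delta_1(n,r)=(r-1)(n+1)-1$. Moreover, if $(Y,S)\in\mathcal{E}(n,r)$ satisfies $\delta(2S,Y)=\delta_1(n,r)$, then, up to exchanging the factors, $Y=\mathbb{P}^{n-1}\times\mathbb{P}^1$ and there are a line $L\subset\mathbb{P}^{n-1}$ and a point $o\in\mathbb{P}^1$ such that $S\subset L\times\{o\}$ and $\langle\pi_1(S)\rangle=L$.
   Context: We work over an algebraically closed field of characteristic $0$. For a multiprojective space $Y=\mathbb{P}^{n_1}\times\cdots\times\mathbb{P}^{n_k}$ (all $n_i>0$), $\pi_i$ is the projection onto the $i$-th factor; for $p\in Y$, $(2p,Y)$ is the closed subscheme of $Y$ with ideal sheaf $(\mathcal{I}_{p,Y})^2$, and for a finite set $S\subset Y$, $(2S,Y)=\bigcup_{p\in S}(2p,Y)$. Put $\delta(2S,Y):=h^1(Y,\mathcal{I}_{(2S,Y)}(1,\dots,1))$. $S(Y,r)$ is the set of subsets of $Y$ of cardinality $r$, and $$\mathbb{T}_1(Y,r)=\{S\in S(Y,r)\mid h^0(\mathcal{I}_{(2S,Y)}(1,\dots,1))>0\text{ and }\delta(2S,Y)>0\}.$$ $\mathcal{U}(n)$ is the set of isomorphism classes of multiprojective spaces of dimension $n$; $\mathcal{E}(n,r)$ is the set of pairs $(Y,S)$ with $Y\in\mathcal{U}(n)$ and $S\in\mathbb{T}_1(Y,r)$; and $\delta_1(n,r):=\max\{\delta(2S,Y)\mid (Y,S)\in\mathcal{E}(n,r)\}$.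 *)

theory Defs
  imports
    "HOL-Computational_Algebra.Computational_Algebra"
    "HOL-Library.Poly_Mapping"
    "HOL-Library.Function_Algebras"
    "HOL-Library.FuncSet"
begin

section \<open>Linear algebra\<close>

interpretation kvec: vector_space "\<lambda>(c::'a::field) (v::nat \<Rightarrow> 'a) i. c * v i"
  by unfold_locales (auto simp: fun_eq_iff algebra_simps)

text \<open>The elements of \<open>X\<close> represent a basis of the quotient space \<open>Z / B\<close>, for subspaces
  \<open>B \<subseteq> Z\<close> of a vector space with scalar multiplication \<open>scale\<close>.\<close>
definition quot_basis :: "('a::field \<Rightarrow> 'v::ab_group_add \<Rightarrow> 'v) \<Rightarrow> 'v set \<Rightarrow> 'v set \<Rightarrow> 'v set \<Rightarrow> bool" where
  "quot_basis scale Z B X \<longleftrightarrow>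
     X \<subseteq> Z \<and> module.span scale (B \<union> X) = Z \<and>
     (\<forall>x\<in>X. x \<notin> module.span scale (B \<union> (X - {x})))"

definition quot_dim :: "('a::field \<Rightarrow> 'v::ab_group_add \<Rightarrow> 'v) \<Rightarrow> 'v set \<Rightarrow> 'v set \<Rightarrow> nat" where
  "quot_dim scale Z B = card (SOME X. quot_basis scale Z B X)"

section \<open>Projective and multiprojective spaces\<close>

text \<open>A vector of \<open>K\<^sup>m\<^sup>+\<^sup>1\<close> is a function supported on \<open>{..m}\<close>; a point of \<open>P\<^sup>m\<close> is a
  one-dimensional subspace of \<open>K\<^sup>m\<^sup>+\<^sup>1\<close>.\<close>

definition kspace :: "nat \<Rightarrow> (nat \<Rightarrow> 'a::field) set" where
  "kspace m = {v. \<forall>j>m. v j = 0}"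

type_synonym 'a ppoint = "(nat \<Rightarrow> 'a) set"

definition proj_space :: "nat \<Rightarrow> 'a::field ppoint set" where
  "proj_space m = {P. kvec.subspace P \<and> P \<subseteq> kspace m \<and> kvec.dim P = 1}"

definition proj_linear :: "nat \<Rightarrow> (nat \<Rightarrow> 'a::field) set \<Rightarrow> 'a ppoint set" where
  "proj_linear m W = {P \<in> proj_space m. P \<subseteq> W}"

definition proj_line :: "nat \<Rightarrow> 'a::field ppoint set \<Rightarrow> bool" where
  "proj_line m L \<longleftrightarrow>
     (\<exists>W. kvec.subspace W \<and> W \<subseteq> kspace m \<and> kvec.dim W = 2 \<and> L = proj_linear m W)"

definition proj_span :: "nat \<Rightarrow> 'a::field ppoint set \<Rightarrow> 'a ppoint set" where
  "proj_span m A = proj_linear m (kvec.span (\<Union>A))"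

text \<open>\<open>P\<^sup>n\<^sup>1 \<times> \<dots> \<times> P\<^sup>n\<^sup>k\<close> is encoded by the list \<open>ns = [n1, \<dots>, nk]\<close>; the \<open>i\<close>-th projection
  is \<open>\<lambda>p. p i\<close>, with \<open>i\<close> counted from \<open>0\<close>.\<close>

type_synonym 'a mpoint = "nat \<Rightarrow> 'a ppoint"

definition mproj :: "nat list \<Rightarrow> 'a::field mpoint set" where
  "mproj ns = (\<Pi>\<^sub>E i\<in>{..<length ns}. proj_space (ns ! i))"

section \<open>Sections over products of standard affine charts\<close>

text \<open>Laurent polynomials in the multihomogeneous coordinates \<open>x\<^sub>i\<^sub>j\<close> (variable \<open>(i, j)\<close>,
  \<open>i\<close>-th factor, \<open>j\<close>-th coordinate).\<close>

type_synonym 'a laurent = "((nat \<times> nat) \<Rightarrow>\<^sub>0 int) \<Rightarrow>\<^sub>0 'a"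

definition laurent_eval :: "(nat \<Rightarrow> nat \<Rightarrow> 'a::field) \<Rightarrow> 'a laurent \<Rightarrow> 'a" where
  "laurent_eval x f =
     (\<Sum>m\<in>Poly_Mapping.keys f. Poly_Mapping.lookup f m *
        (\<Prod>v\<in>Poly_Mapping.keys m. x (fst v) (snd v) powi Poly_Mapping.lookup m v))"

text \<open>For a finite set \<open>J\<close> of variables let \<open>U\<^sub>J\<close> be the open subset of \<open>Y\<close> where all variables in
  \<open>J\<close> are nonzero. \<open>line_sections ns d J\<close> is the degree \<open>(d, \<dots>, d)\<close> part of the localization of
  the Cox ring at the product of the variables in \<open>J\<close>. If \<open>J\<close> contains a variable of every factor,
  then \<open>U\<^sub>J\<close> is affine and this is the space of sections of \<open>O\<^sub>Y(d, \<dots>, d)\<close> over \<open>U\<^sub>J\<close>.\<close>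

definition line_sections :: "nat list \<Rightarrow> int \<Rightarrow> (nat \<times> nat) set \<Rightarrow> 'a::field laurent set" where
  "line_sections ns d J = {f. \<forall>m\<in>Poly_Mapping.keys f.
     Poly_Mapping.keys m \<subseteq> {(i, j). i < length ns \<and> j \<le> ns ! i} \<and>
     (\<forall>i<length ns. (\<Sum>j\<le>ns ! i. Poly_Mapping.lookup m (i, j)) = d) \<and>
     (\<forall>v. Poly_Mapping.lookup m v < 0 \<longrightarrow> v \<in> J)}"

definition in_open :: "(nat \<times> nat) set \<Rightarrow> 'a::field mpoint \<Rightarrow> bool" where
  "in_open J p \<longleftrightarrow> (\<forall>(i, j)\<in>J. \<exists>v\<in>p i. v j \<noteq> 0)"

definition is_lift :: "nat list \<Rightarrow> 'a::field mpoint \<Rightarrow> (nat \<Rightarrow> nat \<Rightarrow> 'a) \<Rightarrow> bool" where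
  "is_lift ns p x \<longleftrightarrow> (\<forall>i<length ns. x i \<in> p i \<and> x i \<noteq> 0)"

text \<open>Sections of \<open>I\<^sub>p\<close> over \<open>U\<^sub>J\<close>. Sections of degree \<open>(0, \<dots>, 0)\<close> have the same value at all lifts
  of \<open>p\<close>; if \<open>p\<close> is not in \<open>U\<^sub>J\<close> there is no condition.\<close>
definition point_ideal :: "nat list \<Rightarrow> 'a::field mpoint \<Rightarrow> (nat \<times> nat) set \<Rightarrow> 'a laurent set" where
  "point_ideal ns p J = {f \<in> line_sections ns 0 J.
     in_open J p \<longrightarrow> (\<forall>x. is_lift ns p x \<longrightarrow> laurent_eval x f = 0)}"

text \<open>Sections over the affine set \<open>U\<^sub>J\<close> of \<open>(I\<^sub>p)\<^sup>2(1, \<dots>, 1)\<close>: the sheaves involved are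
  quasi-coherent, so these form the product of \<open>I\<^sub>p(U\<^sub>J)\<^sup>2\<close> with the module of sections of
  \<open>O\<^sub>Y(1, \<dots>, 1)\<close>.\<close>
definition double_point_sections ::
  "nat list \<Rightarrow> 'a::field mpoint \<Rightarrow> (nat \<times> nat) set \<Rightarrow> 'a laurent set" where
  "double_point_sections ns p J = {f. \<exists>(N::nat) g h s.
     (\<forall>t<N. g t \<in> point_ideal ns p J \<and> h t \<in> point_ideal ns p J \<and> s t \<in> line_sections ns 1 J) \<and>
     f = (\<Sum>t<N. g t * h t * s t)}"

text \<open>Sections of \<open>I\<^sub>(\<^sub>2\<^sub>S\<^sub>,\<^sub>Y\<^sub>)(1, \<dots>, 1)\<close>: the ideal sheaf of the union of the schemes \<open>(2p, Y)\<close>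
  is the intersection of their ideal sheaves.\<close>
definition double_sections ::
  "nat list \<Rightarrow> 'a::field mpoint set \<Rightarrow> (nat \<times> nat) set \<Rightarrow> 'a laurent set" where
  "double_sections ns S J =
     {f \<in> line_sections ns 1 J. \<forall>p\<in>S. f \<in> double_point_sections ns p J}"

section \<open>Cohomology\<close>

text \<open>Cohomology of a quasi-coherent sheaf on \<open>Y\<close>, given by its sections over the sets \<open>U\<^sub>J\<close>, is
  Cech cohomology with respect to the standard affine cover. A chart \<open>a\<close> selects a coordinate
  \<open>a i \<le> ns ! i\<close> in each factor; it is the open set where all \<open>x\<^sub>i\<^sub>,\<^sub>a\<^sub>(\<^sub>i\<^sub>)\<close> are nonzero. A
  \<open>q\<close>-cochain is a function on lists of \<open>q + 1\<close> charts, extended by \<open>0\<close> to all other lists.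
  This is the full (not necessarily alternating) Cech complex.\<close>

type_synonym chart = "nat \<Rightarrow> nat"
type_synonym 'a cochain = "chart list \<Rightarrow> 'a laurent"

definition charts :: "nat list \<Rightarrow> chart set" where
  "charts ns = (\<Pi>\<^sub>E i\<in>{..<length ns}. {..ns ! i})"

definition chart_vars :: "nat list \<Rightarrow> chart list \<Rightarrow> (nat \<times> nat) set" where
  "chart_vars ns l = {(i, a i) | i a. i < length ns \<and> a \<in> set l}"

definition cochains ::
  "nat list \<Rightarrow> ((nat \<times> nat) set \<Rightarrow> 'a::field laurent set) \<Rightarrow> nat \<Rightarrow> 'a cochain set" where
  "cochains ns F q = {c. \<forall>l.
     if length l = q + 1 \<and> set l \<subseteq> charts ns then c l \<in> F (chart_vars ns l) else c l = 0}"

definition cech_d :: "nat list \<Rightarrow> 'a::field cochain \<Rightarrow> 'a cochain" where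
  "cech_d ns c l = (if set l \<subseteq> charts ns
     then \<Sum>i<length l. (-1) ^ i * c (take i l @ drop (Suc i) l) else 0)"

definition cocycles ::
  "nat list \<Rightarrow> ((nat \<times> nat) set \<Rightarrow> 'a::field laurent set) \<Rightarrow> nat \<Rightarrow> 'a cochain set" where
  "cocycles ns F q = {c \<in> cochains ns F q. cech_d ns c = 0}"

fun coboundaries ::
  "nat list \<Rightarrow> ((nat \<times> nat) set \<Rightarrow> 'a::field laurent set) \<Rightarrow> nat \<Rightarrow> 'a cochain set" where
  "coboundaries ns F 0 = {0}"
| "coboundaries ns F (Suc q) = cech_d ns ` cochains ns F q"

definition cochain_scale :: "'a::field \<Rightarrow> 'a cochain \<Rightarrow> 'a cochain" where
  "cochain_scale r c = (\<lambda>l. Poly_Mapping.single 0 r * c l)"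

interpretation coch: vector_space cochain_scale
  by unfold_locales
    (auto simp: cochain_scale_def fun_eq_iff algebra_simps single_add mult_single
      simp flip: mult.assoc)

definition h_coh ::
  "nat list \<Rightarrow> ((nat \<times> nat) set \<Rightarrow> 'a::field laurent set) \<Rightarrow> nat \<Rightarrow> nat" where
  "h_coh ns F q = quot_dim cochain_scale (cocycles ns F q) (coboundaries ns F q)"

section \<open>Terracini loci\<close>

definition delta :: "nat list \<Rightarrow> 'a::field mpoint set \<Rightarrow> nat" where
  "delta ns S = h_coh ns (double_sections ns S) 1"

definition point_sets :: "nat list \<Rightarrow> nat \<Rightarrow> 'a::field mpoint set set" where
  "point_sets ns r = {S. S \<subseteq> mproj ns \<and> finite S \<and> card S = r}"

definition T1 :: "nat list \<Rightarrow> nat \<Rightarrow> 'a::field mpoint set set" where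
  "T1 ns r = {S \<in> point_sets ns r. h_coh ns (double_sections ns S) 0 > 0 \<and> delta ns S > 0}"

text \<open>Every isomorphism class of \<open>n\<close>-dimensional multiprojective spaces is represented, once for each
  ordering of its factors; \<open>delta\<close> is invariant under reordering the factors.\<close>
definition mproj_spaces :: "nat \<Rightarrow> nat list set" where
  "mproj_spaces n = {ns. (\<forall>d\<in>set ns. d > 0) \<and> sum_list ns = n}"

definition Epairs :: "nat \<Rightarrow> nat \<Rightarrow> (nat list \<times> 'a::field mpoint set) set" where
  "Epairs n r = {(ns, S). ns \<in> mproj_spaces n \<and> S \<in> T1 ns r}"

definition delta1 :: "'a::field itself \<Rightarrow> nat \<Rightarrow> nat \<Rightarrow> nat" where
  "delta1 _ n r = Max {delta ns S | ns (S :: 'a mpoint set). (ns, S) \<in> Epairs n r}"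

end

theory Submission
  imports Defs
begin

text \<open>Let \<open>T\<^sub>p\<close> be the space of first order jets at \<open>p\<close> of sections of \<open>O(1, \<dots>, 1)\<close>; it has dimension \<open>n + 1\<close>.
  The long exact sequence of the double points, together with \<open>h\<^sup>1(O(1, \<dots>, 1)) = 0\<close>, shows that
  \<open>\<delta>(2S, Y) = r (n + 1) - \<rho>\<close>, where \<open>\<rho>\<close> is the rank of the jet map from the multilinear forms to the
  sum of the \<open>T\<^sub>p\<close>, \<open>p \<in> S\<close>. At a single point the jet map is onto, so \<open>\<rho> = n + 1 + \<sigma>\<close> with \<open>\<sigma>\<close> the rank of the
  jet map on the forms that vanish doubly at a fixed \<open>p \<in> S\<close>. Such forms are supplied by products of
  linear forms with two factors vanishing at \<open>p\<close>; if \<open>q \<in> S\<close> differs from \<open>p\<close> in the \<open>i\<close>-th coordinate,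
  these have nonzero jets at \<open>q\<close>, and independent ones exist as soon as \<open>n - n\<^sub>i \<ge> 2\<close>. Hence \<open>\<sigma> \<ge> 1\<close>
  (a single projective space is excluded, since there no form vanishes doubly at a point), and
  \<open>\<sigma> = 1\<close> forces two factors, the other one being a line on which \<open>S\<close> is constant, and collinear projections to the \<open>i\<close>-th factor.\<close>

text \<open>The sections of the squared ideal are given algebraically, as sums of products, while
  the rank argument needs them as the sections whose value and derivatives vanish. The bridge is a
  first order Taylor expansion in the affine coordinates of a chart; on overlaps of charts some
  coordinates are invertible, so it must cover Laurent monomials with negative exponents.
  Derivatives are taken in all homogeneous coordinates of a chosen lift; Euler's relation in each
  factor makes one of them redundant, which leaves n + 1 numbers per point. The vanishing of
  h^1(O(1, ..., 1)) is realized by a primitive that depends linearly on the cocycle, so the exact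
  sequence becomes a linear map from cocycles to jets, and only dimensions of subspaces of a finite
  coordinate space remain. The bound is attained by r points on L x {o} with L = {x_2 = ... =
  x_(n-1) = 0} and o = {y_1 = 0}: among the 2 n monomials x_a y_b, those with a \<ge> 2 and b = 1
  contain two variables that vanish at every point of S, so at most n + 2 monomials have nonzero
  jets.\<close>

abbreviation lookup :: "('m \<Rightarrow>\<^sub>0 'a::zero) \<Rightarrow> 'm \<Rightarrow> 'a" where
  "lookup \<equiv> Poly_Mapping.lookup"

abbreviation single :: "'m \<Rightarrow> 'a \<Rightarrow> 'm \<Rightarrow>\<^sub>0 'a::zero" where
  "single \<equiv> Poly_Mapping.single"

abbreviation keys :: "('m \<Rightarrow>\<^sub>0 'a::zero) \<Rightarrow> 'm set" where
  "keys \<equiv> Poly_Mapping.keys"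

section \<open>Linear functionals on Laurent polynomials\<close>

text \<open>Evaluation and partial derivatives at a lift are linear in the coefficients, so both are
  obtained as extensions of functions on monomials.\<close>

definition lin_ext :: "('m \<Rightarrow> 'a) \<Rightarrow> ('m \<Rightarrow>\<^sub>0 'a::comm_ring_1) \<Rightarrow> 'a" where
  "lin_ext \<phi> f = (\<Sum>m\<in>keys f. lookup f m * \<phi> m)"

lemma lin_ext_superset:
  assumes "finite A" "keys f \<subseteq> A"
  shows "lin_ext \<phi> f = (\<Sum>m\<in>A. lookup f m * \<phi> m)"
  unfolding lin_ext_def using assms
  by (intro sum.mono_neutral_left) (auto simp: in_keys_iff)

lemma lin_ext_0 [simp]: "lin_ext \<phi> 0 = 0"
  by (simp add: lin_ext_def)

lemma lin_ext_add: "lin_ext \<phi> (f + g) = lin_ext \<phi> f + lin_ext \<phi> g"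
proof -
  let ?A = "keys f \<union> keys g"
  have "keys (f + g) \<subseteq> ?A" by (rule Poly_Mapping.keys_add)
  then show ?thesis
    by (simp add: lin_ext_superset[of ?A] lookup_add algebra_simps sum.distrib)
qed

lemma lin_ext_uminus: "lin_ext \<phi> (- f) = - lin_ext \<phi> f"
  using lin_ext_add[of \<phi> f "- f"] by (simp add: eq_neg_iff_add_eq_0 add.commute)

lemma lin_ext_diff: "lin_ext \<phi> (f - g) = lin_ext \<phi> f - lin_ext \<phi> g"
  using lin_ext_add[of \<phi> f "- g"] by (simp add: lin_ext_uminus)

lemma lin_ext_sum: "lin_ext \<phi> (\<Sum>i\<in>I. f i) = (\<Sum>i\<in>I. lin_ext \<phi> (f i))"
  by (induction I rule: infinite_finite_induct) (auto simp: lin_ext_add)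

lemma lin_ext_single [simp]: "lin_ext \<phi> (single m c) = c * \<phi> m"
  by (cases "c = 0") (auto simp: lin_ext_def)

lemma sum_single_keys:
  "f = (\<Sum>m\<in>keys f. single m (lookup f m))"
  by (rule poly_mapping_eqI)
    (auto simp: lookup_sum lookup_single when_def in_keys_iff)

lemma lookup_scale: "lookup (single 0 r * f) m = r * lookup f m"
  for f :: "'m::monoid_add \<Rightarrow>\<^sub>0 'a::comm_ring_1"
  unfolding mult_map_scale_conv_mult[symmetric]
  by (simp add: Poly_Mapping.map.rep_eq when_def)

lemma lin_ext_scale: "lin_ext \<phi> (single 0 r * f) = r * lin_ext \<phi> f"
  for f :: "'m::monoid_add \<Rightarrow>\<^sub>0 'a::comm_ring_1"
proof -
  have "keys (single 0 r * f) \<subseteq> keys f"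
    by (auto simp: in_keys_iff lookup_scale)
  then show ?thesis
    by (simp add: lin_ext_superset[of "keys f"] lookup_scale sum_distrib_left mult.assoc)
qed

lemma lin_ext_mult:
  fixes f g :: "'m::monoid_add \<Rightarrow>\<^sub>0 'a::comm_ring_1"
  shows "lin_ext \<phi> (f * g) = (\<Sum>m\<in>keys f. \<Sum>m'\<in>keys g.
           lookup f m * lookup g m' * \<phi> (m + m'))"
proof -
  have "f * g = (\<Sum>m\<in>keys f. \<Sum>m'\<in>keys g.
      single (m + m') (lookup f m * lookup g m'))"
    by (subst (1) sum_single_keys[of f], subst (1) sum_single_keys[of g])
      (simp add: sum_product mult_single)
  then show ?thesis by (simp add: lin_ext_sum)
qed

section \<open>Values and first derivatives of multihomogeneous Laurent polynomials\<close>

definition cox_vars :: "nat list \<Rightarrow> (nat \<times> nat) set" where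
  "cox_vars ns = {(i, j). i < length ns \<and> j \<le> ns ! i}"

lemma finite_cox_vars [simp]: "finite (cox_vars ns)"
proof -
  have "cox_vars ns = (SIGMA i:{..<length ns}. {..ns ! i})" by (auto simp: cox_vars_def)
  then show ?thesis by simp
qed

definition multideg :: "nat list \<Rightarrow> (nat \<times> nat \<Rightarrow>\<^sub>0 int) \<Rightarrow> nat \<Rightarrow> int" where
  "multideg ns m i = (\<Sum>j\<le>ns ! i. lookup m (i, j))"

lemma multideg_add: "multideg ns (m + m') i = multideg ns m i + multideg ns m' i"
  by (simp add: multideg_def lookup_add sum.distrib)

text \<open>The degree may vary with the factor, unlike in \<open>line_sections\<close>: a linear
  form in one factor has degree 1 there and 0 elsewhere, and twisting a section to degree 0 uses
  degree -1.\<close>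

definition adm :: "nat list \<Rightarrow> (nat \<Rightarrow> int) \<Rightarrow> (nat \<times> nat) set \<Rightarrow> (nat \<times> nat \<Rightarrow>\<^sub>0 int) set" where
  "adm ns d J = {m. keys m \<subseteq> cox_vars ns \<and> (\<forall>i<length ns. multideg ns m i = d i) \<and>
     (\<forall>v. lookup m v < 0 \<longrightarrow> v \<in> J)}"

lemma adm_add: "m \<in> adm ns d J \<Longrightarrow> m' \<in> adm ns e J \<Longrightarrow> m + m' \<in> adm ns (\<lambda>i. d i + e i) J"
  using Poly_Mapping.keys_add[of m m'] unfolding adm_def
  by (auto simp: multideg_add lookup_add) (metis add_nonneg_nonneg not_le)

definition sections :: "nat list \<Rightarrow> (nat \<Rightarrow> int) \<Rightarrow> (nat \<times> nat) set \<Rightarrow> 'a::field laurent set" where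
  "sections ns d J = {f. keys f \<subseteq> adm ns d J}"

lemma line_sections_eq: "line_sections ns d J = sections ns (\<lambda>_. d) J"
  by (auto simp: line_sections_def sections_def adm_def cox_vars_def multideg_def)

lemma sections_0 [simp]: "0 \<in> sections ns d J"
  by (simp add: sections_def)

lemma sections_add: "f \<in> sections ns d J \<Longrightarrow> g \<in> sections ns d J \<Longrightarrow> f + g \<in> sections ns d J"
  unfolding sections_def using Poly_Mapping.keys_add[of f g] by auto

lemma sections_uminus: "f \<in> sections ns d J \<Longrightarrow> - f \<in> sections ns d J"
  unfolding sections_def by auto

lemma sections_diff: "f \<in> sections ns d J \<Longrightarrow> g \<in> sections ns d J \<Longrightarrow> f - g \<in> sections ns d J"
  using sections_add[of f ns d J "- g"] sections_uminus[of g ns d J] by simp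

lemma sections_sum: "(\<And>i. i \<in> I \<Longrightarrow> f i \<in> sections ns d J) \<Longrightarrow> (\<Sum>i\<in>I. f i) \<in> sections ns d J"
  by (induction I rule: infinite_finite_induct) (auto intro: sections_add)

lemma sections_mult:
  assumes "f \<in> sections ns d J" "g \<in> sections ns e J" "\<And>i. i < length ns \<Longrightarrow> d i + e i = d' i"
  shows "f * g \<in> sections ns d' J"
proof -
  have "keys (f * g) \<subseteq> adm ns (\<lambda>i. d i + e i) J"
    using assms keys_mult[of f g] unfolding sections_def by (auto intro!: adm_add)
  then show ?thesis
    using assms(3) by (auto simp: sections_def adm_def subset_iff)
qed

lemma sections_scale: "f \<in> sections ns d J \<Longrightarrow> single 0 r * f \<in> sections ns d J"
  by (auto simp: sections_def subset_iff in_keys_iff lookup_scale)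

lemma sections_single: "m \<in> adm ns d J \<Longrightarrow> single m c \<in> sections ns d J"
  by (cases "c = 0") (auto simp: sections_def)

lemma sections_mono: "J \<subseteq> J' \<Longrightarrow> sections ns d J \<subseteq> sections ns d J'"
  unfolding sections_def adm_def by blast

lemma sections_const: "single 0 c \<in> sections ns (\<lambda>_. 0) J"
  by (intro sections_single) (auto simp: adm_def multideg_def)

definition mono_val :: "nat list \<Rightarrow> (nat \<Rightarrow> nat \<Rightarrow> 'a::field) \<Rightarrow> (nat \<times> nat \<Rightarrow>\<^sub>0 int) \<Rightarrow> 'a" where
  "mono_val ns x m = (\<Prod>v\<in>cox_vars ns. x (fst v) (snd v) powi lookup m v)"

text \<open>The formal partial derivative in the variable \<open>w\<close>. If \<open>w\<close> does
  not occur in \<open>m\<close>, the coefficient 0 kills the power with exponent -1, also where the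
  coordinate is 0.\<close>

definition mono_deriv :: "nat list \<Rightarrow> (nat \<Rightarrow> nat \<Rightarrow> 'a::field) \<Rightarrow> nat \<times> nat \<Rightarrow> (nat \<times> nat \<Rightarrow>\<^sub>0 int) \<Rightarrow> 'a" where
  "mono_deriv ns x w m = of_int (lookup m w) *
     x (fst w) (snd w) powi (lookup m w - 1) *
     (\<Prod>v\<in>cox_vars ns - {w}. x (fst v) (snd v) powi lookup m v)"

definition val :: "nat list \<Rightarrow> (nat \<Rightarrow> nat \<Rightarrow> 'a::field) \<Rightarrow> 'a laurent \<Rightarrow> 'a" where
  "val ns x = lin_ext (mono_val ns x)"

definition deriv :: "nat list \<Rightarrow> (nat \<Rightarrow> nat \<Rightarrow> 'a::field) \<Rightarrow> nat \<times> nat \<Rightarrow> 'a laurent \<Rightarrow> 'a" where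
  "deriv ns x w = lin_ext (mono_deriv ns x w)"

lemmas val_linear = lin_ext_add[of "mono_val ns x" for ns x, folded val_def]
  lin_ext_diff[of "mono_val ns x" for ns x, folded val_def]
  lin_ext_uminus[of "mono_val ns x" for ns x, folded val_def]
  lin_ext_sum[of "mono_val ns x" for ns x, folded val_def]
  lin_ext_scale[of "mono_val ns x" for ns x, folded val_def]
  lin_ext_single[of "mono_val ns x" for ns x, folded val_def]

lemmas deriv_linear = lin_ext_add[of "mono_deriv ns x w" for ns x w, folded deriv_def]
  lin_ext_diff[of "mono_deriv ns x w" for ns x w, folded deriv_def]
  lin_ext_uminus[of "mono_deriv ns x w" for ns x w, folded deriv_def]
  lin_ext_sum[of "mono_deriv ns x w" for ns x w, folded deriv_def]
  lin_ext_scale[of "mono_deriv ns x w" for ns x w, folded deriv_def]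
  lin_ext_single[of "mono_deriv ns x w" for ns x w, folded deriv_def]

lemma laurent_eval_eq_val:
  assumes "f \<in> sections ns d J"
  shows "laurent_eval x f = val ns x f"
proof -
  have "(\<Prod>v\<in>keys m. x (fst v) (snd v) powi lookup m v) = mono_val ns x m"
    if "m \<in> keys f" for m
    unfolding mono_val_def
    using assms that by (intro prod.mono_neutral_left) (auto simp: sections_def adm_def in_keys_iff)
  then show ?thesis
    by (auto simp: laurent_eval_def val_def lin_ext_def intro!: sum.cong)
qed

definition nonzero_on :: "(nat \<times> nat) set \<Rightarrow> (nat \<Rightarrow> nat \<Rightarrow> 'a::field) \<Rightarrow> bool" where
  "nonzero_on J x \<longleftrightarrow> (\<forall>(i, j)\<in>J. x i j \<noteq> 0)"

lemma powi_add_adm: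
  fixes y :: "'a::field"
  assumes "y \<noteq> 0 \<or> (a \<ge> 0 \<and> b \<ge> 0)"
  shows "y powi (a + b) = y powi a * y powi b"
  using assms by (cases "a = 0"; cases "b = 0") (auto intro!: power_int_add)

lemma powi_deriv_add_adm:
  fixes y :: "'a::field"
  assumes "y \<noteq> 0 \<or> (a \<ge> 0 \<and> b \<ge> 0)"
  shows "of_int (a + b) * y powi (a + b - 1) =
    of_int a * y powi (a - 1) * y powi b + y powi a * (of_int b * y powi (b - 1))"
proof (cases "y = 0")
  case True
  with assms have "a \<ge> 0" "b \<ge> 0" by auto
  then show ?thesis using True
    by (cases "a = 0"; cases "b = 0"; cases "a = 1"; cases "b = 1")
      (auto simp: power_int_0_left_if)
next
  case False
  have 1: "y powi (a + b - 1) = y powi (a - 1) * y powi b"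
    using False power_int_add[of y "a - 1" b] by (simp add: algebra_simps)
  have 2: "y powi (a + b - 1) = y powi a * y powi (b - 1)"
    using False power_int_add[of y a "b - 1"] by (simp add: algebra_simps)
  have "of_int (a + b) * y powi (a + b - 1) = of_int a * y powi (a + b - 1) + of_int b * y powi (a + b - 1)"
    by (simp add: algebra_simps)
  also have "of_int a * y powi (a + b - 1) = of_int a * (y powi (a - 1) * y powi b)" by (simp only: 1)
  also have "of_int b * y powi (a + b - 1) = of_int b * (y powi a * y powi (b - 1))" by (simp only: 2)
  finally show ?thesis by (simp add: algebra_simps)
qed

text \<open>A variable with a negative exponent lies in \<open>J\<close>, hence is nonzero at
  \<open>x\<close>. This is exactly what makes exponents additive under \<open>powi\<close>, where 0
  has no proper negative powers.\<close>

lemma adm_cond: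
  assumes "m \<in> adm ns d J" "m' \<in> adm ns e J" "nonzero_on J x"
  shows "x (fst v) (snd v) \<noteq> 0 \<or> lookup m v \<ge> 0 \<and> lookup m' v \<ge> 0"
  using assms unfolding adm_def nonzero_on_def by (cases v) (force simp: not_le[symmetric])

lemma mono_val_add:
  assumes "m \<in> adm ns d J" "m' \<in> adm ns e J" "nonzero_on J x"
  shows "mono_val ns x (m + m') = mono_val ns x m * mono_val ns x m'"
  unfolding mono_val_def prod.distrib[symmetric] lookup_add
  by (intro prod.cong refl powi_add_adm adm_cond[OF assms])

lemma mono_val_remove:
  "w \<in> cox_vars ns \<Longrightarrow> mono_val ns x m = x (fst w) (snd w) powi lookup m w *
    (\<Prod>v\<in>cox_vars ns - {w}. x (fst v) (snd v) powi lookup m v)"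
  unfolding mono_val_def by (rule prod.remove) auto

lemma mono_deriv_add:
  assumes "m \<in> adm ns d J" "m' \<in> adm ns e J" "nonzero_on J x" "w \<in> cox_vars ns"
  shows "mono_deriv ns x w (m + m') =
    mono_deriv ns x w m * mono_val ns x m' + mono_val ns x m * mono_deriv ns x w m'"
proof -
  let ?y = "x (fst w) (snd w)"
  let ?P = "\<lambda>m. \<Prod>v\<in>cox_vars ns - {w}. x (fst v) (snd v) powi lookup m v"
  let ?a = "lookup m w" and ?b = "lookup m' w"
  have P: "?P (m + m') = ?P m * ?P m'"
    unfolding prod.distrib[symmetric] lookup_add
    by (intro prod.cong refl powi_add_adm adm_cond[OF assms(1-3)])
  have "mono_deriv ns x w (m + m') = (of_int (?a + ?b) * ?y powi (?a + ?b - 1)) * (?P m * ?P m')"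
    unfolding mono_deriv_def P by (simp add: lookup_add)
  also have "\<dots> = (of_int ?a * ?y powi (?a - 1) * ?y powi ?b +
      ?y powi ?a * (of_int ?b * ?y powi (?b - 1))) * (?P m * ?P m')"
    by (subst powi_deriv_add_adm[OF adm_cond[OF assms(1-3)]]) simp
  also have "\<dots> = mono_deriv ns x w m * mono_val ns x m' + mono_val ns x m * mono_deriv ns x w m'"
    unfolding mono_deriv_def mono_val_remove[OF assms(4)] by (simp add: algebra_simps)
  finally show ?thesis .
qed

lemma val_mult:
  assumes "f \<in> sections ns d J" "g \<in> sections ns e J" "nonzero_on J x"
  shows "val ns x (f * g) = val ns x f * val ns x g"
proof -
  have "val ns x (f * g) = (\<Sum>m\<in>keys f. \<Sum>m'\<in>keys g.
      (lookup f m * mono_val ns x m) * (lookup g m' * mono_val ns x m'))"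
    unfolding val_def lin_ext_mult using assms
    by (intro sum.cong refl, subst mono_val_add[of _ ns d J _ e]) (auto simp: sections_def)
  then show ?thesis by (simp add: val_def lin_ext_def sum_product)
qed

lemma deriv_mult:
  assumes "f \<in> sections ns d J" "g \<in> sections ns e J" "nonzero_on J x" "w \<in> cox_vars ns"
  shows "deriv ns x w (f * g) = deriv ns x w f * val ns x g + val ns x f * deriv ns x w g"
proof -
  have "deriv ns x w (f * g) = (\<Sum>m\<in>keys f. \<Sum>m'\<in>keys g.
      (lookup f m * mono_deriv ns x w m) * (lookup g m' * mono_val ns x m') +
      (lookup f m * mono_val ns x m) * (lookup g m' * mono_deriv ns x w m'))"
    unfolding deriv_def lin_ext_mult using assms
    by (intro sum.cong refl, subst mono_deriv_add[of _ ns d J _ e]) (auto simp: sections_def algebra_simps)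
  then show ?thesis by (simp add: deriv_def val_def lin_ext_def sum_product sum.distrib)
qed

lemma euler_mono:
  assumes "i < length ns"
  shows "(\<Sum>j\<le>ns ! i. x i j * mono_deriv ns x (i, j) m) = of_int (multideg ns m i) * mono_val ns x m"
proof -
  have "x i j * mono_deriv ns x (i, j) m = of_int (lookup m (i, j)) * mono_val ns x m"
    if "j \<le> ns ! i" for j
  proof -
    have w: "(i, j) \<in> cox_vars ns" using assms that by (simp add: cox_vars_def)
    have "of_int a * (x i j * x i j powi (a - 1)) = of_int a * x i j powi a" for a
      by (cases "a = 0"; cases "x i j = 0") (auto simp: power_int_minus_mult mult.commute[of "x i j"])
    from this[of "lookup m (i, j)"] show ?thesis
      unfolding mono_deriv_def mono_val_remove[OF w] by (simp add: algebra_simps) (metis mult.assoc mult.commute)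
  qed
  then show ?thesis by (simp add: multideg_def sum_distrib_right)
qed

text \<open>Euler's relation for the variables of one factor. It will determine the derivative in a
  pivot variable from the value and the other derivatives of that factor.\<close>

lemma euler:
  assumes "f \<in> sections ns d J" "i < length ns"
  shows "(\<Sum>j\<le>ns ! i. x i j * deriv ns x (i, j) f) = of_int (d i) * val ns x f"
proof -
  have "(\<Sum>j\<le>ns ! i. x i j * deriv ns x (i, j) f) =
    (\<Sum>m\<in>keys f. lookup f m * (\<Sum>j\<le>ns ! i. x i j * mono_deriv ns x (i, j) m))"
    unfolding deriv_def lin_ext_def sum_distrib_left by (subst sum.swap) (simp add: algebra_simps)
  also have "\<dots> = (\<Sum>m\<in>keys f. lookup f m * (of_int (d i) * mono_val ns x m))"
    using assms by (intro sum.cong refl, subst euler_mono) (auto simp: sections_def adm_def subset_iff)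
  finally show ?thesis by (simp add: val_def lin_ext_def sum_distrib_left algebra_simps)
qed

section \<open>Points and their lifts\<close>

lemma proj_space_iff:
  "P \<in> proj_space m \<longleftrightarrow> (\<exists>v. v \<noteq> 0 \<and> v \<in> kspace m \<and> P = range (\<lambda>c i. c * v i))"
proof
  assume P: "P \<in> proj_space m"
  then have sub: "kvec.subspace P" and k: "P \<subseteq> kspace m" and d: "kvec.dim P = 1"
    by (auto simp: proj_space_def)
  obtain B where B: "B \<subseteq> P" "kvec.independent B" "P \<subseteq> kvec.span B" "card B = kvec.dim P"
    using kvec.basis_exists by blast
  then obtain v where v: "B = {v}" using d card_1_singletonE by metis
  have "P = kvec.span {v}"
    using B(1,3) sub unfolding v by (intro subset_antisym kvec.span_minimal)
  moreover have "v \<noteq> 0" using B(2) unfolding v kvec.dependent_single by simp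
  moreover have "v \<in> kspace m" using B v k by auto
  ultimately show "\<exists>v. v \<noteq> 0 \<and> v \<in> kspace m \<and> P = range (\<lambda>c i. c * v i)"
    unfolding kvec.span_singleton by (intro exI[of _ v] conjI)
next
  assume "\<exists>v. v \<noteq> 0 \<and> v \<in> kspace m \<and> P = range (\<lambda>c i. c * v i)"
  then obtain v where v: "v \<noteq> 0" "v \<in> kspace m" "P = kvec.span {v}"
    unfolding kvec.span_singleton by metis
  have "kvec.independent {v}" using v(1) unfolding kvec.dependent_single by simp
  then have "kvec.dim P = 1"
    unfolding v(3) by (subst kvec.dim_span_eq_card_independent) auto
  moreover have "P \<subseteq> kspace m"
    using v(2) unfolding v(3) kvec.span_singleton by (auto simp: kspace_def)
  moreover have "kvec.subspace P" unfolding v(3) by (rule kvec.subspace_span)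
  ultimately show "P \<in> proj_space m"
    unfolding proj_space_def by blast
qed

definition pivot :: "'a::field mpoint \<Rightarrow> nat \<Rightarrow> nat" where
  "pivot p i = (SOME j. \<exists>v\<in>p i. v j \<noteq> 0)"

text \<open>All values and derivatives below are taken at this one representative, whose pivot
  coordinates are 1; so a jet becomes a vector of numbers attached to the point.\<close>

definition lift :: "'a::field mpoint \<Rightarrow> nat \<Rightarrow> nat \<Rightarrow> 'a" where
  "lift p i = (SOME v. v \<in> p i \<and> v (pivot p i) = 1)"

lemma
  assumes "p \<in> mproj ns" "i < length ns"
  shows lift_in: "lift p i \<in> p i" and lift_pivot: "lift p i (pivot p i) = 1"
    and pivot_le: "pivot p i \<le> ns ! i" and point_eq: "p i = range (\<lambda>c j. c * lift p i j)"
    and lift_kspace: "lift p i \<in> kspace (ns ! i)"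
proof -
  have "p i \<in> proj_space (ns ! i)" using assms by (auto simp: mproj_def)
  then obtain v where v: "v \<noteq> 0" "v \<in> kspace (ns ! i)" "p i = range (\<lambda>c j. c * v j)"
    unfolding proj_space_iff by blast
  have v_in: "v \<in> p i" unfolding v(3) by (rule range_eqI[of _ _ 1]) auto
  obtain j where "v j \<noteq> 0" using v(1) by (auto simp: fun_eq_iff)
  then have "\<exists>j. \<exists>v\<in>p i. v j \<noteq> 0" using v_in by blast
  then have "\<exists>w\<in>p i. w (pivot p i) \<noteq> 0" unfolding pivot_def by (rule someI_ex)
  then have vp: "v (pivot p i) \<noteq> 0" unfolding v(3) by auto
  then have "(\<lambda>j. v j / v (pivot p i)) \<in> p i \<and> (\<lambda>j. v j / v (pivot p i)) (pivot p i) = 1"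
    unfolding v(3) by (auto simp: fun_eq_iff field_simps intro!: range_eqI[of _ _ "1 / v (pivot p i)"])
  then have l: "lift p i \<in> p i \<and> lift p i (pivot p i) = 1"
    unfolding lift_def by (rule someI[where P = "\<lambda>v. v \<in> p i \<and> v (pivot p i) = 1"])
  then show "lift p i \<in> p i" "lift p i (pivot p i) = 1" by auto
  show "pivot p i \<le> ns ! i" using vp v(2) by (force simp: kspace_def not_le[symmetric])
  obtain c where c: "lift p i = (\<lambda>j. c * v j)" using l v(3) by auto
  then have "c \<noteq> 0" using l by auto
  then have e: "(\<lambda>j. b * v j) = (\<lambda>j. b / c * lift p i j)" for b using c by (simp add: fun_eq_iff)
  show "p i = range (\<lambda>c j. c * lift p i j)"
  proof
    show "p i \<subseteq> range (\<lambda>c j. c * lift p i j)" unfolding v(3) e by (intro image_subsetI rangeI)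
    show "range (\<lambda>c j. c * lift p i j) \<subseteq> p i" unfolding v(3) c
      by (auto simp: mult.assoc[symmetric])
  qed
  show "lift p i \<in> kspace (ns ! i)" using c v(2) by (auto simp: kspace_def)
qed

lemma lift_is_lift: "p \<in> mproj ns \<Longrightarrow> is_lift ns p (lift p)"
  using lift_in lift_pivot unfolding is_lift_def by (metis zero_fun_apply zero_neq_one)

lemma in_open_iff:
  assumes "p \<in> mproj ns" "J \<subseteq> cox_vars ns"
  shows "in_open J p \<longleftrightarrow> nonzero_on J (lift p)"
proof -
  have "(\<exists>v\<in>p i. v j \<noteq> 0) \<longleftrightarrow> lift p i j \<noteq> 0" if "(i, j) \<in> J" for i j
  proof -
    have "i < length ns" using that assms(2) by (auto simp: cox_vars_def)
    from point_eq[OF assms(1) this] show ?thesis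
      using lift_in[OF assms(1) \<open>i < length ns\<close>] by auto
  qed
  then show ?thesis unfolding in_open_def nonzero_on_def by blast
qed

lemma cox_vars_Sigma: "cox_vars ns = (SIGMA i:{..<length ns}. {..ns ! i})"
  by (auto simp: cox_vars_def)

lemma powi_sum:
  "c \<noteq> 0 \<Longrightarrow> (\<Prod>j\<in>A. c powi f j) = (c::'a::field) powi (\<Sum>j\<in>A. f j)"
  by (induction A rule: infinite_finite_induct) (auto simp: power_int_add)

text \<open>Rescaling the coordinates of factor \<open>i\<close> by \<open>c i\<close> multiplies a
  monomial by \<open>c i\<close> to the power of its degree in that factor, which is 0.\<close>

lemma val_lift_indep:
  assumes "p \<in> mproj ns" "is_lift ns p x" "f \<in> sections ns (\<lambda>_. 0) J"
  shows "val ns x f = val ns (lift p) f"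
proof -
  have "\<exists>c. c \<noteq> 0 \<and> (\<forall>j. x i j = c * lift p i j)" if i: "i < length ns" for i
  proof -
    have "x i \<in> p i" "x i \<noteq> 0" using assms(2) i by (auto simp: is_lift_def)
    then obtain c where "x i = (\<lambda>j. c * lift p i j)" using point_eq[OF assms(1) i] by auto
    with \<open>x i \<noteq> 0\<close> show ?thesis by (intro exI[of _ c]) (auto simp: fun_eq_iff)
  qed
  then obtain c where c: "\<And>i. i < length ns \<Longrightarrow> c i \<noteq> 0 \<and> (\<forall>j. x i j = c i * lift p i j)"
    by metis
  have "mono_val ns x m = mono_val ns (lift p) m" if m: "m \<in> adm ns (\<lambda>_. 0) J" for m
  proof -
    have "mono_val ns x m = (\<Prod>v\<in>cox_vars ns. c (fst v) powi lookup m v *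
        lift p (fst v) (snd v) powi lookup m v)"
      unfolding mono_val_def using c
      by (intro prod.cong refl) (auto simp: cox_vars_def power_int_mult_distrib)
    also have "\<dots> = (\<Prod>v\<in>cox_vars ns. c (fst v) powi lookup m v) * mono_val ns (lift p) m"
      by (simp add: mono_val_def prod.distrib)
    also have "(\<Prod>v\<in>cox_vars ns. c (fst v) powi lookup m v) =
        (\<Prod>i<length ns. \<Prod>j\<le>ns ! i. c i powi lookup m (i, j))"
      unfolding cox_vars_Sigma by (simp add: prod.Sigma case_prod_unfold)
    also have "\<dots> = (\<Prod>i<length ns. c i powi multideg ns m i)"
      using c by (intro prod.cong refl) (simp add: powi_sum multideg_def)
    also have "\<dots> = 1" using m by (intro prod.neutral) (auto simp: adm_def)
    finally show ?thesis by simp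
  qed
  then show ?thesis using assms(3)
    by (auto simp: val_def lin_ext_def sections_def intro!: sum.cong)
qed

lemma point_ideal_iff:
  assumes "p \<in> mproj ns" "J \<subseteq> cox_vars ns"
  shows "f \<in> point_ideal ns p J \<longleftrightarrow>
    f \<in> sections ns (\<lambda>_. 0) J \<and> (nonzero_on J (lift p) \<longrightarrow> val ns (lift p) f = 0)"
proof -
  have "(\<forall>x. is_lift ns p x \<longrightarrow> laurent_eval x f = 0) \<longleftrightarrow> val ns (lift p) f = 0"
    if f: "f \<in> sections ns (\<lambda>_. 0) J"
    unfolding laurent_eval_eq_val[OF f]
    using val_lift_indep[OF assms(1) _ f] lift_is_lift[OF assms(1)] by metis
  then show ?thesis
    unfolding point_ideal_def line_sections_eq in_open_iff[OF assms] by blast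
qed

section \<open>The square of the ideal of a point\<close>

text \<open>The additive span of the products that define the squared ideal, in inductive form. The
  degree \<open>d\<close> is left free because the Taylor expansion takes place in degree 0 and is
  then twisted to degree 1.\<close>

inductive_set sq_ideal for ns d J x where
  zero: "0 \<in> sq_ideal ns d J x"
| add: "f \<in> sq_ideal ns d J x \<Longrightarrow> g \<in> sections ns (\<lambda>_. 0) J \<Longrightarrow> val ns x g = 0 \<Longrightarrow>
    h \<in> sections ns (\<lambda>_. 0) J \<Longrightarrow> val ns x h = 0 \<Longrightarrow> s \<in> sections ns d J \<Longrightarrow>
    f + g * h * s \<in> sq_ideal ns d J x"

lemma sq_ideal_mult: 
  assumes "g \<in> sections ns (\<lambda>_. 0) J" "val ns x g = 0" "h \<in> sections ns (\<lambda>_. 0) J" "val ns x h = 0"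
    "s \<in> sections ns d J"
  shows "g * h * s \<in> sq_ideal ns d J x"
  using sq_ideal.add[OF sq_ideal.zero assms] by simp

lemma sq_ideal_add:
  assumes "f \<in> sq_ideal ns d J x" "g \<in> sq_ideal ns d J x"
  shows "f + g \<in> sq_ideal ns d J x"
  using assms(2)
proof induction
  case zero
  then show ?case using assms(1) by simp
next
  case (add g u v s)
  have "f + (g + u * v * s) = (f + g) + u * v * s" by (simp add: algebra_simps)
  with add show ?case using sq_ideal.add by metis
qed

lemma sq_ideal_times:
  assumes "f \<in> sq_ideal ns d J x" "s \<in> sections ns e J" "\<And>i. i < length ns \<Longrightarrow> d i + e i = d' i"
  shows "f * s \<in> sq_ideal ns d' J x"
  using assms(1)
proof induction
  case zero
  then show ?case by (simp add: sq_ideal.zero)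
next
  case (add f g h t)
  have "(f + g * h * t) * s = f * s + g * h * (t * s)" by (simp add: algebra_simps)
  moreover have "t * s \<in> sections ns d' J" using add assms by (intro sections_mult) auto
  ultimately show ?case using add by (metis sq_ideal.add)
qed

lemma sq_ideal_double_point:
  assumes "f \<in> sq_ideal ns (\<lambda>_. 1) J (lift p)" "p \<in> mproj ns" "J \<subseteq> cox_vars ns"
  shows "f \<in> double_point_sections ns p J"
  using assms(1)
proof induction
  case zero
  then show ?case unfolding double_point_sections_def by (intro CollectI exI[of _ 0]) auto
next
  case (add f u v s)
  then obtain N :: nat and g h t where
    *: "\<And>k. k < N \<Longrightarrow> g k \<in> point_ideal ns p J \<and> h k \<in> point_ideal ns p J \<and> t k \<in> line_sections ns 1 J"
    "f = (\<Sum>k<N. g k * h k * t k)"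
    unfolding double_point_sections_def by auto
  have "u \<in> point_ideal ns p J" "v \<in> point_ideal ns p J" "s \<in> line_sections ns 1 J"
    using add assms by (auto simp: point_ideal_iff line_sections_eq)
  then show ?case unfolding double_point_sections_def
    using * by (intro CollectI exI[of _ "Suc N"] exI[of _ "g(N := u)"] exI[of _ "h(N := v)"] exI[of _ "t(N := s)"])
      (auto simp: less_Suc_eq)
qed

section \<open>Affine coordinates on a chart and first order Taylor expansion\<close>

definition ratio_exp :: "(nat \<Rightarrow> nat) \<Rightarrow> nat \<times> nat \<Rightarrow> int \<Rightarrow> (nat \<times> nat \<Rightarrow>\<^sub>0 int)" where
  "ratio_exp a w k = single w k - single (fst w, a (fst w)) k"

text \<open>The \<open>k\<close>-th power, with \<open>k\<close> possibly negative, of the affine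
  coordinate of the chart \<open>a\<close> belonging to \<open>w\<close>: the variable
  \<open>w\<close> divided by the variable that \<open>a\<close> selects in the same factor.\<close>

definition ratio :: "(nat \<Rightarrow> nat) \<Rightarrow> nat \<times> nat \<Rightarrow> int \<Rightarrow> 'a::field laurent" where
  "ratio a w k = single (ratio_exp a w k) 1"

lemma ratio_add: "ratio a w (k + l) = ratio a w k * ratio a w l"
  by (simp add: ratio_def ratio_exp_def mult_single single_add algebra_simps)

lemma ratio_0 [simp]: "ratio a w 0 = 1"
  by (simp add: ratio_def ratio_exp_def)

lemma ratio_pivot [simp]: "ratio a (i, a i) k = 1"
  by (simp add: ratio_def ratio_exp_def)

definition pivots :: "nat list \<Rightarrow> (nat \<Rightarrow> nat) \<Rightarrow> (nat \<times> nat) set" where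
  "pivots ns a = {(i, a i) | i. i < length ns}"

lemma ratio_exp_adm:
  assumes "w \<in> cox_vars ns" "pivots ns a \<subseteq> J" "J \<subseteq> cox_vars ns" "k \<ge> 0 \<or> w \<in> J"
  shows "ratio_exp a w k \<in> adm ns (\<lambda>_. 0) J"
proof -
  obtain i j where w: "w = (i, j)" by (cases w)
  have ij: "i < length ns" "j \<le> ns ! i" using assms(1) by (auto simp: w cox_vars_def)
  have p: "(i, a i) \<in> J" "(i, a i) \<in> cox_vars ns" using ij assms by (auto simp: pivots_def)
  have ai: "a i \<le> ns ! i" using p by (auto simp: cox_vars_def)
  have l: "lookup (ratio_exp a (i, j) k) v = (if v = (i, j) then k else 0) - (if v = (i, a i) then k else 0)" for v
    by (auto simp: ratio_exp_def w lookup_minus lookup_single when_def)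
  have "multideg ns (ratio_exp a w k) i' = 0" for i'
    using ij ai by (cases "i' = i") (auto simp: multideg_def l w sum_subtractf sum.delta)
  moreover have "keys (ratio_exp a w k) \<subseteq> cox_vars ns"
    using p assms(1) by (auto simp: in_keys_iff l w split: if_splits)
  moreover have "v \<in> J" if "lookup (ratio_exp a w k) v < 0" for v
    using that p assms(4) by (auto simp: l w split: if_splits)
  ultimately show ?thesis by (auto simp: adm_def)
qed

lemma ratio_sections:
  assumes "w \<in> cox_vars ns" "pivots ns a \<subseteq> J" "J \<subseteq> cox_vars ns" "k \<ge> 0 \<or> w \<in> J"
  shows "ratio a w k \<in> sections ns (\<lambda>_. 0) J"
  unfolding ratio_def by (intro sections_single ratio_exp_adm assms)

lemma deriv_const: "deriv ns x w (single 0 c) = 0"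
  by (simp add: deriv_linear mono_deriv_def)

lemma val_const: "val ns x (single 0 c) = c"
  by (simp add: val_linear mono_val_def)

lemma val_one [simp]: "val ns x 1 = 1"
  using val_const[of ns x 1] by simp

lemma deriv_one [simp]: "deriv ns x w 1 = 0"
  using deriv_const[of ns x w 1] by simp

lemma
  assumes "w \<in> cox_vars ns" "pivots ns a \<subseteq> J" "J \<subseteq> cox_vars ns" "snd w \<noteq> a (fst w)"
  shows val_ratio: "val ns x (ratio a w 1) = x (fst w) (snd w) / x (fst w) (a (fst w))"
    and deriv_ratio: "w' \<in> cox_vars ns \<Longrightarrow> snd w' \<noteq> a (fst w') \<Longrightarrow>
      deriv ns x w' (ratio a w 1) = (if w' = w then 1 / x (fst w) (a (fst w)) else 0)"
proof -
  obtain i j where w: "w = (i, j)" by (cases w)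
  have ij: "i < length ns" "j \<noteq> a i" using assms by (auto simp: w cox_vars_def)
  have p: "(i, a i) \<in> cox_vars ns" using ij assms by (auto simp: pivots_def)
  have l: "lookup (ratio_exp a (i, j) 1) v = (if v = (i, j) then 1 else if v = (i, a i) then -1 else 0)" for v
    using ij by (auto simp: ratio_exp_def lookup_minus lookup_single when_def)
  have rest: "(\<Prod>v\<in>cox_vars ns - {w}. x (fst v) (snd v) powi lookup (ratio_exp a w 1) v) =
    inverse (x i (a i))"
  proof -
    have "(\<Prod>v\<in>cox_vars ns - {w}. x (fst v) (snd v) powi lookup (ratio_exp a w 1) v) =
      (\<Prod>v\<in>{(i, a i)}. x (fst v) (snd v) powi lookup (ratio_exp a w 1) v)"
      using p ij by (intro prod.mono_neutral_right) (auto simp: l w)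
    then show ?thesis using ij by (simp add: l w)
  qed
  have "mono_val ns x (ratio_exp a w 1) = x i j * inverse (x i (a i))"
    unfolding mono_val_remove[OF assms(1)] rest by (simp add: l w)
  then show "val ns x (ratio a w 1) = x (fst w) (snd w) / x (fst w) (a (fst w))"
    by (simp add: ratio_def val_linear w divide_inverse)
  assume w': "w' \<in> cox_vars ns" "snd w' \<noteq> a (fst w')"
  have "mono_deriv ns x w' (ratio_exp a w 1) = (if w' = w then inverse (x i (a i)) else 0)"
  proof (cases "w' = w")
    case True
    then show ?thesis using rest by (simp add: mono_deriv_def l w)
  next
    case False
    then have "lookup (ratio_exp a w 1) w' = 0" using w' by (auto simp: l w)
    then show ?thesis using False by (simp add: mono_deriv_def)
  qed
  then show "deriv ns x w' (ratio a w 1) = (if w' = w then 1 / x (fst w) (a (fst w)) else 0)"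
    by (simp add: ratio_def deriv_linear w divide_inverse)
qed

abbreviation cst :: "'a::field \<Rightarrow> 'a laurent" where
  "cst c \<equiv> single 0 c"

lemma cst_mult: "cst (c * d) = cst c * cst d"
  by (simp add: mult_single)

lemma cst_add: "cst (c + d) = cst c + cst d"
  by (simp add: single_add)

text \<open>The linear part of the expansion at \<open>x\<close>. For \<open>f\<close> of degree 0,
  the derivative in the affine coordinate x_ij / x_ia(i) is x_ia(i) times the derivative in x_ij.
  The sum may include the chart's own variables: their ratio is constantly 1, so their terms vanish
  as soon as x_ia(i) is nonzero.\<close>

definition taylor1 :: "nat list \<Rightarrow> (nat \<Rightarrow> nat) \<Rightarrow> (nat \<Rightarrow> nat \<Rightarrow> 'a::field) \<Rightarrow> 'a laurent \<Rightarrow> 'a laurent" where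
  "taylor1 ns a x f = (\<Sum>w\<in>cox_vars ns. cst (deriv ns x w f * x (fst w) (a (fst w))) *
     (ratio a w 1 - cst (x (fst w) (snd w) / x (fst w) (a (fst w)))))"

lemma taylor1_add: "taylor1 ns a x (f + g) = taylor1 ns a x f + taylor1 ns a x g"
  by (simp add: taylor1_def deriv_linear cst_add distrib_right sum.distrib)

lemma taylor1_scale: "taylor1 ns a x (cst c * f) = cst c * taylor1 ns a x f"
  by (simp add: taylor1_def deriv_linear cst_mult sum_distrib_left mult.assoc)

lemma taylor1_one [simp]: "taylor1 ns a x 1 = 0"
  by (simp add: taylor1_def)

text \<open>The exponent of the product of the variables selected by the chart. This monomial
  trivializes O(1, ..., 1) on the chart; over all charts, these are also the monomials of
  multidegree (1, ..., 1).\<close>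

definition chart_exp :: "nat list \<Rightarrow> (nat \<Rightarrow> nat) \<Rightarrow> (nat \<times> nat \<Rightarrow>\<^sub>0 int)" where
  "chart_exp ns a = (\<Sum>i<length ns. single (i, a i) 1)"

lemma lookup_chart_exp:
  "lookup (chart_exp ns a) v = (if fst v < length ns \<and> snd v = a (fst v) then 1 else 0)"
proof -
  have "lookup (chart_exp ns a) v =
    (\<Sum>i<length ns. if i = fst v then (if snd v = a (fst v) then 1 else 0) else 0)"
    unfolding chart_exp_def lookup_sum
    by (intro sum.cong refl) (cases v, auto simp: lookup_single when_def)
  then show ?thesis by simp
qed

lemma chart_exp_adm:
  assumes "pivots ns a \<subseteq> cox_vars ns"
  shows "chart_exp ns a \<in> adm ns (\<lambda>_. 1) J" "pivots ns a \<subseteq> J \<Longrightarrow> - chart_exp ns a \<in> adm ns (\<lambda>_. - 1) J"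
proof -
  have a: "a i \<le> ns ! i" if "i < length ns" for i
    using assms that by (auto simp: pivots_def cox_vars_def)
  then show "chart_exp ns a \<in> adm ns (\<lambda>_. 1) J"
    unfolding adm_def multideg_def
    by (auto simp: in_keys_iff lookup_chart_exp cox_vars_def split: if_splits)
  assume "pivots ns a \<subseteq> J"
  then show "- chart_exp ns a \<in> adm ns (\<lambda>_. - 1) J" using a
    unfolding adm_def multideg_def
    by (auto simp: in_keys_iff lookup_chart_exp cox_vars_def pivots_def sum_negf split: if_splits)
qed

context
  fixes ns :: "nat list" and a :: "nat \<Rightarrow> nat" and J and x :: "nat \<Rightarrow> nat \<Rightarrow> 'a::field"
  assumes pivots: "pivots ns a \<subseteq> J" and J: "J \<subseteq> cox_vars ns" and x: "nonzero_on J x"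
begin

lemma x_pivot: "w \<in> cox_vars ns \<Longrightarrow> x (fst w) (a (fst w)) \<noteq> 0"
  using pivots x by (fastforce simp: pivots_def nonzero_on_def cox_vars_def)

lemma val_ratio': "w \<in> cox_vars ns \<Longrightarrow> val ns x (ratio a w 1) = x (fst w) (snd w) / x (fst w) (a (fst w))"
  using val_ratio[OF _ pivots J, of w x] x_pivot[of w] by (cases w; cases "snd w = a (fst w)") auto

lemma taylor1_sections: "taylor1 ns a x f \<in> sections ns (\<lambda>_. 0) J"
  unfolding taylor1_def
  by (intro sections_sum sections_scale sections_diff ratio_sections sections_const pivots J) auto

lemma val_taylor1: "val ns x (taylor1 ns a x f) = 0"
  unfolding taylor1_def by (simp add: val_linear(4,5,2) val_ratio' val_const)

lemma taylor1_mult: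
  assumes "f \<in> sections ns d J" "g \<in> sections ns e J"
  shows "taylor1 ns a x (f * g) = cst (val ns x f) * taylor1 ns a x g + cst (val ns x g) * taylor1 ns a x f"
  unfolding taylor1_def sum_distrib_left sum.distrib[symmetric]
  by (intro sum.cong refl)
    (simp add: deriv_mult[OF assms x] cst_mult cst_add distrib_left distrib_right mult_ac)

text \<open>Congruence to the first order Taylor polynomial modulo the square of the ideal of the point is
  stable under sums, products and inverses, so it holds for all Laurent polynomials of degree \<open>0\<close>.\<close>

definition nearly_affine :: "'a laurent \<Rightarrow> bool" where
  "nearly_affine f \<longleftrightarrow> f \<in> sections ns (\<lambda>_. 0) J \<and>
     f - cst (val ns x f) - taylor1 ns a x f \<in> sq_ideal ns (\<lambda>_. 0) J x"

lemma sq_ideal_cst: "f \<in> sq_ideal ns d J x \<Longrightarrow> cst c * f \<in> sq_ideal ns d J x"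
  using sq_ideal_times[of f ns d J x "cst c" "\<lambda>_. 0" d] by (simp add: sections_const mult.commute)

lemma nearly_affine_add: "nearly_affine f \<Longrightarrow> nearly_affine g \<Longrightarrow> nearly_affine (f + g)"
  unfolding nearly_affine_def
proof (intro conjI)
  assume f: "f \<in> sections ns (\<lambda>_. 0) J \<and> f - cst (val ns x f) - taylor1 ns a x f \<in> sq_ideal ns (\<lambda>_. 0) J x"
    and g: "g \<in> sections ns (\<lambda>_. 0) J \<and> g - cst (val ns x g) - taylor1 ns a x g \<in> sq_ideal ns (\<lambda>_. 0) J x"
  from f g show "f + g \<in> sections ns (\<lambda>_. 0) J" by (auto intro: sections_add)
  have "f + g - cst (val ns x (f + g)) - taylor1 ns a x (f + g) =
    (f - cst (val ns x f) - taylor1 ns a x f) + (g - cst (val ns x g) - taylor1 ns a x g)"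
    by (simp add: val_linear taylor1_add cst_add algebra_simps)
  then show "f + g - cst (val ns x (f + g)) - taylor1 ns a x (f + g) \<in> sq_ideal ns (\<lambda>_. 0) J x"
    using f g sq_ideal_add by metis
qed

lemma nearly_affine_scale: "nearly_affine f \<Longrightarrow> nearly_affine (cst c * f)"
proof -
  assume f: "nearly_affine f"
  have "cst c * f - cst (val ns x (cst c * f)) - taylor1 ns a x (cst c * f) =
    cst c * (f - cst (val ns x f) - taylor1 ns a x f)"
    by (simp only: val_linear(5) taylor1_scale cst_mult right_diff_distrib)
  then show ?thesis using f sq_ideal_cst sections_scale unfolding nearly_affine_def by metis
qed

lemma nearly_affine_0: "nearly_affine 0"
  using sq_ideal.zero[of ns "\<lambda>_. 0" J x] by (simp add: nearly_affine_def val_def taylor1_def deriv_def)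

lemma nearly_affine_sum: "(\<And>i. i \<in> I \<Longrightarrow> nearly_affine (f i)) \<Longrightarrow> nearly_affine (\<Sum>i\<in>I. f i)"
  by (induction I rule: infinite_finite_induct) (auto intro: nearly_affine_add nearly_affine_0)

lemma nearly_affine_one: "nearly_affine 1"
  using sq_ideal.zero[of ns "\<lambda>_. 0" J x] sections_const[of 1 ns J] by (simp add: nearly_affine_def)

lemma nearly_affine_mult:
  assumes f: "nearly_affine f" and g: "nearly_affine g"
  shows "nearly_affine (f * g)"
  unfolding nearly_affine_def
proof
  have fs: "f \<in> sections ns (\<lambda>_. 0) J" and gs: "g \<in> sections ns (\<lambda>_. 0) J"
    using f g by (auto simp: nearly_affine_def)
  then show "f * g \<in> sections ns (\<lambda>_. 0) J" by (intro sections_mult) auto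
  define f0 f1 g0 g1 where "f0 = cst (val ns x f)" "f1 = taylor1 ns a x f" "g0 = cst (val ns x g)" "g1 = taylor1 ns a x g"
  note defs = this
  define e e' where "e = f - f0 - f1" "e' = g - g0 - g1"
  have e: "e \<in> sq_ideal ns (\<lambda>_. 0) J x" "e' \<in> sq_ideal ns (\<lambda>_. 0) J x"
    using f g by (auto simp: e_e'_def defs nearly_affine_def)
  \<comment> \<open>With f = f0 + f1 + e and g = g0 + g1 + e', the error is the product of the two
    linear parts, both vanishing at the point, plus multiples of \<open>e\<close> and
    \<open>e'\<close>.\<close>
  have "f * g - f0 * g0 - (f0 * g1 + g0 * f1) = f1 * g1 * 1 + (e * g + e' * (f0 + f1))"
    by (simp add: e_e'_def algebra_simps)
  moreover have "f1 * g1 * 1 \<in> sq_ideal ns (\<lambda>_. 0) J x"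
    unfolding defs using sections_const[of 1 ns J]
    by (intro sq_ideal_mult taylor1_sections val_taylor1) auto
  moreover have "e * g \<in> sq_ideal ns (\<lambda>_. 0) J x" using e gs by (intro sq_ideal_times) auto
  moreover have "f0 + f1 \<in> sections ns (\<lambda>_. 0) J" unfolding defs
    by (intro sections_add taylor1_sections sections_const)
  then have "e' * (f0 + f1) \<in> sq_ideal ns (\<lambda>_. 0) J x"
    using e by (intro sq_ideal_times) auto
  ultimately have "f * g - f0 * g0 - (f0 * g1 + g0 * f1) \<in> sq_ideal ns (\<lambda>_. 0) J x"
    by (simp only: sq_ideal_add)
  then show "f * g - cst (val ns x (f * g)) - taylor1 ns a x (f * g) \<in> sq_ideal ns (\<lambda>_. 0) J x"
    by (simp add: defs taylor1_mult[OF fs gs] val_mult[OF fs gs x] cst_mult)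
qed

lemma nearly_affine_prod: "(\<And>i. i \<in> I \<Longrightarrow> nearly_affine (f i)) \<Longrightarrow> nearly_affine (\<Prod>i\<in>I. f i)"
  by (induction I rule: infinite_finite_induct) (auto intro: nearly_affine_mult nearly_affine_one)

text \<open>The Leibniz rule for u v = 1 forces v1 = - v0^2 u1. Moreover v - v0 + v0^2 (u - u0) =
  v0^2 v (u - u0)^2, and u - u0 vanishes at the point, so this lies in the square of the
  ideal.\<close>

lemma nearly_affine_inverse:
  assumes u: "nearly_affine u" and v: "v \<in> sections ns (\<lambda>_. 0) J" and uv: "u * v = 1"
  shows "nearly_affine v"
proof -
  have us: "u \<in> sections ns (\<lambda>_. 0) J" using u by (auto simp: nearly_affine_def)
  define u0 v0 u1 v1 where "u0 = cst (val ns x u)" "v0 = cst (val ns x v)"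
    "u1 = taylor1 ns a x u" "v1 = taylor1 ns a x v"
  note defs = this
  define e where "e = u - u0 - u1"
  have e: "e \<in> sq_ideal ns (\<lambda>_. 0) J x" using u by (auto simp: e_def defs nearly_affine_def)
  have "val ns x u * val ns x v = 1" using val_mult[OF us v x] uv by simp
  then have 0: "u0 * v0 = 1" by (simp add: defs mult_single)
  have "u0 * v1 + v0 * u1 = 0" using taylor1_mult[OF us v] uv by (simp add: defs)
  then have "v0 * (u0 * v1) + v0 * v0 * u1 = 0" by (metis distrib_left mult.assoc mult_zero_right)
  moreover have "v0 * (u0 * v1) = (u0 * v0) * v1" by (simp add: mult_ac)
  ultimately have v1: "v1 = - (v0 * v0 * u1)" using 0 by (simp add: eq_neg_iff_add_eq_0)
  have "(u - u0) * (u - u0) * (v0 * v0 * v) =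
      v0 * v0 * u * (u * v) - 2 * v0 * (u * v) * (u0 * v0) + v * (u0 * v0) * (u0 * v0)"
    by (simp add: algebra_simps)
  also have "\<dots> = v0 * v0 * u - 2 * v0 + v" using uv 0 by simp
  also have "\<dots> = v - v0 + v0 * v0 * u - v0 * (u0 * v0)" using 0 by (simp add: algebra_simps)
  finally have "v - v0 - v1 = (u - u0) * (u - u0) * (v0 * v0 * v) + - (v0 * v0 * e)"
    by (simp add: v1 e_def algebra_simps)
  moreover have "(u - u0) * (u - u0) * (v0 * v0 * v) \<in> sq_ideal ns (\<lambda>_. 0) J x"
  proof (intro sq_ideal_mult)
    show "u - u0 \<in> sections ns (\<lambda>_. 0) J" "u - u0 \<in> sections ns (\<lambda>_. 0) J"
      unfolding defs by (intro sections_diff us sections_const)+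
    show "val ns x (u - u0) = 0" "val ns x (u - u0) = 0" by (simp_all add: defs val_linear(2) val_const)
    show "v0 * v0 * v \<in> sections ns (\<lambda>_. 0) J" unfolding defs mult.assoc by (intro sections_scale v)
  qed
  moreover have "- (v0 * v0 * e) = cst (- (val ns x v * val ns x v)) * e"
    by (simp add: defs single_uminus mult_single)
  ultimately have "v - v0 - v1 \<in> sq_ideal ns (\<lambda>_. 0) J x"
    using sq_ideal_cst[OF e] sq_ideal_add by metis
  then show ?thesis using v by (simp add: nearly_affine_def defs)
qed

text \<open>An affine coordinate equals its own first order expansion: only the term of
  \<open>w\<close> survives in \<open>taylor1\<close>, and the remainder is exactly 0.\<close>

lemma nearly_affine_ratio1:
  assumes w: "w \<in> cox_vars ns"
  shows "nearly_affine (ratio a w 1)"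
proof (cases "snd w = a (fst w)")
  case True
  then have "ratio a w 1 = (1 :: 'a laurent)" by (cases w) auto
  then show ?thesis using nearly_affine_one by simp
next
  case False
  have "taylor1 ns a x (ratio a w 1) = (\<Sum>w'\<in>{w}. cst (deriv ns x w' (ratio a w 1) * x (fst w') (a (fst w'))) *
     (ratio a w' 1 - cst (x (fst w') (snd w') / x (fst w') (a (fst w')))))"
    unfolding taylor1_def
  proof (intro sum.mono_neutral_right ballI)
    fix w' assume w': "w' \<in> cox_vars ns - {w}"
    show "cst (deriv ns x w' (ratio a w 1) * x (fst w') (a (fst w'))) *
      (ratio a w' 1 - cst (x (fst w') (snd w') / x (fst w') (a (fst w')))) = 0"
    proof (cases "snd w' = a (fst w')")
      case True
      then have "ratio a w' 1 = (1 :: 'a laurent)" by (cases w') auto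
      then show ?thesis using True w' x_pivot[of w'] by simp
    next
      case False
      then show ?thesis using deriv_ratio[OF w pivots J \<open>snd w \<noteq> a (fst w)\<close>, of w' x] w' by simp
    qed
  qed (use w in auto)
  then have "ratio a w 1 - cst (val ns x (ratio a w 1)) - taylor1 ns a x (ratio a w 1) = 0"
    using deriv_ratio[OF w pivots J False w False, where x = x] x_pivot[OF w] val_ratio'[OF w] by simp
  then show ?thesis
    using ratio_sections[OF w pivots J, where 'a = 'a and k = 1] sq_ideal.zero[of ns "\<lambda>_. 0" J x]
    by (simp add: nearly_affine_def)
qed

lemma nearly_affine_ratio:
  assumes w: "w \<in> cox_vars ns" and k: "k \<ge> 0 \<or> w \<in> J"
  shows "nearly_affine (ratio a w k)"
proof -
  have nn: "nearly_affine (ratio a w (int n))" for n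
  proof (induction n)
    case 0
    then show ?case by (simp add: nearly_affine_one)
  next
    case (Suc n)
    have "ratio a w (int (Suc n)) = (ratio a w 1 :: 'a laurent) * ratio a w (int n)"
      by (simp add: ratio_add)
    then show ?case using Suc nearly_affine_mult nearly_affine_ratio1[OF w] by simp
  qed
  show ?thesis
  proof (cases "k \<ge> 0")
    case True
    then show ?thesis using nn[of "nat k"] by simp
  next
    case False
    have "ratio a w (int (nat (- k))) * ratio a w k = (1 :: 'a laurent)"
      using False by (simp flip: ratio_add)
    then show ?thesis using nearly_affine_inverse[OF nn _ ] ratio_sections[OF w pivots J k] by blast
  qed
qed

text \<open>In the product of all these ratios, the chart variable of factor \<open>i\<close> picks
  up as an extra exponent minus the degree of \<open>m\<close> in that factor, which is 0.\<close>

lemma single_eq_prod_ratio: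
  assumes "m \<in> adm ns (\<lambda>_. 0) J"
  shows "single m 1 = (\<Prod>w\<in>cox_vars ns. ratio a w (lookup m w) :: 'a laurent)"
proof -
  have *: "(\<Prod>w\<in>I. ratio a w (h w)) = (single (\<Sum>w\<in>I. ratio_exp a w (h w)) 1 :: 'a laurent)" for I h
    by (induction I rule: infinite_finite_induct) (auto simp: ratio_def mult_single)
  have "(\<Sum>w\<in>cox_vars ns. ratio_exp a w (lookup m w)) = m"
  proof (rule poly_mapping_eqI)
    fix v
    have 1: "(\<Sum>w\<in>cox_vars ns. lookup (single w (lookup m w)) v) =
      lookup m v"
      using assms by (auto simp: lookup_single when_def adm_def in_keys_iff)
    have "(\<Sum>w\<in>cox_vars ns. lookup (single (fst w, a (fst w)) (lookup m w)) v) =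
      (\<Sum>i<length ns. \<Sum>j\<le>ns ! i. if (i, a i) = v then lookup m (i, j) else 0)"
      unfolding cox_vars_Sigma by (simp add: sum.Sigma case_prod_unfold lookup_single when_def cong: if_cong)
    also have "\<dots> = (\<Sum>i<length ns. if (i, a i) = v then multideg ns m i else 0)"
      by (intro sum.cong refl) (auto simp: multideg_def)
    also have "\<dots> = 0" using assms by (intro sum.neutral) (auto simp: adm_def)
    finally have 2: "(\<Sum>w\<in>cox_vars ns. lookup (single (fst w, a (fst w)) (lookup m w)) v) = 0" .
    show "lookup (\<Sum>w\<in>cox_vars ns. ratio_exp a w (lookup m w)) v = lookup m v"
      unfolding lookup_sum ratio_exp_def lookup_minus sum_subtractf 1 2 by simp
  qed
  then show ?thesis unfolding * by simp
qed

lemma nearly_affine_all: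
  assumes "f \<in> sections ns (\<lambda>_. 0) J"
  shows "nearly_affine f"
proof -
  have "nearly_affine (single m c)" if "m \<in> keys f" for m c
  proof -
    have m: "m \<in> adm ns (\<lambda>_. 0) J" using that assms by (auto simp: sections_def)
    have "single m c = cst c * single m 1" by (simp add: mult_single)
    moreover have "nearly_affine (single m 1)"
      unfolding single_eq_prod_ratio[OF m] using m
      by (intro nearly_affine_prod nearly_affine_ratio) (auto simp: adm_def not_le[symmetric])
    ultimately show ?thesis using nearly_affine_scale by simp
  qed
  then show ?thesis by (subst sum_single_keys) (rule nearly_affine_sum)
qed

text \<open>Dividing by the chart monomial moves \<open>f\<close> to degree 0 and keeps its value
  and derivatives 0. Its Taylor polynomial is then 0, so the quotient equals its own remainder,
  which lies in the squared ideal; multiplying back restores the degree.\<close>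

lemma sq_idealI:
  assumes f: "f \<in> sections ns (\<lambda>_. 1) J" and "val ns x f = 0"
    and d: "\<And>w. w \<in> cox_vars ns \<Longrightarrow> deriv ns x w f = 0"
  shows "f \<in> sq_ideal ns (\<lambda>_. 1) J x"
proof -
  define s t :: "'a laurent" where "s = single (chart_exp ns a) 1" "t = single (- chart_exp ns a) 1"
  have a: "pivots ns a \<subseteq> cox_vars ns" using pivots J by simp
  have s: "s \<in> sections ns (\<lambda>_. 1) J" and t: "t \<in> sections ns (\<lambda>_. - 1) J"
    unfolding s_t_def by (intro sections_single chart_exp_adm a pivots)+
  have ts: "t * s = 1" by (simp add: s_t_def mult_single)
  have ft: "f * t \<in> sections ns (\<lambda>_. 0) J" using sections_mult[OF f t] by simp
  have "val ns x (f * t) = 0" using val_mult[OF f t x] assms by simp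
  moreover have "taylor1 ns a x (f * t) = 0"
    unfolding taylor1_def using d assms(2) by (intro sum.neutral) (simp add: deriv_mult[OF f t x])
  ultimately have "f * t \<in> sq_ideal ns (\<lambda>_. 0) J x"
    using nearly_affine_all[OF ft] by (simp add: nearly_affine_def)
  then have "(f * t) * s \<in> sq_ideal ns (\<lambda>_. 1) J x" using s by (rule sq_ideal_times) auto
  then show ?thesis using ts by (simp add: mult.assoc)
qed

end

text \<open>One direction is the Leibniz rule, the other the Taylor expansion. If \<open>U_J\<close>
  misses \<open>p\<close>, the constant 1 belongs to the ideal of \<open>p\<close> over
  \<open>U_J\<close>, so no condition is left.\<close>

lemma double_point_sections_iff:
  assumes "pivots ns a \<subseteq> J" "J \<subseteq> cox_vars ns" "p \<in> mproj ns"
  shows "f \<in> double_point_sections ns p J \<longleftrightarrow> f \<in> sections ns (\<lambda>_. 1) J \<and>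
    (nonzero_on J (lift p) \<longrightarrow> val ns (lift p) f = 0 \<and> (\<forall>w\<in>cox_vars ns. deriv ns (lift p) w f = 0))"
proof
  assume "f \<in> double_point_sections ns p J"
  then obtain N :: nat and g h s where
    *: "\<And>k. k < N \<Longrightarrow> g k \<in> point_ideal ns p J \<and> h k \<in> point_ideal ns p J \<and> s k \<in> line_sections ns 1 J"
    "f = (\<Sum>k<N. g k * h k * s k)"
    unfolding double_point_sections_def by auto
  let ?x = "lift p"
  have g: "g k \<in> sections ns (\<lambda>_. 0) J" "h k \<in> sections ns (\<lambda>_. 0) J" "s k \<in> sections ns (\<lambda>_. 1) J"
    "nonzero_on J ?x \<Longrightarrow> val ns ?x (g k) = 0" "nonzero_on J ?x \<Longrightarrow> val ns ?x (h k) = 0" if "k < N" for k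
    using *(1)[OF that] by (auto simp: point_ideal_iff[OF assms(3,2)] line_sections_eq)
  have gh: "g k * h k \<in> sections ns (\<lambda>_. 0) J" if "k < N" for k
    using sections_mult[OF g(1,2)[OF that]] by simp
  have "f \<in> sections ns (\<lambda>_. 1) J"
    unfolding *(2) using g gh by (intro sections_sum sections_mult[OF gh g(3)]) auto
  moreover have "val ns ?x f = 0 \<and> (\<forall>w\<in>cox_vars ns. deriv ns ?x w f = 0)" if x: "nonzero_on J ?x"
  proof -
    have "val ns ?x (g k * h k * s k) = 0" if "k < N" for k
      by (simp add: val_mult[OF gh[OF that] g(3)[OF that] x] val_mult[OF g(1,2)[OF that] x] g(4)[OF that x])
    moreover have "deriv ns ?x w (g k * h k * s k) = 0" if "k < N" "w \<in> cox_vars ns" for k w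
      using that x by (simp add: deriv_mult[OF gh[OF that(1)] g(3)[OF that(1)] x] val_mult[OF g(1,2)[OF that(1)] x]
         deriv_mult[OF g(1,2)[OF that(1)] x] g(4,5)[OF that(1) x])
    ultimately show ?thesis unfolding *(2) by (auto simp: val_linear(4) deriv_linear(4))
  qed
  ultimately show "f \<in> sections ns (\<lambda>_. 1) J \<and>
    (nonzero_on J ?x \<longrightarrow> val ns ?x f = 0 \<and> (\<forall>w\<in>cox_vars ns. deriv ns ?x w f = 0))" by blast
next
  assume f: "f \<in> sections ns (\<lambda>_. 1) J \<and>
    (nonzero_on J (lift p) \<longrightarrow> val ns (lift p) f = 0 \<and> (\<forall>w\<in>cox_vars ns. deriv ns (lift p) w f = 0))"
  show "f \<in> double_point_sections ns p J"
  proof (cases "nonzero_on J (lift p)")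
    case True
    then show ?thesis using f sq_idealI[OF assms(1,2) True] sq_ideal_double_point[OF _ assms(3,2)] by blast
  next
    case False
    then have "1 \<in> point_ideal ns p J"
      using sections_const[of 1 ns J] by (simp add: point_ideal_iff[OF assms(3,2)])
    then show ?thesis unfolding double_point_sections_def
      using f by (intro CollectI exI[of _ "1::nat"] exI[of _ "\<lambda>_. 1"] exI[of _ "\<lambda>_. f"])
        (auto simp: line_sections_eq)
  qed
qed

section \<open>Dimensions of quotients\<close>

abbreviation fscale :: "'a::field \<Rightarrow> ('i \<Rightarrow> 'a) \<Rightarrow> 'i \<Rightarrow> 'a" where
  "fscale \<equiv> \<lambda>c v i. c * v i"

interpretation fvec: vector_space "fscale :: 'a::field \<Rightarrow> ('i \<Rightarrow> 'a) \<Rightarrow> 'i \<Rightarrow> 'a"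
  by unfold_locales (auto simp: fun_eq_iff algebra_simps)

definition supported :: "'i set \<Rightarrow> ('i \<Rightarrow> 'a::field) set" where
  "supported I = {v. \<forall>i. i \<notin> I \<longrightarrow> v i = 0}"

definition unit_vec :: "'i \<Rightarrow> 'i \<Rightarrow> 'a::field" where
  "unit_vec i = (\<lambda>j. if j = i then 1 else 0)"

lemma subspace_vanish: "fvec.subspace {v. v i = 0}"
  by (auto simp: fvec.subspace_def)

lemma sum_unit_vec:
  assumes "finite I" "v \<in> supported I"
  shows "v = (\<Sum>i\<in>I. fscale (v i) (unit_vec i))"
proof
  fix j
  have "(\<Sum>i\<in>I. fscale (v i) (unit_vec i)) j = (\<Sum>i\<in>I. if i = j then v j else 0)"
    by (induction I rule: infinite_finite_induct) (auto simp: unit_vec_def)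
  then show "v j = (\<Sum>i\<in>I. fscale (v i) (unit_vec i)) j"
    using assms by (auto simp: supported_def)
qed

lemma supported_subset_span:
  fixes I :: "'i set"
  shows "finite I \<Longrightarrow> (supported I :: ('i \<Rightarrow> 'a::field) set) \<subseteq> fvec.span (unit_vec ` I)"
proof
  fix v :: "'i \<Rightarrow> 'a" assume "finite I" "v \<in> supported I"
  then have "v = (\<Sum>i\<in>I. fscale (v i) (unit_vec i))" by (rule sum_unit_vec)
  also have "\<dots> \<in> fvec.span (unit_vec ` I)"
    by (intro fvec.span_sum fvec.span_scale fvec.span_base) auto
  finally show "v \<in> fvec.span (unit_vec ` I)" .
qed

lemma independent_supported_bound:
  fixes I :: "'i set" and T :: "('i \<Rightarrow> 'a::field) set"
  assumes "finite I" "fvec.independent T" "T \<subseteq> supported I"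
  shows "finite T \<and> card T \<le> card I"
proof -
  have "finite T \<and> card T \<le> card (unit_vec ` I :: ('i \<Rightarrow> 'a) set)"
    using assms supported_subset_span[OF assms(1)] by (intro fvec.independent_span_bound) auto
  then show ?thesis
    using card_image_le[OF assms(1), of "unit_vec :: 'i \<Rightarrow> 'i \<Rightarrow> 'a"] by linarith
qed

lemma independent_card_le_dim:
  assumes "finite I" "E \<subseteq> supported I" "fvec.independent T" "T \<subseteq> E"
  shows "card T \<le> fvec.dim E"
proof -
  obtain Y where Y: "Y \<subseteq> E" "fvec.independent Y" "E \<subseteq> fvec.span Y" "card Y = fvec.dim E"
    using fvec.basis_exists by blast
  have "finite Y" using independent_supported_bound[OF assms(1) Y(2)] Y(1) assms(2) by blast
  then show ?thesis
    using fvec.independent_span_bound[of Y T] assms Y by auto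
qed

text \<open>When \<open>u i\<close> is added, all vectors already present have entry 0 at
  \<open>i\<close>, and so does their span, whereas \<open>u i\<close> has entry 1 there.\<close>

lemma independent_union_triangular:
  assumes "finite I0" "finite T" "fvec.independent T" "\<And>t i. t \<in> T \<Longrightarrow> i \<in> I0 \<Longrightarrow> t i = 0"
    "\<And>i j. i \<in> I0 \<Longrightarrow> j \<in> I0 \<Longrightarrow> u i j = (if j = i then 1 else 0)"
  shows "fvec.independent (T \<union> u ` I0) \<and> finite (T \<union> u ` I0) \<and> card (T \<union> u ` I0) = card T + card I0"
  using assms(1,4,5)
proof (induction I0)
  case empty
  then show ?case using assms by simp
next
  case (insert i I0)
  have "fvec.span (T \<union> u ` I0) \<subseteq> {v. v i = 0}"
    using insert by (intro fvec.span_minimal subspace_vanish) auto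
  moreover have "u i i = 1" using insert by simp
  ultimately have u: "u i \<notin> fvec.span (T \<union> u ` I0)" by auto
  then have "u i \<notin> T \<union> u ` I0" using fvec.span_superset[of "T \<union> u ` I0"] by blast
  moreover have IH: "fvec.independent (T \<union> u ` I0) \<and> finite (T \<union> u ` I0) \<and> card (T \<union> u ` I0) = card T + card I0"
    using insert by simp
  moreover have "T \<union> u ` insert i I0 = insert (u i) (T \<union> u ` I0)" by simp
  ultimately show ?case using fvec.independent_insertI[OF u] insert(1,2) by simp
qed

text \<open>Restriction to the coordinates in \<open>I0\<close> maps \<open>E\<close> onto all
  vectors on \<open>I0\<close>, and \<open>T\<close> is independent in its kernel. It will be
  applied with \<open>I0\<close> the jet coordinates at one point.\<close>

lemma card_add_card_le_dim:
  assumes "finite I" "E \<subseteq> supported I" "I0 \<subseteq> I" "fvec.independent T" "T \<subseteq> E"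
    "\<And>t i. t \<in> T \<Longrightarrow> i \<in> I0 \<Longrightarrow> t i = 0"
    "\<And>i. i \<in> I0 \<Longrightarrow> \<exists>u\<in>E. \<forall>j\<in>I0. u j = (if j = i then 1 else 0)"
  shows "card T + card I0 \<le> fvec.dim E"
proof -
  obtain u where u: "\<And>i. i \<in> I0 \<Longrightarrow> u i \<in> E \<and> (\<forall>j\<in>I0. u i j = (if j = i then 1 else 0))"
    using assms(7) by metis
  have f: "finite I0" using assms(1,3) finite_subset by blast
  have "finite T" using independent_supported_bound[OF assms(1,4)] assms(2,5) by blast
  have "fvec.independent (T \<union> u ` I0) \<and> finite (T \<union> u ` I0) \<and> card (T \<union> u ` I0) = card T + card I0"
    using assms(6) u by (intro independent_union_triangular f \<open>finite T\<close> assms(4)) auto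
  moreover have "T \<union> u ` I0 \<subseteq> E" using u assms(5) by auto
  ultimately show ?thesis using independent_card_le_dim[OF assms(1,2)] by metis
qed

lemma independent_pair:
  assumes "\<And>\<alpha> \<beta>. fscale \<alpha> s + fscale \<beta> t = 0 \<Longrightarrow> \<alpha> = 0 \<and> \<beta> = 0"
  shows "fvec.independent {s, t} \<and> card {s, t} = 2"
proof -
  have "t \<noteq> 0" using assms[of 0 1] by (auto simp: fun_eq_iff)
  moreover have "s \<notin> fvec.span {t}"
  proof
    assume "s \<in> fvec.span {t}"
    then obtain c where "s = fscale c t" unfolding fvec.span_singleton by auto
    then have "fscale 1 s + fscale (- c) t = 0" by (simp add: fun_eq_iff)
    from assms[OF this] show False by simp
  qed
  moreover have "s \<noteq> t" using calculation(2) fvec.span_base[of t "{t}"] by auto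
  moreover have "fvec.independent {t}" using calculation(1) unfolding fvec.dependent_single by simp
  ultimately show ?thesis using fvec.independent_insertI[of s "{t}"] by simp
qed

context vector_space
begin

text \<open>A maximal independent subset of \<open>B\<close> is extended to one of \<open>Z\<close>;
  the added vectors represent a basis of the quotient.\<close>

lemma quot_basis_exists:
  assumes "subspace Z" "B \<subseteq> Z"
  shows "\<exists>X. quot_basis scale Z B X"
proof -
  obtain C where C: "C \<subseteq> B" "independent C" "B \<subseteq> span C"
    using maximal_independent_subset by blast
  have "C \<subseteq> Z" using C(1) assms(2) by simp
  then obtain D where D: "C \<subseteq> D" "D \<subseteq> Z" "independent D" "Z \<subseteq> span D"
    using maximal_independent_subset_extend[OF _ C(2)] by blast
  have "span (B \<union> (D - C)) = Z"
  proof
    show "span (B \<union> (D - C)) \<subseteq> Z" using assms D(2) by (intro span_minimal) auto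
    show "Z \<subseteq> span (B \<union> (D - C))" using D(4) span_mono[of D "B \<union> (D - C)"] C(1) by blast
  qed
  moreover have "x \<notin> span (B \<union> (D - C - {x}))" if "x \<in> D - C" for x
  proof
    assume "x \<in> span (B \<union> (D - C - {x}))"
    moreover have "C \<subseteq> D - {x}" using that D(1) by auto
    then have "B \<subseteq> span (D - {x})" using C(3) span_mono by blast
    then have "B \<union> (D - C - {x}) \<subseteq> span (D - {x})" using span_superset[of "D - {x}"] by blast
    then have "span (B \<union> (D - C - {x})) \<subseteq> span (D - {x})" by (rule span_minimal) auto
    ultimately show False using D(3) that by (auto simp: dependent_def)
  qed
  ultimately show ?thesis using D(2) unfolding quot_basis_def by (intro exI[of _ "D - C"]) auto
qed

end

text \<open>\<open>\<Psi>\<close> induces an isomorphism from \<open>Z / B\<close> to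
  \<open>supported I / E\<close>, so the images of \<open>X\<close> together with a basis of
  \<open>E\<close> form a basis of \<open>supported I\<close>. As \<open>Z\<close> may be
  infinite-dimensional, \<open>X\<close> is not known to be finite beforehand; this follows from the
  uniform bound on its finite subsets.\<close>

lemma card_quot_basis:
  fixes scl :: "'a::field \<Rightarrow> 'b::ab_group_add \<Rightarrow> 'b" and \<Psi> :: "'b \<Rightarrow> 'i \<Rightarrow> 'a"
  assumes lin: "Vector_Spaces.linear scl fscale \<Psi>"
    and Z: "module.subspace scl Z"
    and I: "finite I" and E: "fvec.subspace E" "E \<subseteq> supported I"
    and B: "\<And>c. c \<in> B \<longleftrightarrow> c \<in> Z \<and> \<Psi> c \<in> E"
    and sup: "\<Psi> ` Z \<subseteq> supported I"
    and surj: "\<And>v. v \<in> supported I \<Longrightarrow> \<exists>c\<in>Z. v - \<Psi> c \<in> E"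
    and X: "quot_basis scl Z B X"
  shows "card X + fvec.dim E = card I"
proof -
  interpret \<Psi>: Vector_Spaces.linear scl fscale \<Psi> by (rule lin)
  obtain Y where Y: "Y \<subseteq> E" "fvec.independent Y" "E \<subseteq> fvec.span Y" "card Y = fvec.dim E"
    using fvec.basis_exists by blast
  have finY: "finite Y" using independent_supported_bound[OF I Y(2)] Y(1) E(2) by blast
  have XZ: "X \<subseteq> Z" and sp: "\<Psi>.vs1.span (B \<union> X) = Z"
    and nX: "\<And>x. x \<in> X \<Longrightarrow> x \<notin> \<Psi>.vs1.span (B \<union> (X - {x}))"
    using X by (auto simp: quot_basis_def)
  \<comment> \<open>A dependence of \<open>\<Psi> x\<close> on the other images modulo
    \<open>E\<close> lifts to \<open>x - z'\<close> with image in \<open>E\<close>, hence in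
    \<open>B\<close>; then \<open>x\<close> would be redundant in the quotient basis.\<close>
  have step: "\<Psi> x \<notin> fvec.span (Y \<union> \<Psi> ` X')" if x: "x \<in> X" "x \<notin> X'" "X' \<subseteq> X" for x X'
  proof
    assume "\<Psi> x \<in> fvec.span (Y \<union> \<Psi> ` X')"
    then obtain y z where yz: "\<Psi> x = y + z" "y \<in> fvec.span Y" "z \<in> fvec.span (\<Psi> ` X')"
      unfolding fvec.span_Un by blast
    have y: "y \<in> E" using yz(2) fvec.span_minimal[OF Y(1) E(1)] by blast
    obtain z' where z': "z = \<Psi> z'" "z' \<in> \<Psi>.vs1.span X'"
      using yz(3) unfolding \<Psi>.span_image by blast
    have "z' \<in> Z" using z'(2) x(3) XZ \<Psi>.vs1.span_minimal[OF _ Z, of X'] by blast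
    then have "x - z' \<in> Z" using x(1) XZ Z \<Psi>.vs1.subspace_diff by blast
    moreover have "\<Psi> (x - z') = y" using yz(1) z'(1) by (simp add: \<Psi>.diff)
    ultimately have "x - z' \<in> B" using B y by blast
    then have "(x - z') + z' \<in> \<Psi>.vs1.span (B \<union> (X - {x}))"
      using z'(2) x(2,3) \<Psi>.vs1.span_mono[of X' "B \<union> (X - {x})"]
      by (intro \<Psi>.vs1.span_add) (auto intro: \<Psi>.vs1.span_base)
    then show False using nX[OF x(1)] by simp
  qed
  have ind: "fvec.independent (Y \<union> \<Psi> ` X') \<and> card (Y \<union> \<Psi> ` X') = card Y + card X'"
    if "finite X'" "X' \<subseteq> X" for X'
    using that
  proof (induction X')
    case empty
    then show ?case using Y(2) by simp
  next
    case (insert x X')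
    have n: "\<Psi> x \<notin> fvec.span (Y \<union> \<Psi> ` X')" using step insert by blast
    then have "\<Psi> x \<notin> Y \<union> \<Psi> ` X'" using fvec.span_superset[of "Y \<union> \<Psi> ` X'"] by blast
    moreover have "fvec.independent (Y \<union> \<Psi> ` X') \<and> card (Y \<union> \<Psi> ` X') = card Y + card X'"
      using insert by simp
    moreover have "Y \<union> \<Psi> ` insert x X' = insert (\<Psi> x) (Y \<union> \<Psi> ` X')" by simp
    ultimately show ?case using fvec.independent_insertI[OF n] insert(1,2) finY by simp
  qed
  have sub: "Y \<union> \<Psi> ` X' \<subseteq> supported I" if "X' \<subseteq> X" for X'
    using that XZ sup Y(1) E(2) by blast
  have bound: "card X' \<le> card I" if "finite X'" "X' \<subseteq> X" for X'
    using ind[OF that] independent_supported_bound[OF I _ sub[OF that(2)]] by auto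
  have fin: "finite X"
  proof (rule ccontr)
    assume "infinite X"
    then obtain X' where "finite X'" "card X' = Suc (card I)" "X' \<subseteq> X"
      using infinite_arbitrarily_large by blast
    then show False using bound[of X'] by simp
  qed
  have "supported I \<subseteq> fvec.span (Y \<union> \<Psi> ` X)"
  proof
    fix v :: "'i \<Rightarrow> 'a" assume "v \<in> supported I"
    then obtain c where c: "c \<in> Z" "v - \<Psi> c \<in> E" using surj by blast
    have EY: "E \<subseteq> fvec.span (Y \<union> \<Psi> ` X)" using Y(3) fvec.span_mono[of Y "Y \<union> \<Psi> ` X"] by blast
    have "\<Psi> ` (B \<union> X) \<subseteq> fvec.span (Y \<union> \<Psi> ` X)" 
      using EY B fvec.span_superset[of "Y \<union> \<Psi> ` X"] by auto
    then have "fvec.span (\<Psi> ` (B \<union> X)) \<subseteq> fvec.span (Y \<union> \<Psi> ` X)"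
      by (rule fvec.span_minimal) (rule fvec.subspace_span)
    then have "\<Psi> c \<in> fvec.span (Y \<union> \<Psi> ` X)" using c(1) sp unfolding \<Psi>.span_image by blast
    then have "(v - \<Psi> c) + \<Psi> c \<in> fvec.span (Y \<union> \<Psi> ` X)"
      using c(2) EY by (intro fvec.span_add) auto
    then show "v \<in> fvec.span (Y \<union> \<Psi> ` X)" by simp
  qed
  moreover have "unit_vec ` I \<subseteq> (supported I :: ('i \<Rightarrow> 'a) set)" by (auto simp: supported_def unit_vec_def)
  ultimately have "unit_vec ` I \<subseteq> fvec.span (Y \<union> \<Psi> ` X)" by blast
  moreover have "fvec.independent ({} \<union> unit_vec ` I :: ('i \<Rightarrow> 'a) set) \<and> finite ({} \<union> unit_vec ` I :: ('i \<Rightarrow> 'a) set) \<and>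
      card ({} \<union> unit_vec ` I :: ('i \<Rightarrow> 'a) set) = card ({} :: ('i \<Rightarrow> 'a) set) + card I"
    by (intro independent_union_triangular I fvec.independent_empty) (auto simp: unit_vec_def)
  ultimately have "card I \<le> card (Y \<union> \<Psi> ` X)"
    using fvec.independent_span_bound[of "Y \<union> \<Psi> ` X" "unit_vec ` I"] finY fin by auto
  moreover have "card (Y \<union> \<Psi> ` X) \<le> card I"
    using ind[OF fin] independent_supported_bound[OF I _ sub] by blast
  ultimately show ?thesis using ind[OF fin] Y(4) by auto
qed

lemma quot_dim_eq:
  fixes scl :: "'a::field \<Rightarrow> 'b::ab_group_add \<Rightarrow> 'b" and \<Psi> :: "'b \<Rightarrow> 'i \<Rightarrow> 'a"
  assumes "Vector_Spaces.linear scl fscale \<Psi>" "module.subspace scl Z" "finite I"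
    "fvec.subspace E" "E \<subseteq> supported I"
    "\<And>c. c \<in> B \<longleftrightarrow> c \<in> Z \<and> \<Psi> c \<in> E" "\<Psi> ` Z \<subseteq> supported I"
    "\<And>v. v \<in> supported I \<Longrightarrow> \<exists>c\<in>Z. v - \<Psi> c \<in> E"
  shows "quot_dim scl Z B + fvec.dim E = card I"
proof -
  interpret \<Psi>: Vector_Spaces.linear scl fscale \<Psi> by (rule assms(1))
  have "\<exists>X. quot_basis scl Z B X" using assms(2,6) by (intro \<Psi>.vs1.quot_basis_exists) auto
  then have "quot_basis scl Z B (SOME X. quot_basis scl Z B X)" by (rule someI_ex)
  from card_quot_basis[OF assms this] show ?thesis by (simp add: quot_dim_def)
qed

section \<open>First jets at the points of a finite set\<close>

definition jet_vars :: "nat list \<Rightarrow> 'a::field mpoint \<Rightarrow> (nat \<times> nat) set" where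
  "jet_vars ns p = {w \<in> cox_vars ns. snd w \<noteq> pivot p (fst w)}"

text \<open>\<open>None\<close> indexes the value and \<open>Some w\<close> the derivative in
  \<open>w\<close>. Leaving out the pivot variable of each factor, whose derivative is determined by
  Euler's relation, makes the number of entries n + 1, the length of the double point.\<close>

definition jet_index :: "nat list \<Rightarrow> 'a::field mpoint \<Rightarrow> (nat \<times> nat) option set" where
  "jet_index ns p = insert None (Some ` jet_vars ns p)"

definition jet :: "nat list \<Rightarrow> 'a::field mpoint \<Rightarrow> (nat \<times> nat) option \<Rightarrow> 'a laurent \<Rightarrow> 'a" where
  "jet ns p e f = (case e of None \<Rightarrow> val ns (lift p) f | Some w \<Rightarrow> deriv ns (lift p) w f)"

definition jets_index :: "nat list \<Rightarrow> 'a::field mpoint set \<Rightarrow> ('a mpoint \<times> (nat \<times> nat) option) set" where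
  "jets_index ns S = (SIGMA p:S. jet_index ns p)"

text \<open>The section may depend on the point, because the connecting map evaluates at each point
  a section over a chart containing that point. Global sections enter as constant families.\<close>

definition jets :: "nat list \<Rightarrow> 'a::field mpoint set \<Rightarrow> ('a mpoint \<Rightarrow> 'a laurent) \<Rightarrow>
    'a mpoint \<times> (nat \<times> nat) option \<Rightarrow> 'a" where
  "jets ns S b = (\<lambda>k. if k \<in> jets_index ns S then jet ns (fst k) (snd k) (b (fst k)) else 0)"

lemma jet_add: "jet ns p e (f + g) = jet ns p e f + jet ns p e g"
  by (simp add: jet_def val_linear deriv_linear split: option.split)

lemma jet_diff: "jet ns p e (f - g) = jet ns p e f - jet ns p e g"
  by (simp add: jet_def val_linear deriv_linear split: option.split)

lemma jet_uminus: "jet ns p e (- f) = - jet ns p e f"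
  by (simp add: jet_def val_linear deriv_linear split: option.split)

lemma jet_scale: "jet ns p e (cst c * f) = c * jet ns p e f"
  by (simp add: jet_def val_linear deriv_linear split: option.split)

lemma jet_sum: "jet ns p e (\<Sum>i\<in>I. f i) = (\<Sum>i\<in>I. jet ns p e (f i))"
  by (simp add: jet_def val_linear deriv_linear split: option.split)

lemma jets_supported: "jets ns S b \<in> supported (jets_index ns S)"
  by (simp add: jets_def supported_def)

lemma pivots_pivot:
  assumes "p \<in> mproj ns"
  shows "pivots ns (pivot p) \<subseteq> cox_vars ns" "nonzero_on (pivots ns (pivot p)) (lift p)"
  using pivot_le[OF assms] lift_pivot[OF assms] by (auto simp: pivots_def cox_vars_def nonzero_on_def)

lemma finite_jet_vars: "finite (jet_vars ns p)"
  by (simp add: jet_vars_def)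

lemma card_cox_vars: "card (cox_vars ns) = sum_list ns + length ns"
proof -
  have "card (cox_vars ns) = (\<Sum>i<length ns. Suc (ns ! i))"
    unfolding cox_vars_Sigma by simp
  also have "\<dots> = (\<Sum>i<length ns. ns ! i) + length ns" 
    using sum.distrib[of "(!) ns" "\<lambda>_. 1" "{..<length ns}"] by simp
  finally show ?thesis by (simp add: sum_list_sum_nth atLeast0LessThan)
qed

lemma card_jet_index:
  assumes "p \<in> mproj ns"
  shows "card (jet_index ns p) = sum_list ns + 1"
proof -
  have "pivots ns (pivot p) = (\<lambda>i. (i, pivot p i)) ` {..<length ns}" by (auto simp: pivots_def)
  then have "card (pivots ns (pivot p)) = length ns" by (simp add: card_image inj_on_def)
  moreover have "jet_vars ns p = cox_vars ns - pivots ns (pivot p)"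
    by (auto simp: jet_vars_def pivots_def cox_vars_def)
  ultimately have "card (jet_vars ns p) = sum_list ns"
    using pivots_pivot[OF assms] by (simp add: card_Diff_subset card_cox_vars finite_subset)
  then show ?thesis
    unfolding jet_index_def by (subst card_insert_disjoint) (auto simp: finite_jet_vars card_image)
qed

lemma finite_jet_index: "finite (jet_index ns p)"
  by (simp add: jet_index_def finite_jet_vars)

lemma finite_jets_index: "finite S \<Longrightarrow> finite (jets_index ns S)"
  by (simp add: jets_index_def finite_jet_index)

lemma card_jets_index:
  assumes "S \<subseteq> mproj ns" "finite S"
  shows "card (jets_index ns S) = card S * (sum_list ns + 1)"
proof -
  have "card (jets_index ns S) = (\<Sum>p\<in>S. card (jet_index ns p))"
    unfolding jets_index_def using assms by (intro card_SigmaI) (auto simp: finite_jet_index)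
  also have "\<dots> = (\<Sum>p\<in>S. sum_list ns + 1)"
    using assms by (intro sum.cong refl card_jet_index) auto
  finally show ?thesis by simp
qed

text \<open>Once the value and the other derivatives of a factor vanish, Euler's relation reduces to
  the pivot coordinate, which is 1, times the pivot derivative.\<close>

lemma jet_zero_imp_deriv_zero:
  assumes p: "p \<in> mproj ns" and f: "f \<in> sections ns d J"
    and z: "\<And>e. e \<in> jet_index ns p \<Longrightarrow> jet ns p e f = 0" and w: "w \<in> cox_vars ns"
  shows "deriv ns (lift p) w f = 0"
proof -
  have nonpiv: "deriv ns (lift p) w f = 0" if "w \<in> jet_vars ns p" for w
    using z[of "Some w"] that by (simp add: jet_index_def jet_def)
  show ?thesis
  proof (cases "w \<in> jet_vars ns p")
    case False
    then obtain i where i: "w = (i, pivot p i)" "i < length ns"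
      using w by (cases w) (auto simp: jet_vars_def cox_vars_def)
    have "val ns (lift p) f = 0" using z[of None] by (simp add: jet_index_def jet_def)
    then have "0 = (\<Sum>j\<le>ns ! i. lift p i j * deriv ns (lift p) (i, j) f)"
      using euler[OF f i(2), of "lift p"] by simp
    also have "\<dots> = (\<Sum>j\<in>{pivot p i}. lift p i j * deriv ns (lift p) (i, j) f)"
      using pivot_le[OF p i(2)] i(2) nonpiv
      by (intro sum.mono_neutral_right) (auto simp: jet_vars_def cox_vars_def)
    finally show ?thesis using lift_pivot[OF p i(2)] by (simp add: i)
  qed (rule nonpiv)
qed

lemma double_sections_iff:
  assumes "pivots ns a \<subseteq> J" "J \<subseteq> cox_vars ns" "S \<subseteq> mproj ns"
  shows "f \<in> double_sections ns S J \<longleftrightarrow> f \<in> sections ns (\<lambda>_. 1) J \<and>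
    (\<forall>p\<in>S. nonzero_on J (lift p) \<longrightarrow> (\<forall>e\<in>jet_index ns p. jet ns p e f = 0))"
proof -
  have "(val ns (lift p) f = 0 \<and> (\<forall>w\<in>cox_vars ns. deriv ns (lift p) w f = 0)) \<longleftrightarrow>
      (\<forall>e\<in>jet_index ns p. jet ns p e f = 0)" if "p \<in> S" "f \<in> sections ns (\<lambda>_. 1) J" for p
  proof
    assume "\<forall>e\<in>jet_index ns p. jet ns p e f = 0"
    moreover from this have "val ns (lift p) f = 0" by (auto simp: jet_index_def jet_def)
    ultimately show "val ns (lift p) f = 0 \<and> (\<forall>w\<in>cox_vars ns. deriv ns (lift p) w f = 0)"
      using jet_zero_imp_deriv_zero[OF _ that(2), of p] that(1) assms(3) by blast
  qed (auto simp: jet_index_def jet_def jet_vars_def)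
  moreover have "f \<in> double_point_sections ns p J \<longleftrightarrow> f \<in> sections ns (\<lambda>_. 1) J \<and>
    (nonzero_on J (lift p) \<longrightarrow> val ns (lift p) f = 0 \<and> (\<forall>w\<in>cox_vars ns. deriv ns (lift p) w f = 0))"
    if "p \<in> S" for p
    using that assms(3) by (intro double_point_sections_iff[OF assms(1,2)]) auto
  ultimately show ?thesis unfolding double_sections_def line_sections_eq by auto
qed

section \<open>Global sections with a prescribed jet at one point\<close>

definition pivot_section :: "nat list \<Rightarrow> 'a::field mpoint \<Rightarrow> 'a laurent" where
  "pivot_section ns p = single (chart_exp ns (pivot p)) 1"

text \<open>After division by \<open>pivot_section\<close>, this is the affine coordinate of
  \<open>w\<close> centered at \<open>p\<close>. Together with \<open>pivot_section\<close>, these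
  sections are dual to the jet coordinates at \<open>p\<close>.\<close>

definition tangent_section :: "nat list \<Rightarrow> 'a::field mpoint \<Rightarrow> nat \<times> nat \<Rightarrow> 'a laurent" where
  "tangent_section ns p w =
     pivot_section ns p * (ratio (pivot p) w 1 - cst (lift p (fst w) (snd w)))"

lemma pivot_section_sections: "p \<in> mproj ns \<Longrightarrow> pivot_section ns p \<in> sections ns (\<lambda>_. 1) J"
  unfolding pivot_section_def by (intro sections_single chart_exp_adm pivots_pivot)

text \<open>The factor \<open>ratio\<close> has a denominator, but it is one of the variables of the
  pivot monomial and cancels, so the section is global.\<close>

lemma tangent_section_sections:
  assumes p: "p \<in> mproj ns" and w: "w \<in> cox_vars ns"
  shows "tangent_section ns p w \<in> sections ns (\<lambda>_. 1) {}"
proof -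
  let ?a = "pivot p" and ?J = "pivots ns (pivot p)"
  have "chart_exp ns ?a + ratio_exp ?a w 1 \<in> adm ns (\<lambda>i. 1 + 0) ?J"
    using pivots_pivot[OF p] w by (intro adm_add chart_exp_adm ratio_exp_adm) auto
  moreover have "lookup (chart_exp ns ?a + ratio_exp ?a w 1) v \<ge> 0" for v
    using w by (auto simp: lookup_add lookup_chart_exp ratio_exp_def lookup_minus lookup_single when_def cox_vars_def)
  ultimately have "chart_exp ns ?a + ratio_exp ?a w 1 \<in> adm ns (\<lambda>_. 1) {}"
    by (auto simp: adm_def not_less)
  then have "pivot_section ns p * ratio ?a w 1 \<in> sections ns (\<lambda>_. 1) {}"
    by (auto simp: pivot_section_def ratio_def mult_single intro: sections_single)
  then show ?thesis
    unfolding tangent_section_def right_diff_distrib mult.commute[of _ "cst _"]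
    by (intro sections_diff sections_scale pivot_section_sections[OF p])
qed

lemma jet_pivot_section:
  assumes p: "p \<in> mproj ns" and e: "e \<in> jet_index ns p"
  shows "jet ns p e (pivot_section ns p) = (if e = None then 1 else 0)"
proof (cases e)
  case None
  have "mono_val ns (lift p) (chart_exp ns (pivot p)) = 1"
    unfolding mono_val_def using lift_pivot[OF p]
    by (intro prod.neutral) (auto simp: lookup_chart_exp cox_vars_def)
  then show ?thesis using None by (simp add: jet_def pivot_section_def val_linear)
next
  case (Some w)
  then have "lookup (chart_exp ns (pivot p)) w = 0"
    using e by (auto simp: jet_index_def jet_vars_def lookup_chart_exp)
  then show ?thesis using Some by (simp add: jet_def pivot_section_def deriv_linear mono_deriv_def)
qed

lemma jet_tangent_section:
  assumes p: "p \<in> mproj ns" and w: "w \<in> jet_vars ns p" and e: "e \<in> jet_index ns p"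
  shows "jet ns p e (tangent_section ns p w) = (if e = Some w then 1 else 0)"
proof -
  let ?a = "pivot p" and ?J = "pivots ns (pivot p)" and ?x = "lift p"
  let ?r = "ratio ?a w 1 - cst (?x (fst w) (snd w))"
  note J = pivots_pivot[OF p]
  have w': "w \<in> cox_vars ns" "snd w \<noteq> ?a (fst w)" using w by (auto simp: jet_vars_def)
  have one: "?x (fst w) (?a (fst w)) = 1" using w' lift_pivot[OF p] by (auto simp: cox_vars_def)
  have s: "pivot_section ns p \<in> sections ns (\<lambda>_. 1) ?J" by (rule pivot_section_sections[OF p])
  have r: "?r \<in> sections ns (\<lambda>_. 0) ?J"
    using J w' by (intro sections_diff ratio_sections sections_const) auto
  have v: "val ns ?x ?r = 0"
    using val_ratio[OF w'(1) order_refl J(1) w'(2), of ?x] one by (simp add: val_linear(2) val_const)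
  have v1: "val ns ?x (pivot_section ns p) = 1"
    using jet_pivot_section[OF p, of None] by (simp add: jet_index_def jet_def)
  show ?thesis
  proof (cases e)
    case None
    then show ?thesis by (simp add: jet_def tangent_section_def val_mult[OF s r J(2)] v)
  next
    case (Some u)
    then have u: "u \<in> cox_vars ns" "snd u \<noteq> ?a (fst u)" using e by (auto simp: jet_index_def jet_vars_def)
    have "deriv ns ?x u ?r = (if u = w then 1 else 0)"
      using deriv_ratio[OF w'(1) order_refl J(1) w'(2) u, of ?x] one by (simp add: deriv_linear(2) deriv_const)
    then show ?thesis
      using Some by (simp add: jet_def tangent_section_def deriv_mult[OF s r J(2) u(1)] v v1)
  qed
qed

lemma section_with_jet:
  assumes p: "p \<in> mproj ns"
  shows "\<exists>s\<in>sections ns (\<lambda>_. 1) {}. \<forall>e\<in>jet_index ns p. jet ns p e s = t e"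
proof
  let ?s = "cst (t None) * pivot_section ns p + (\<Sum>w\<in>jet_vars ns p. cst (t (Some w)) * tangent_section ns p w)"
  show "?s \<in> sections ns (\<lambda>_. 1) {}"
    by (intro sections_add sections_sum sections_scale pivot_section_sections tangent_section_sections p)
      (auto simp: jet_vars_def)
  show "\<forall>e\<in>jet_index ns p. jet ns p e ?s = t e"
  proof
    fix e assume e: "e \<in> jet_index ns p"
    have "(\<Sum>w\<in>jet_vars ns p. t (Some w) * jet ns p e (tangent_section ns p w)) =
        (\<Sum>w\<in>jet_vars ns p. if e = Some w then t e else 0)"
      by (intro sum.cong refl) (auto simp: jet_tangent_section[OF p _ e])
    also have "\<dots> = (if e = None then 0 else t e)"
    proof (cases e)
      case (Some w)
      then have "w \<in> jet_vars ns p" using e by (auto simp: jet_index_def)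
      then show ?thesis using Some by (simp add: finite_jet_vars)
    qed simp
    finally show "jet ns p e ?s = t e"
      by (simp add: jet_add jet_scale jet_sum jet_pivot_section[OF p e])
  qed
qed

section \<open>Interpolation of jets at several points over an open set\<close>

lemma square_vanishes:
  assumes "u \<in> sections ns (\<lambda>_. 0) J" "val ns x u = 0" "r \<in> sections ns d J" "nonzero_on J x"
  shows "val ns x (u * u * r) = 0" "w \<in> cox_vars ns \<Longrightarrow> deriv ns x w (u * u * r) = 0"
proof -
  have uu: "u * u \<in> sections ns (\<lambda>_. 0) J" using sections_mult[OF assms(1,1)] by simp
  show "val ns x (u * u * r) = 0"
    by (simp add: val_mult[OF uu assms(3,4)] val_mult[OF assms(1,1,4)] assms(2))
  show "w \<in> cox_vars ns \<Longrightarrow> deriv ns x w (u * u * r) = 0"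
    by (simp add: deriv_mult[OF uu assms(3,4)] deriv_mult[OF assms(1,1,4)] val_mult[OF assms(1,1,4)] assms(2))
qed

text \<open>The linear forms x_j - q_j x_b, with b the pivot of \<open>q\<close>, vanish at
  \<open>q\<close>. If all of them vanished at \<open>p\<close> too, the lift of \<open>p\<close>
  would be a multiple of the lift of \<open>q\<close>.\<close>

lemma separating_form:
  assumes "p \<in> mproj ns" "q \<in> mproj ns" "i < length ns" "p i \<noteq> q i"
  shows "\<exists>j\<le>ns ! i. lift p i j \<noteq> lift q i j * lift p i (pivot q i)"
proof (rule ccontr)
  assume *: "\<not> ?thesis"
  define c where "c = lift p i (pivot q i)"
  have e: "lift p i = (\<lambda>j. c * lift q i j)"
  proof
    fix j
    show "lift p i j = c * lift q i j"
      using * lift_kspace[OF assms(1,3)] lift_kspace[OF assms(2,3)]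
      by (cases "j \<le> ns ! i") (auto simp: kspace_def c_def mult.commute)
  qed
  have "c \<noteq> 0" using e lift_pivot[OF assms(1,3)] by auto
  have "p i = range (\<lambda>b j. b * (c * lift q i j))"
    by (subst point_eq[OF assms(1,3)]) (simp add: e)
  also have "\<dots> = range (\<lambda>b j. b * lift q i j)"
  proof
    show "range (\<lambda>b j. b * (c * lift q i j)) \<subseteq> range (\<lambda>b j. b * lift q i j)"
      by (auto simp: mult.assoc[symmetric])
    have "(\<lambda>j. b * lift q i j) = (\<lambda>j. (b / c) * (c * lift q i j))" for b using \<open>c \<noteq> 0\<close> by simp
    then show "range (\<lambda>b j. b * lift q i j) \<subseteq> range (\<lambda>b j. b * (c * lift q i j))" by (metis image_subsetI rangeI)
  qed
  finally show False using point_eq[OF assms(2,3)] assms(4) by simp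
qed

lemma mproj_neqE:
  assumes "p \<in> mproj ns" "q \<in> mproj ns" "p \<noteq> q"
  obtains i where "i < length ns" "p i \<noteq> q i"
  using assms unfolding mproj_def by (metis PiE_ext lessThan_iff)

lemma separating_section:
  assumes pq: "p \<in> mproj ns" "q \<in> mproj ns" "p \<noteq> q"
    and J: "pivots ns a \<subseteq> J" "J \<subseteq> cox_vars ns" and nz: "nonzero_on J (lift p)" "nonzero_on J (lift q)"
  shows "\<exists>u\<in>sections ns (\<lambda>_. 0) J. val ns (lift q) u = 0 \<and> val ns (lift p) u \<noteq> 0"
proof -
  obtain i where i: "i < length ns" "p i \<noteq> q i" using mproj_neqE[OF pq] .
  obtain j where j: "j \<le> ns ! i" "lift p i j \<noteq> lift q i j * lift p i (pivot q i)"
    using separating_form[OF pq(1,2) i] by blast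
  let ?u = "ratio a (i, j) 1 - cst (lift q i j) * ratio a (i, pivot q i) 1"
  have w: "(i, j) \<in> cox_vars ns" "(i, pivot q i) \<in> cox_vars ns"
    using i j pivot_le[OF pq(2)] by (auto simp: cox_vars_def)
  have v: "val ns x ?u = (x i j - lift q i j * x i (pivot q i)) / x i (a i)" if "nonzero_on J x" for x
    using val_ratio'[OF J that w(1)] val_ratio'[OF J that w(2)]
    by (simp add: val_linear(2,5) diff_divide_distrib)
  have "?u \<in> sections ns (\<lambda>_. 0) J"
    by (intro sections_diff sections_scale ratio_sections w J) auto
  moreover have "val ns (lift q) ?u = 0" using v[OF nz(2)] lift_pivot[OF pq(2) i(1)] by simp
  moreover have "val ns (lift p) ?u \<noteq> 0"
    using v[OF nz(1)] j(2) x_pivot[OF J nz(1) w(1)] by simp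
  ultimately show ?thesis by blast
qed

text \<open>A global section is multiplied by \<open>h\<close>, a product of squares of functions
  that vanish at the other points but not at \<open>p\<close>. The squares kill the first jets at
  the other points, and as \<open>h\<close> is nonzero at \<open>p\<close>, multiplication by it is
  invertible on jets at \<open>p\<close>.\<close>

lemma local_interpolation_single:
  assumes S: "S \<subseteq> mproj ns" "finite S" and p: "p \<in> S" and J: "pivots ns a \<subseteq> J" "J \<subseteq> cox_vars ns"
    and nz: "\<And>q. q \<in> S \<Longrightarrow> nonzero_on J (lift q)"
  shows "\<exists>f\<in>sections ns (\<lambda>_. 1) J. (\<forall>e\<in>jet_index ns p. jet ns p e f = t e) \<and>
    (\<forall>q\<in>S - {p}. \<forall>e\<in>jet_index ns q. jet ns q e f = 0)"
proof -
  have "\<exists>u\<in>sections ns (\<lambda>_. 0) J. val ns (lift q) u = 0 \<and> val ns (lift p) u \<noteq> 0" if "q \<in> S - {p}" for q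
    using that S p nz by (intro separating_section[OF _ _ _ J]) auto
  then obtain u where u: "\<And>q. q \<in> S - {p} \<Longrightarrow> u q \<in> sections ns (\<lambda>_. 0) J"
    "\<And>q. q \<in> S - {p} \<Longrightarrow> val ns (lift q) (u q) = 0" "\<And>q. q \<in> S - {p} \<Longrightarrow> val ns (lift p) (u q) \<noteq> 0"
    by metis
  define h where "h T = (\<Prod>q\<in>T. u q * u q)" for T
  have h: "h T \<in> sections ns (\<lambda>_. 0) J \<and> val ns (lift p) (h T) \<noteq> 0" if "T \<subseteq> S - {p}" for T
  proof -
    have "finite T" using that S(2) finite_subset by blast
    then show ?thesis using that
    proof (induction T)
      case empty
      then show ?case using sections_const[of 1 ns J] by (simp add: h_def)
    next
      case (insert q T)
      have q: "u q \<in> sections ns (\<lambda>_. 0) J" using u insert by auto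
      have qq: "u q * u q \<in> sections ns (\<lambda>_. 0) J" using sections_mult[OF q q] by simp
      have T: "h T \<in> sections ns (\<lambda>_. 0) J" "val ns (lift p) (h T) \<noteq> 0" using insert by auto
      have "h (insert q T) = u q * u q * h T" using insert by (simp add: h_def)
      moreover have "val ns (lift p) (u q * u q * h T) \<noteq> 0"
        using u(3)[of q] insert T by (simp add: val_mult[OF qq T(1) nz[OF p]] val_mult[OF q q nz[OF p]])
      ultimately show ?case using sections_mult[OF qq T(1)] by simp
    qed
  qed
  let ?h = "h (S - {p})" and ?x = "lift p"
  have hs: "?h \<in> sections ns (\<lambda>_. 0) J" and h0: "val ns ?x ?h \<noteq> 0" using h by auto
  \<comment> \<open>\<open>s0\<close> and the derivatives prescribed next solve the Leibniz rule for
    the jet of \<open>h * s\<close> to be \<open>t\<close>.\<close>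
  define s0 where "s0 = t None / val ns ?x ?h"
  obtain s where s: "s \<in> sections ns (\<lambda>_. 1) {}"
    "\<And>e. e \<in> jet_index ns p \<Longrightarrow> jet ns p e s =
      (case e of None \<Rightarrow> s0 | Some w \<Rightarrow> (t e - deriv ns ?x w ?h * s0) / val ns ?x ?h)"
    using section_with_jet[of p ns "\<lambda>e. case e of None \<Rightarrow> s0 | Some w \<Rightarrow> (t e - deriv ns ?x w ?h * s0) / val ns ?x ?h"]
      S p by blast
  have sJ: "s \<in> sections ns (\<lambda>_. 1) J" using s(1) sections_mono[of "{}" J] by blast
  have "?h * s \<in> sections ns (\<lambda>_. 1) J" using sections_mult[OF hs sJ] by simp
  moreover have "jet ns p e (?h * s) = t e" if e: "e \<in> jet_index ns p" for e
  proof (cases e)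
    case None
    then show ?thesis using s(2)[OF e] h0 by (simp add: jet_def val_mult[OF hs sJ nz[OF p]] s0_def)
  next
    case (Some w)
    have "val ns ?x s = s0" using s(2)[of None] by (simp add: jet_index_def jet_def)
    moreover have "w \<in> cox_vars ns" using e Some by (auto simp: jet_index_def jet_vars_def)
    ultimately show ?thesis
      using s(2)[OF e] h0 Some by (simp add: jet_def deriv_mult[OF hs sJ nz[OF p]])
  qed
  moreover have "jet ns q e (?h * s) = 0" if q: "q \<in> S - {p}" and e: "e \<in> jet_index ns q" for q e
  proof -
    have "?h = u q * u q * h (S - {p} - {q})"
      unfolding h_def using S(2) q by (subst prod.remove) auto
    then have eq: "?h * s = u q * u q * (h (S - {p} - {q}) * s)" by (simp add: mult.assoc)
    have r: "h (S - {p} - {q}) * s \<in> sections ns (\<lambda>_. 1) J"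
      using h[of "S - {p} - {q}"] sJ by (intro sections_mult[of _ ns "\<lambda>_. 0" J s "\<lambda>_. 1"]) auto
    show ?thesis unfolding eq
      using square_vanishes[OF u(1,2)[OF q] r nz] q e
      by (cases e) (auto simp: jet_def jet_index_def jet_vars_def)
  qed
  ultimately show ?thesis by blast
qed

lemma local_interpolation:
  assumes S: "S \<subseteq> mproj ns" "finite S" and J: "pivots ns a \<subseteq> J" "J \<subseteq> cox_vars ns"
  shows "\<exists>f\<in>sections ns (\<lambda>_. 1) J. \<forall>p\<in>S. nonzero_on J (lift p) \<longrightarrow> (\<forall>e\<in>jet_index ns p. jet ns p e f = t p e)"
proof -
  define T where "T = {p\<in>S. nonzero_on J (lift p)}"
  have T: "T \<subseteq> mproj ns" "finite T" "\<And>q. q \<in> T \<Longrightarrow> nonzero_on J (lift q)" using S by (auto simp: T_def)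
  have "\<exists>f\<in>sections ns (\<lambda>_. 1) J. (\<forall>e\<in>jet_index ns p. jet ns p e f = t p e) \<and>
    (\<forall>q\<in>T - {p}. \<forall>e\<in>jet_index ns q. jet ns q e f = 0)" if "p \<in> T" for p
    by (rule local_interpolation_single[OF T(1,2) that J T(3)])
  then obtain f where f: "\<And>p. p \<in> T \<Longrightarrow> f p \<in> sections ns (\<lambda>_. 1) J"
    "\<And>p e. p \<in> T \<Longrightarrow> e \<in> jet_index ns p \<Longrightarrow> jet ns p e (f p) = t p e"
    "\<And>p q e. p \<in> T \<Longrightarrow> q \<in> T - {p} \<Longrightarrow> e \<in> jet_index ns q \<Longrightarrow> jet ns q e (f p) = 0"
    by metis
  have "jet ns p e (\<Sum>p\<in>T. f p) = t p e" if "p \<in> T" "e \<in> jet_index ns p" for p e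
  proof -
    have "(\<Sum>q\<in>T - {p}. jet ns p e (f q)) = 0" using that f(3) by (intro sum.neutral) auto
    then show ?thesis
      unfolding jet_sum using that f(2) T(2) by (subst sum.remove[of _ p]) auto
  qed
  then show ?thesis using f(1) by (intro bexI[of _ "\<Sum>p\<in>T. f p"] sections_sum) (auto simp: T_def)
qed

section \<open>Cech cohomology in degrees 0 and 1\<close>

lemma chart_vars_Nil [simp]: "chart_vars ns [] = {}"
  by (simp add: chart_vars_def)

lemma chart_vars_Cons [simp]: "chart_vars ns (a # l) = pivots ns a \<union> chart_vars ns l"
  by (auto simp: chart_vars_def pivots_def)

lemma charts_pivots: "a \<in> charts ns \<Longrightarrow> pivots ns a \<subseteq> cox_vars ns"
  by (auto simp: charts_def pivots_def cox_vars_def PiE_iff)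

lemma finite_charts: "finite (charts ns)"
  unfolding charts_def by (intro finite_PiE) auto

text \<open>A chart that contains \<open>p\<close>; the restriction is needed because the elements
  of \<open>charts\<close> are extensional functions.\<close>

definition pivot_chart :: "nat list \<Rightarrow> 'a::field mpoint \<Rightarrow> chart" where
  "pivot_chart ns p = (\<lambda>i\<in>{..<length ns}. pivot p i)"

lemma pivots_pivot_chart [simp]: "pivots ns (pivot_chart ns p) = pivots ns (pivot p)"
  by (auto simp: pivots_def pivot_chart_def)

lemma pivot_chart_in: "p \<in> mproj ns \<Longrightarrow> pivot_chart ns p \<in> charts ns"
  using pivot_le[of p ns] by (auto simp: charts_def pivot_chart_def)

lemma nonzero_on_Un [simp]: "nonzero_on (J \<union> J') x \<longleftrightarrow> nonzero_on J x \<and> nonzero_on J' x"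
  by (auto simp: nonzero_on_def)

lemma length_eq_3E:
  assumes "length l = 3"
  obtains x y z where "l = [x, y, z]"
  using assms by (auto simp: length_Suc_conv numeral_3_eq_3)

lemma length_eq_2E:
  assumes "length l = 2"
  obtains x y where "l = [x, y]"
  using assms by (auto simp: length_Suc_conv numeral_2_eq_2)

lemma cech_d_2: "set [x, y] \<subseteq> charts ns \<Longrightarrow> cech_d ns c [x, y] = c [y] - c [x]"
  by (simp add: cech_d_def lessThan_Suc)

lemma cech_d_3:
  "set [x, y, z] \<subseteq> charts ns \<Longrightarrow> cech_d ns c [x, y, z] = c [y, z] - c [x, z] + c [x, y]"
  by (simp add: cech_d_def lessThan_Suc numeral_3_eq_3)

lemma cech_d_eq_0:
  assumes "\<And>l'. length l' = length l - 1 \<Longrightarrow> c l' = 0"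
  shows "cech_d ns c l = 0"
  unfolding cech_d_def using assms by (auto intro!: sum.neutral)

lemma cech_d_cochains_0:
  assumes "c \<in> cochains ns F 0"
  shows "cech_d ns c l = (if length l = 2 \<and> set l \<subseteq> charts ns then c [l ! 1] - c [l ! 0] else 0)"
proof (cases "length l = 2 \<and> set l \<subseteq> charts ns")
  case True
  then obtain x y where "l = [x, y]" by (auto elim: length_eq_2E)
  then show ?thesis using True cech_d_2[of x y ns c] by simp
next
  case False
  have "cech_d ns c l = 0"
  proof (cases "length l = 2")
    case True
    then show ?thesis using False by (simp add: cech_d_def)
  next
    case False
    have "c l' = 0" if "length l' = length l - 1" for l'
    proof -
      have "length l' \<noteq> 1" using that False by (cases l) auto
      then show ?thesis using assms by (simp add: cochains_def)
    qed
    then show ?thesis by (rule cech_d_eq_0)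
  qed
  then show ?thesis using False by (simp only: if_False)
qed

lemma cech_d_cochains_1:
  assumes "c \<in> cochains ns F 1"
  shows "cech_d ns c = 0 \<longleftrightarrow>
    (\<forall>x\<in>charts ns. \<forall>y\<in>charts ns. \<forall>z\<in>charts ns. c [y, z] - c [x, z] + c [x, y] = 0)"
proof
  assume d: "cech_d ns c = 0"
  show "\<forall>x\<in>charts ns. \<forall>y\<in>charts ns. \<forall>z\<in>charts ns. c [y, z] - c [x, z] + c [x, y] = 0"
  proof (intro ballI)
    fix x y z assume "x \<in> charts ns" "y \<in> charts ns" "z \<in> charts ns"
    then show "c [y, z] - c [x, z] + c [x, y] = 0"
      using cech_d_3[of x y z ns c] fun_cong[OF d, of "[x, y, z]"] by simp
  qed
next
  assume *: "\<forall>x\<in>charts ns. \<forall>y\<in>charts ns. \<forall>z\<in>charts ns. c [y, z] - c [x, z] + c [x, y] = 0"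
  show "cech_d ns c = 0"
  proof
    fix l
    show "cech_d ns c l = 0 l"
    proof (cases "length l = 3")
      case True
      then obtain x y z where l: "l = [x, y, z]" by (rule length_eq_3E)
      show ?thesis
      proof (cases "set l \<subseteq> charts ns")
        case True
        then show ?thesis using * cech_d_3[of x y z ns c] by (simp add: l)
      qed (simp add: cech_d_def)
    next
      case False
      have "c l' = 0" if "length l' = length l - 1" for l'
      proof (cases "length l' = 2")
        case True
        then have "length l = 3" using that by simp
        then show ?thesis using False by simp
      next
        case False
        then show ?thesis using assms by (simp add: cochains_def)
      qed
      then show ?thesis by (simp add: cech_d_eq_0)
    qed
  qed
qed

lemma cech_d_d_0:
  assumes c: "c \<in> cochains ns F 0" and dc: "cech_d ns c \<in> cochains ns G 1"
  shows "cech_d ns (cech_d ns c) = 0"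
  unfolding cech_d_cochains_1[OF dc] by (auto simp: cech_d_cochains_0[OF c])

section \<open>Vanishing of h^1(O(1, ..., 1)) through an explicit primitive\<close>

definition positive_chart :: "nat list \<Rightarrow> (nat \<times> nat \<Rightarrow>\<^sub>0 int) \<Rightarrow> chart" where
  "positive_chart ns m = (\<lambda>i\<in>{..<length ns}. SOME j. j \<le> ns ! i \<and> lookup m (i, j) > 0)"

text \<open>In each factor the exponents of \<open>m\<close> sum to 1, so at least one of them is
  positive.\<close>

lemma positive_chart:
  assumes "m \<in> adm ns (\<lambda>_. 1) J"
  shows "positive_chart ns m \<in> charts ns"
    "v \<in> pivots ns (positive_chart ns m) \<Longrightarrow> lookup m v > 0"
proof -
  have "\<exists>j. j \<le> ns ! i \<and> lookup m (i, j) > 0" if "i < length ns" for i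
  proof (rule ccontr)
    assume "\<not> ?thesis"
    then have "multideg ns m i \<le> 0"
      unfolding multideg_def by (intro sum_nonpos) (auto simp: not_less)
    then show False using assms that by (auto simp: adm_def)
  qed
  then have *: "positive_chart ns m i \<le> ns ! i \<and> lookup m (i, positive_chart ns m i) > 0"
    if "i < length ns" for i
    using that unfolding positive_chart_def by simp (rule someI_ex)
  then show "positive_chart ns m \<in> charts ns"
    by (auto simp: charts_def positive_chart_def)
  show "v \<in> pivots ns (positive_chart ns m) \<Longrightarrow> lookup m v > 0"
    using * by (auto simp: pivots_def)
qed

text \<open>The coefficient at \<open>m\<close> is that of the cocycle relative to a base chart depending on \<open>m\<close>, given by a
  variable of positive exponent in each factor; so the variables of negative exponent in \<open>m\<close> must
  all belong to the other chart.\<close>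

definition primitive :: "nat list \<Rightarrow> 'a::field cochain \<Rightarrow> chart \<Rightarrow> 'a laurent" where
  "primitive ns c a = (\<Sum>b\<in>charts ns. Poly_Mapping.mapp (\<lambda>m x. if positive_chart ns m = b then x else 0) (c [b, a]))"

lemma lookup_primitive:
  "lookup (primitive ns c a) m =
    (if positive_chart ns m \<in> charts ns then lookup (c [positive_chart ns m, a]) m else 0)"
proof -
  have "lookup (primitive ns c a) m =
    (\<Sum>b\<in>charts ns. if b = positive_chart ns m then lookup (c [b, a]) m else 0)"
    unfolding primitive_def lookup_sum
    by (intro sum.cong refl) (auto simp: Poly_Mapping.lookup_mapp when_def in_keys_iff)
  then show ?thesis by (simp add: finite_charts)
qed

lemma primitive_add: "primitive ns (c + d) a = primitive ns c a + primitive ns d a"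
  by (rule poly_mapping_eqI) (simp add: lookup_primitive lookup_add)

lemma primitive_scale: "primitive ns (cochain_scale r c) a = cst r * primitive ns c a"
  by (rule poly_mapping_eqI) (simp add: lookup_primitive lookup_scale cochain_scale_def)

lemma cochains_1D:
  "c \<in> cochains ns (line_sections ns 1) 1 \<Longrightarrow> x \<in> charts ns \<Longrightarrow> y \<in> charts ns \<Longrightarrow>
    c [x, y] \<in> sections ns (\<lambda>_. 1) (pivots ns x \<union> pivots ns y)"
  unfolding cochains_def line_sections_eq
  by (drule CollectD, drule spec[of _ "[x, y]"]) simp

lemma primitive_sections:
  assumes c: "c \<in> cochains ns (line_sections ns 1) 1" and a: "a \<in> charts ns"
  shows "primitive ns c a \<in> sections ns (\<lambda>_. 1) (pivots ns a)"
  unfolding sections_def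
proof (intro CollectI subsetI)
  fix m assume "m \<in> keys (primitive ns c a)"
  then have *: "positive_chart ns m \<in> charts ns" "m \<in> keys (c [positive_chart ns m, a])"
    by (auto simp: in_keys_iff lookup_primitive split: if_splits)
  then have m: "m \<in> adm ns (\<lambda>_. 1) (pivots ns (positive_chart ns m) \<union> pivots ns a)"
    using cochains_1D[OF c *(1) a] by (auto simp: sections_def)
  then show "m \<in> adm ns (\<lambda>_. 1) (pivots ns a)"
    using positive_chart(2)[OF m] unfolding adm_def by fastforce
qed

text \<open>At a fixed exponent \<open>m\<close> the base chart is the same for \<open>x\<close> and
  \<open>y\<close>, so the cocycle relation for the base chart, \<open>x\<close> and
  \<open>y\<close> gives the equality of the coefficients. Exponents without a positive chart do not
  occur in degree (1, ..., 1).\<close>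

lemma primitive_diff:
  assumes c: "c \<in> cochains ns (line_sections ns 1) 1" and d: "cech_d ns c = 0"
    and x: "x \<in> charts ns" and y: "y \<in> charts ns"
  shows "c [x, y] = primitive ns c y - primitive ns c x"
proof (rule poly_mapping_eqI)
  fix m
  show "lookup (c [x, y]) m = lookup (primitive ns c y - primitive ns c x) m"
  proof (cases "positive_chart ns m \<in> charts ns")
    case True
    then have "c [x, y] - c [positive_chart ns m, y] + c [positive_chart ns m, x] = 0"
      using d x y unfolding cech_d_cochains_1[OF c] by blast
    then have "c [x, y] = c [positive_chart ns m, y] - c [positive_chart ns m, x]"
      by (simp add: algebra_simps)
    then show ?thesis using True by (simp add: lookup_minus lookup_primitive)
  next
    case False
    then have "m \<notin> keys (c [x, y])"
      using cochains_1D[OF c x y] positive_chart(1) by (auto simp: sections_def)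
    then show ?thesis using False by (simp add: lookup_minus lookup_primitive in_keys_iff)
  qed
qed

text \<open>As every factor has positive dimension, it has at least two coordinates, so for each
  variable there is a chart that does not select it. Over that chart its exponent cannot be
  negative.\<close>

lemma global_sections:
  assumes pos: "\<forall>d\<in>set ns. d > 0" and f: "\<And>a. a \<in> charts ns \<Longrightarrow> f \<in> sections ns (\<lambda>_. 1) (pivots ns a)"
  shows "f \<in> sections ns (\<lambda>_. 1) {}"
  unfolding sections_def
proof (intro CollectI subsetI)
  fix m assume m: "m \<in> keys f"
  have adm: "m \<in> adm ns (\<lambda>_. 1) (pivots ns a)" if "a \<in> charts ns" for a
    using f[OF that] m by (auto simp: sections_def)
  have "\<not> lookup m (i, j) < 0" for i j
  proof
    assume neg: "lookup m (i, j) < 0"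
    define a where "a = (\<lambda>i'\<in>{..<length ns}. if i' = i then (if j = 0 then 1 else 0) else (0::nat))"
    have "a i' \<le> ns ! i'" if "i' < length ns" for i'
      using pos nth_mem[OF that] that by (auto simp: a_def Suc_le_eq)
    then have a: "a \<in> charts ns" by (auto simp: charts_def a_def)
    have "(i, j) \<in> pivots ns a" using adm[OF a] neg by (auto simp: adm_def)
    then have "i < length ns" "a i = j" by (auto simp: pivots_def)
    then show False by (auto simp: a_def split: if_splits)
  qed
  moreover have "(\<lambda>i\<in>{..<length ns}. 0) \<in> charts ns" by (auto simp: charts_def)
  ultimately show "m \<in> adm ns (\<lambda>_. 1) {}"
    using adm by (force simp: adm_def)
qed

lemma sections_empty_mono: "f \<in> sections ns d {} \<Longrightarrow> f \<in> sections ns d J"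
  using sections_mono[of "{}" J] by blast

section \<open>The connecting map between cocycles and jets, and the formula for
  \<open>delta\<close>\<close>

context
  fixes ns :: "nat list" and S :: "'a::field mpoint set"
  assumes pos: "\<forall>d\<in>set ns. d > 0" and S: "S \<subseteq> mproj ns" and finS: "finite S"
begin

lemma double_sections_chart:
  assumes "x \<in> charts ns"
  shows "f \<in> double_sections ns S (pivots ns x) \<longleftrightarrow> f \<in> sections ns (\<lambda>_. 1) (pivots ns x) \<and>
    (\<forall>p\<in>S. nonzero_on (pivots ns x) (lift p) \<longrightarrow> (\<forall>e\<in>jet_index ns p. jet ns p e f = 0))"
  by (rule double_sections_iff[OF order_refl charts_pivots[OF assms] S])

lemma double_sections_chart2:
  assumes "x \<in> charts ns" "y \<in> charts ns"
  shows "f \<in> double_sections ns S (pivots ns x \<union> pivots ns y) \<longleftrightarrow>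
    f \<in> sections ns (\<lambda>_. 1) (pivots ns x \<union> pivots ns y) \<and>
    (\<forall>p\<in>S. nonzero_on (pivots ns x) (lift p) \<and> nonzero_on (pivots ns y) (lift p) \<longrightarrow>
      (\<forall>e\<in>jet_index ns p. jet ns p e f = 0))"
  using double_sections_iff[of ns x "pivots ns x \<union> pivots ns y" S f] charts_pivots assms S by auto

lemma cochains_0_iff:
  "c \<in> cochains ns (double_sections ns S) 0 \<longleftrightarrow>
    (\<forall>x\<in>charts ns. c [x] \<in> double_sections ns S (pivots ns x)) \<and>
    (\<forall>l. \<not> (length l = 1 \<and> set l \<subseteq> charts ns) \<longrightarrow> c l = 0)"
proof
  assume c: "c \<in> cochains ns (double_sections ns S) 0"
  show "(\<forall>x\<in>charts ns. c [x] \<in> double_sections ns S (pivots ns x)) \<and>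
    (\<forall>l. \<not> (length l = 1 \<and> set l \<subseteq> charts ns) \<longrightarrow> c l = 0)"
  proof (intro conjI ballI allI impI)
    fix x assume "x \<in> charts ns"
    then show "c [x] \<in> double_sections ns S (pivots ns x)"
      using c[unfolded cochains_def, THEN CollectD, THEN spec, of "[x]"] by simp
  next
    fix l assume "\<not> (length l = 1 \<and> set l \<subseteq> charts ns)"
    then show "c l = 0"
      using c[unfolded cochains_def, THEN CollectD, THEN spec, of l] by simp
  qed
next
  assume "(\<forall>x\<in>charts ns. c [x] \<in> double_sections ns S (pivots ns x)) \<and>
    (\<forall>l. \<not> (length l = 1 \<and> set l \<subseteq> charts ns) \<longrightarrow> c l = 0)"
  then show "c \<in> cochains ns (double_sections ns S) 0"
    by (auto simp: cochains_def length_Suc_conv)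
qed

lemma cochains_1_iff:
  "c \<in> cochains ns (double_sections ns S) 1 \<longleftrightarrow>
    (\<forall>x\<in>charts ns. \<forall>y\<in>charts ns. c [x, y] \<in> double_sections ns S (pivots ns x \<union> pivots ns y)) \<and>
    (\<forall>l. \<not> (length l = 2 \<and> set l \<subseteq> charts ns) \<longrightarrow> c l = 0)"
proof
  assume c: "c \<in> cochains ns (double_sections ns S) 1"
  show "(\<forall>x\<in>charts ns. \<forall>y\<in>charts ns. c [x, y] \<in> double_sections ns S (pivots ns x \<union> pivots ns y)) \<and>
    (\<forall>l. \<not> (length l = 2 \<and> set l \<subseteq> charts ns) \<longrightarrow> c l = 0)"
  proof (intro conjI ballI allI impI)
    fix x y assume "x \<in> charts ns" "y \<in> charts ns"
    then show "c [x, y] \<in> double_sections ns S (pivots ns x \<union> pivots ns y)"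
      using c[unfolded cochains_def, THEN CollectD, THEN spec, of "[x, y]"] by simp
  next
    fix l assume "\<not> (length l = 2 \<and> set l \<subseteq> charts ns)"
    then show "c l = 0"
      using c[unfolded cochains_def, THEN CollectD, THEN spec, of l] by simp
  qed
next
  assume "(\<forall>x\<in>charts ns. \<forall>y\<in>charts ns. c [x, y] \<in> double_sections ns S (pivots ns x \<union> pivots ns y)) \<and>
    (\<forall>l. \<not> (length l = 2 \<and> set l \<subseteq> charts ns) \<longrightarrow> c l = 0)"
  then show "c \<in> cochains ns (double_sections ns S) 1"
    by (auto simp: cochains_def length_Suc_conv numeral_2_eq_2)
qed

lemma cochains_1_line: 
  assumes "c \<in> cochains ns (double_sections ns S) 1"
  shows "c \<in> cochains ns (line_sections ns 1) 1"
proof -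
  have "double_sections ns S J \<subseteq> line_sections ns 1 J" for J by (auto simp: double_sections_def)
  then show ?thesis using assms unfolding cochains_def by (auto split: if_splits)
qed

lemma double_sections_diff:
  assumes x: "x \<in> charts ns" and y: "y \<in> charts ns"
    and f: "f \<in> sections ns (\<lambda>_. 1) (pivots ns x)" and g: "g \<in> sections ns (\<lambda>_. 1) (pivots ns y)"
    and "\<And>p e. p \<in> S \<Longrightarrow> nonzero_on (pivots ns x) (lift p) \<Longrightarrow> nonzero_on (pivots ns y) (lift p) \<Longrightarrow>
      e \<in> jet_index ns p \<Longrightarrow> jet ns p e f = jet ns p e g"
  shows "g - f \<in> double_sections ns S (pivots ns x \<union> pivots ns y)"
proof -
  have "g - f \<in> sections ns (\<lambda>_. 1) (pivots ns x \<union> pivots ns y)"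
    using f g sections_mono[of "pivots ns x" "pivots ns x \<union> pivots ns y" ns "\<lambda>_. 1"]
      sections_mono[of "pivots ns y" "pivots ns x \<union> pivots ns y" ns "\<lambda>_. 1"]
    by (intro sections_diff) auto
  then show ?thesis unfolding double_sections_chart2[OF x y] using assms(5) by (auto simp: jet_diff)
qed

definition cochain_of :: "(chart \<Rightarrow> 'a laurent) \<Rightarrow> 'a cochain" where
  "cochain_of b l = (if length l = 1 \<and> set l \<subseteq> charts ns then b (hd l) else 0)"

lemma cochain_of_single [simp]: "x \<in> charts ns \<Longrightarrow> cochain_of b [x] = b x"
  by (simp add: cochain_of_def)

lemma cochain_of_cochain:
  "(\<And>x. x \<in> charts ns \<Longrightarrow> b x \<in> sections ns (\<lambda>_. 1) (pivots ns x)) \<Longrightarrow>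
    cochain_of b \<in> cochains ns (line_sections ns 1) 0"
  by (auto simp: cochains_def cochain_of_def line_sections_eq length_Suc_conv)

text \<open>The sections \<open>b x\<close> need not vanish doubly on \<open>S\<close>. If their
  jets agree on overlaps, their differences do vanish doubly, so the coboundary in O(1, ..., 1) is a
  cocycle of the ideal sheaf, though perhaps not a coboundary there.\<close>

lemma d_cochain_of_cocycle:
  assumes b: "\<And>x. x \<in> charts ns \<Longrightarrow> b x \<in> sections ns (\<lambda>_. 1) (pivots ns x)"
    and j: "\<And>x y p e. x \<in> charts ns \<Longrightarrow> y \<in> charts ns \<Longrightarrow> p \<in> S \<Longrightarrow> nonzero_on (pivots ns x) (lift p) \<Longrightarrow>
      nonzero_on (pivots ns y) (lift p) \<Longrightarrow> e \<in> jet_index ns p \<Longrightarrow> jet ns p e (b x) = jet ns p e (b y)"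
  shows "cech_d ns (cochain_of b) \<in> cocycles ns (double_sections ns S) 1"
proof -
  have "cech_d ns (cochain_of b) \<in> cochains ns (double_sections ns S) 1"
    unfolding cochains_1_iff
    by (auto simp: cech_d_cochains_0[OF cochain_of_cochain[OF b]] intro!: double_sections_diff b j)
  then show ?thesis unfolding cocycles_def using cech_d_d_0[OF cochain_of_cochain[OF b]] by blast
qed

text \<open>Modulo \<open>global_jets\<close>, this inverts the connecting homomorphism from jets to
  h^1 of the ideal sheaf. A cocycle of the ideal sheaf is a difference of sections of O(1, ..., 1)
  whose jets at a point of \<open>S\<close> agree on all charts containing it; the pivot chart is
  one of these.\<close>

definition connecting :: "'a cochain \<Rightarrow> 'a mpoint \<times> (nat \<times> nat) option \<Rightarrow> 'a" where
  "connecting c = jets ns S (\<lambda>p. primitive ns c (pivot_chart ns p))"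

definition global_jets :: "('a mpoint \<times> (nat \<times> nat) option \<Rightarrow> 'a) set" where
  "global_jets = (\<lambda>f. jets ns S (\<lambda>_. f)) ` sections ns (\<lambda>_. 1) {}"

lemma jets_cong:
  "(\<And>p e. p \<in> S \<Longrightarrow> e \<in> jet_index ns p \<Longrightarrow> jet ns p e (b p) = jet ns p e (b' p)) \<Longrightarrow> jets ns S b = jets ns S b'"
  by (auto simp: jets_def jets_index_def fun_eq_iff)

lemma jets_eqD:
  "jets ns S b = jets ns S b' \<Longrightarrow> p \<in> S \<Longrightarrow> e \<in> jet_index ns p \<Longrightarrow> jet ns p e (b p) = jet ns p e (b' p)"
  by (drule fun_cong[of _ _ "(p, e)"]) (auto simp: jets_def jets_index_def)

lemma linear_connecting: "Vector_Spaces.linear cochain_scale fscale connecting"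
  unfolding Vector_Spaces.linear_iff
  by (auto simp: connecting_def jets_def primitive_add primitive_scale jet_add jet_scale fun_eq_iff
      coch.vector_space_axioms fvec.vector_space_axioms)

lemma subspace_global_jets: "fvec.subspace global_jets"
  unfolding fvec.subspace_def
proof (intro conjI ballI allI)
  show "0 \<in> global_jets" unfolding global_jets_def
    by (rule image_eqI[of _ _ 0]) (auto simp: jets_def jet_def val_def deriv_def fun_eq_iff split: option.split)
  fix u assume "u \<in> global_jets"
  then obtain f where f: "u = jets ns S (\<lambda>_. f)" "f \<in> sections ns (\<lambda>_. 1) {}" by (auto simp: global_jets_def)
  show "u + v \<in> global_jets" if "v \<in> global_jets" for v
  proof -
    from that obtain g where g: "v = jets ns S (\<lambda>_. g)" "g \<in> sections ns (\<lambda>_. 1) {}" by (auto simp: global_jets_def)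
    show ?thesis unfolding global_jets_def using f g
      by (intro image_eqI[of _ _ "f + g"]) (auto simp: jets_def jet_add fun_eq_iff intro: sections_add)
  qed
  show "fscale c u \<in> global_jets" for c unfolding global_jets_def using f
    by (intro image_eqI[of _ _ "cst c * f"]) (auto simp: jets_def jet_scale fun_eq_iff intro: sections_scale)
qed

text \<open>Two primitives of one cocycle differ by sections that agree on all charts, hence by a
  global section.\<close>

lemma global_difference:
  assumes c: "c \<in> cochains ns (line_sections ns 1) 1" "cech_d ns c = 0"
    and b: "\<And>x. x \<in> charts ns \<Longrightarrow> b x \<in> sections ns (\<lambda>_. 1) (pivots ns x)"
    and cb: "\<And>x y. x \<in> charts ns \<Longrightarrow> y \<in> charts ns \<Longrightarrow> c [x, y] = b y - b x"
  shows "\<exists>f\<in>sections ns (\<lambda>_. 1) {}. \<forall>x\<in>charts ns. primitive ns c x = b x + f"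
proof -
  let ?o = "\<lambda>i\<in>{..<length ns}. 0::nat"
  have o: "?o \<in> charts ns" by (auto simp: charts_def)
  define f where "f = primitive ns c ?o - b ?o"
  have f: "f = primitive ns c x - b x" if x: "x \<in> charts ns" for x
    using primitive_diff[OF c o x] cb[OF o x] by (simp add: f_def algebra_simps)
  have "f \<in> sections ns (\<lambda>_. 1) {}"
    by (rule global_sections[OF pos]) (metis f sections_diff primitive_sections[OF c(1)] b)
  then show ?thesis using f by (intro bexI[of _ f]) auto
qed

text \<open>If \<open>c\<close> is the coboundary of sections with zero jets, these differ from
  \<open>primitive\<close> by a global section, whose jets are \<open>connecting c\<close>.
  Conversely, subtracting a global section with these jets from \<open>primitive\<close> leaves
  sections that vanish doubly on \<open>S\<close>.\<close>

lemma coboundary_iff: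
  "c \<in> coboundaries ns (double_sections ns S) 1 \<longleftrightarrow>
    c \<in> cocycles ns (double_sections ns S) 1 \<and> connecting c \<in> global_jets"
proof
  assume "c \<in> coboundaries ns (double_sections ns S) 1"
  then obtain b' where b': "b' \<in> cochains ns (double_sections ns S) 0" "c = cech_d ns b'" by auto
  define b where "b x = b' [x]" for x
  have bD: "b x \<in> double_sections ns S (pivots ns x)" if "x \<in> charts ns" for x
    using b'(1) that by (auto simp: cochains_0_iff b_def)
  have b: "b x \<in> sections ns (\<lambda>_. 1) (pivots ns x)" if "x \<in> charts ns" for x
    using bD[OF that] double_sections_chart[OF that] by blast
  have bj: "jet ns p e (b x) = 0" if "x \<in> charts ns" "p \<in> S" "nonzero_on (pivots ns x) (lift p)" "e \<in> jet_index ns p" for x p e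
    using bD[OF that(1)] double_sections_chart[OF that(1)] that by blast
  have "cochain_of b = b'"
    using b'(1) by (auto simp: cochain_of_def b_def cochains_0_iff fun_eq_iff length_Suc_conv)
  then have cb: "c = cech_d ns (cochain_of b)" using b'(2) by simp
  have cc: "c \<in> cocycles ns (double_sections ns S) 1"
    unfolding cb by (rule d_cochain_of_cocycle) (auto simp: b bj)
  then have c1: "c \<in> cochains ns (line_sections ns 1) 1" "cech_d ns c = 0"
    using cochains_1_line by (auto simp: cocycles_def)
  have "c [x, y] = b y - b x" if "x \<in> charts ns" "y \<in> charts ns" for x y
    unfolding cb using that by (simp add: cech_d_2)
  then obtain f where f: "f \<in> sections ns (\<lambda>_. 1) {}" "\<And>x. x \<in> charts ns \<Longrightarrow> primitive ns c x = b x + f"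
    using global_difference[OF c1 b] by blast
  have "connecting c = jets ns S (\<lambda>_. f)"
    unfolding connecting_def
  proof (rule jets_cong)
    fix p e assume p: "p \<in> S" "e \<in> jet_index ns p"
    then have pc: "pivot_chart ns p \<in> charts ns" using S pivot_chart_in by blast
    have "jet ns p e (b (pivot_chart ns p)) = 0"
      using bj[OF pc p(1) _ p(2)] pivots_pivot(2)[of p ns] p S by auto
    then show "jet ns p e (primitive ns c (pivot_chart ns p)) = jet ns p e f"
      using f(2)[OF pc] by (simp add: jet_add)
  qed
  then show "c \<in> cocycles ns (double_sections ns S) 1 \<and> connecting c \<in> global_jets"
    using cc f(1) by (auto simp: global_jets_def)
next
  assume "c \<in> cocycles ns (double_sections ns S) 1 \<and> connecting c \<in> global_jets"
  then obtain f where c: "c \<in> cochains ns (double_sections ns S) 1" "cech_d ns c = 0"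
    and f: "f \<in> sections ns (\<lambda>_. 1) {}" "connecting c = jets ns S (\<lambda>_. f)"
    by (auto simp: cocycles_def global_jets_def)
  have c1: "c \<in> cochains ns (line_sections ns 1) 1" using cochains_1_line[OF c(1)] .
  define b where "b x = primitive ns c x - f" for x
  have b: "b x \<in> sections ns (\<lambda>_. 1) (pivots ns x)" if "x \<in> charts ns" for x
    unfolding b_def by (intro sections_diff primitive_sections[OF c1 that] sections_empty_mono[OF f(1)])
  have bD: "b x \<in> double_sections ns S (pivots ns x)" if x: "x \<in> charts ns" for x
    unfolding double_sections_chart[OF x]
  proof (intro conjI b x ballI impI)
    fix p e assume p: "p \<in> S" "nonzero_on (pivots ns x) (lift p)" "e \<in> jet_index ns p"
    let ?pc = "pivot_chart ns p"
    have pc: "?pc \<in> charts ns" using S p pivot_chart_in by blast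
    have "c [x, ?pc] \<in> double_sections ns S (pivots ns x \<union> pivots ns ?pc)"
      using c(1) x pc unfolding cochains_1_iff by blast
    then have "jet ns p e (c [x, ?pc]) = 0"
      unfolding double_sections_chart2[OF x pc] using p pivots_pivot(2)[of p ns] S by auto
    then have "jet ns p e (primitive ns c ?pc) = jet ns p e (primitive ns c x)"
      using primitive_diff[OF c1 c(2) x pc] by (simp add: jet_diff)
    moreover have "jet ns p e (primitive ns c ?pc) = jet ns p e f"
      using jets_eqD[OF f(2)[unfolded connecting_def] p(1,3)] .
    ultimately show "jet ns p e (b x) = 0" by (simp add: b_def jet_diff)
  qed
  have "c = cech_d ns (cochain_of b)"
  proof
    fix l
    show "c l = cech_d ns (cochain_of b) l"
    proof (cases "length l = 2 \<and> set l \<subseteq> charts ns")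
      case True
      then obtain x y where l: "l = [x, y]" by (auto elim: length_eq_2E)
      then show ?thesis using True primitive_diff[OF c1 c(2), of x y] by (simp add: cech_d_2 b_def)
    next
      case False
      then show ?thesis using c(1) cech_d_cochains_0[OF cochain_of_cochain[OF b], of l]
        unfolding cochains_1_iff by auto
    qed
  qed
  moreover have "cochain_of b \<in> cochains ns (double_sections ns S) 0"
    unfolding cochains_0_iff using bD by (auto simp: cochain_of_def)
  ultimately show "c \<in> coboundaries ns (double_sections ns S) 1" by simp
qed

text \<open>On each chart, \<open>v\<close> is interpolated at the points lying in it. The
  coboundary of these local solutions is the required cocycle, and its canonical primitive differs
  from them by a global section.\<close>

lemma connecting_surj:
  assumes v: "v \<in> supported (jets_index ns S)"
  shows "\<exists>c\<in>cocycles ns (double_sections ns S) 1. v - connecting c \<in> global_jets"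
proof -
  have "\<exists>f\<in>sections ns (\<lambda>_. 1) (pivots ns x). \<forall>p\<in>S. nonzero_on (pivots ns x) (lift p) \<longrightarrow>
      (\<forall>e\<in>jet_index ns p. jet ns p e f = v (p, e))" if "x \<in> charts ns" for x
    using local_interpolation[OF S finS order_refl charts_pivots[OF that], of "\<lambda>p e. v (p, e)"] .
  then obtain b where b: "\<And>x. x \<in> charts ns \<Longrightarrow> b x \<in> sections ns (\<lambda>_. 1) (pivots ns x)"
    "\<And>x p e. x \<in> charts ns \<Longrightarrow> p \<in> S \<Longrightarrow> nonzero_on (pivots ns x) (lift p) \<Longrightarrow> e \<in> jet_index ns p \<Longrightarrow>
      jet ns p e (b x) = v (p, e)"
    by metis
  let ?c = "cech_d ns (cochain_of b)"
  have cc: "?c \<in> cocycles ns (double_sections ns S) 1"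
    by (rule d_cochain_of_cocycle) (auto simp: b)
  then have c1: "?c \<in> cochains ns (line_sections ns 1) 1" "cech_d ns ?c = 0"
    using cochains_1_line by (auto simp: cocycles_def)
  have "?c [x, y] = b y - b x" if "x \<in> charts ns" "y \<in> charts ns" for x y
    using that by (simp add: cech_d_2)
  then obtain f where f: "f \<in> sections ns (\<lambda>_. 1) {}" "\<And>x. x \<in> charts ns \<Longrightarrow> primitive ns ?c x = b x + f"
    using global_difference[OF c1 b(1)] by blast
  have "v - connecting ?c = jets ns S (\<lambda>_. - f)"
  proof
    fix k
    show "(v - connecting ?c) k = jets ns S (\<lambda>_. - f) k"
    proof (cases "k \<in> jets_index ns S")
      case True
      then obtain p e where k: "k = (p, e)" "p \<in> S" "e \<in> jet_index ns p" by (auto simp: jets_index_def)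
      have pc: "pivot_chart ns p \<in> charts ns" using S k pivot_chart_in by blast
      have "jet ns p e (b (pivot_chart ns p)) = v (p, e)"
        using b(2)[OF pc k(2) _ k(3)] pivots_pivot(2)[of p ns] k S by auto
      then show ?thesis using True f(2)[OF pc] by (simp add: connecting_def jets_def k(1) jet_add jet_uminus)
    next
      case False
      then show ?thesis using v by (cases k) (simp add: connecting_def jets_def supported_def)
    qed
  qed
  then have "v - connecting ?c \<in> global_jets"
    unfolding global_jets_def using sections_uminus[OF f(1)] by (rule image_eqI)
  then show ?thesis using cc by blast
qed

lemma subspace_cocycles: "coch.subspace (cocycles ns (double_sections ns S) 1)"
proof -
  have ch: "cochain_scale r c \<in> cochains ns (double_sections ns S) 1 \<and> c + d \<in> cochains ns (double_sections ns S) 1"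
    if "c \<in> cochains ns (double_sections ns S) 1" "d \<in> cochains ns (double_sections ns S) 1" for r c d
    using that unfolding cochains_1_iff
    by (auto simp: double_sections_chart2 cochain_scale_def sections_scale sections_add jet_scale jet_add)
  have z: "0 \<in> cochains ns (double_sections ns S) 1"
    unfolding cochains_1_iff
    by (auto simp: double_sections_chart2 jet_def val_def deriv_def split: option.split)
  have d: "cech_d ns c = 0 \<longleftrightarrow> (\<forall>x\<in>charts ns. \<forall>y\<in>charts ns. \<forall>z\<in>charts ns. c [y, z] - c [x, z] + c [x, y] = 0)"
    if "c \<in> cochains ns (double_sections ns S) 1" for c
    by (rule cech_d_cochains_1[OF that])
  show ?thesis
    unfolding coch.subspace_def
  proof (intro conjI ballI allI)
    show "0 \<in> cocycles ns (double_sections ns S) 1"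
      using z d[OF z] by (simp add: cocycles_def)
    fix c assume c: "c \<in> cocycles ns (double_sections ns S) 1"
    show "c + c' \<in> cocycles ns (double_sections ns S) 1" if c': "c' \<in> cocycles ns (double_sections ns S) 1" for c'
    proof -
      have m: "c + c' \<in> cochains ns (double_sections ns S) 1" using c c' ch by (auto simp: cocycles_def)
      have "(c + c') [y, z] - (c + c') [x, z] + (c + c') [x, y] =
        (c [y, z] - c [x, z] + c [x, y]) + (c' [y, z] - c' [x, z] + c' [x, y])" for x y z by simp
      then have "cech_d ns (c + c') = 0"
        unfolding d[OF m] using c c' d by (simp only: cocycles_def mem_Collect_eq) auto
      then show ?thesis using m by (simp add: cocycles_def)
    qed
    show "cochain_scale r c \<in> cocycles ns (double_sections ns S) 1" for r
    proof -
      have m: "cochain_scale r c \<in> cochains ns (double_sections ns S) 1" using c ch by (auto simp: cocycles_def)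
      have "cochain_scale r c [y, z] - cochain_scale r c [x, z] + cochain_scale r c [x, y] =
        cst r * (c [y, z] - c [x, z] + c [x, y])" for x y z
        by (simp add: cochain_scale_def algebra_simps)
      then have "cech_d ns (cochain_scale r c) = 0"
        unfolding d[OF m] using c d by (simp only: cocycles_def mem_Collect_eq) auto
      then show ?thesis using m by (simp add: cocycles_def)
    qed
  qed
qed

lemma delta_eq: "delta ns S + fvec.dim global_jets = card S * (sum_list ns + 1)"
  unfolding delta_def h_coh_def card_jets_index[OF S finS, symmetric]
proof (rule quot_dim_eq[OF linear_connecting subspace_cocycles finite_jets_index[OF finS] subspace_global_jets])
  show "global_jets \<subseteq> supported (jets_index ns S)" using jets_supported by (auto simp: global_jets_def)
  show "connecting ` cocycles ns (double_sections ns S) 1 \<subseteq> supported (jets_index ns S)"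
    using jets_supported by (auto simp: connecting_def)
qed (rule coboundary_iff, rule connecting_surj)

lemma cocycles_0_iff:
  "c \<in> cocycles ns (double_sections ns S) 0 \<longleftrightarrow>
    (\<exists>f\<in>sections ns (\<lambda>_. 1) {}. (\<forall>p\<in>S. \<forall>e\<in>jet_index ns p. jet ns p e f = 0) \<and> c = cochain_of (\<lambda>_. f))"
proof
  assume "c \<in> cocycles ns (double_sections ns S) 0"
  then have c: "c \<in> cochains ns (double_sections ns S) 0" "cech_d ns c = 0" by (auto simp: cocycles_def)
  let ?o = "\<lambda>i\<in>{..<length ns}. 0::nat"
  have o: "?o \<in> charts ns" by (auto simp: charts_def)
  define f where "f = c [?o]"
  have cf: "c [x] = f" if "x \<in> charts ns" for x
    using fun_cong[OF c(2), of "[?o, x]"] cech_d_2[of ?o x ns c] o that by (simp add: f_def)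
  have fD: "f \<in> double_sections ns S (pivots ns x)" if "x \<in> charts ns" for x
    using c(1) cf[OF that] that by (auto simp: cochains_0_iff)
  have "f \<in> sections ns (\<lambda>_. 1) {}"
    using fD double_sections_chart by (intro global_sections[OF pos]) blast
  moreover have "jet ns p e f = 0" if "p \<in> S" "e \<in> jet_index ns p" for p e
  proof -
    have pc: "pivot_chart ns p \<in> charts ns" using S that pivot_chart_in by blast
    show ?thesis using fD[OF pc] pivots_pivot(2)[of p ns] that S unfolding double_sections_chart[OF pc] by auto
  qed
  moreover have "c = cochain_of (\<lambda>_. f)"
    using c(1) cf by (auto simp: cochain_of_def cochains_0_iff fun_eq_iff length_Suc_conv)
  ultimately show "\<exists>f\<in>sections ns (\<lambda>_. 1) {}. (\<forall>p\<in>S. \<forall>e\<in>jet_index ns p. jet ns p e f = 0) \<and> c = cochain_of (\<lambda>_. f)"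
    by blast
next
  assume "\<exists>f\<in>sections ns (\<lambda>_. 1) {}. (\<forall>p\<in>S. \<forall>e\<in>jet_index ns p. jet ns p e f = 0) \<and> c = cochain_of (\<lambda>_. f)"
  then obtain f where f: "f \<in> sections ns (\<lambda>_. 1) {}" "\<And>p e. p \<in> S \<Longrightarrow> e \<in> jet_index ns p \<Longrightarrow> jet ns p e f = 0"
    and c: "c = cochain_of (\<lambda>_. f)" by blast
  have "c \<in> cochains ns (double_sections ns S) 0"
    unfolding cochains_0_iff c using f
    by (simp add: double_sections_chart sections_empty_mono) (simp add: cochain_of_def)
  moreover from this have "cech_d ns c = 0"
    by (auto simp: fun_eq_iff cech_d_cochains_0 c elim!: length_eq_2E)
  ultimately show "c \<in> cocycles ns (double_sections ns S) 0" by (simp add: cocycles_def)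
qed

end

section \<open>Products of linear forms and the rank of the jet map\<close>

definition pairing :: "nat list \<Rightarrow> nat \<Rightarrow> (nat \<Rightarrow> 'a::field) \<Rightarrow> (nat \<Rightarrow> 'a) \<Rightarrow> 'a" where
  "pairing ns i l v = (\<Sum>j\<le>ns ! i. l j * v j)"

definition linear_form :: "nat list \<Rightarrow> nat \<Rightarrow> (nat \<Rightarrow> 'a::field) \<Rightarrow> 'a laurent" where
  "linear_form ns i l = (\<Sum>j\<le>ns ! i. single (single (i, j) 1) (l j))"

definition form_prod :: "nat list \<Rightarrow> nat set \<Rightarrow> (nat \<Rightarrow> nat \<Rightarrow> 'a::field) \<Rightarrow> 'a laurent" where
  "form_prod ns I l = (\<Prod>i\<in>I. linear_form ns i (l i))"

lemma nonzero_on_empty [simp]: "nonzero_on {} x"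
  by (simp add: nonzero_on_def)

lemma
  assumes ij: "(i, j) \<in> cox_vars ns"
  shows variable_adm: "single (i, j) 1 \<in> adm ns (\<lambda>i'. if i' = i then 1 else 0) {}"
    and mono_val_variable: "mono_val ns x (single (i, j) 1) = x i j"
    and mono_deriv_variable: "w \<in> cox_vars ns \<Longrightarrow>
      mono_deriv ns x w (single (i, j) 1) = (if w = (i, j) then 1 else 0)"
proof -
  have j: "j \<le> ns ! i" using ij by (simp add: cox_vars_def)
  have l: "lookup (single (i, j) 1) v = (if v = (i, j) then 1 else (0::int))" for v
    by (auto simp: lookup_single when_def)
  show "single (i, j) 1 \<in> adm ns (\<lambda>i'. if i' = i then 1 else 0) {}"
    using ij j by (auto simp: adm_def multideg_def l in_keys_iff split: if_splits)
  have 1: "(\<Prod>v\<in>cox_vars ns - {(i, j)}. x (fst v) (snd v) powi lookup (single (i, j) 1) v) = 1"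
    by (intro prod.neutral) (auto simp: l)
  show "mono_val ns x (single (i, j) 1) = x i j"
    using mono_val_remove[OF ij, of x "single (i, j) 1"] 1 by (simp add: l)
  show "mono_deriv ns x w (single (i, j) 1) = (if w = (i, j) then 1 else 0)"
    using 1 by (auto simp: mono_deriv_def l)
qed

lemma
  assumes i: "i < length ns"
  shows linear_form_sections: "linear_form ns i l \<in> sections ns (\<lambda>i'. if i' = i then 1 else 0) {}"
    and val_linear_form: "val ns x (linear_form ns i l) = pairing ns i l (x i)"
    and deriv_linear_form: "(i', j') \<in> cox_vars ns \<Longrightarrow>
      deriv ns x (i', j') (linear_form ns i l) = (if i' = i then l j' else 0)"
proof -
  have c: "(i, j) \<in> cox_vars ns" if "j \<le> ns ! i" for j using that i by (simp add: cox_vars_def)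
  show "linear_form ns i l \<in> sections ns (\<lambda>i'. if i' = i then 1 else 0) {}"
    unfolding linear_form_def by (intro sections_sum sections_single variable_adm c) auto
  show "val ns x (linear_form ns i l) = pairing ns i l (x i)"
    unfolding linear_form_def pairing_def val_linear(4)
    by (intro sum.cong refl) (simp add: val_linear(6) mono_val_variable[OF c])
  assume w: "(i', j') \<in> cox_vars ns"
  have "deriv ns x (i', j') (linear_form ns i l) = (\<Sum>j\<le>ns ! i. if j = j' \<and> i' = i then l j else 0)"
    unfolding linear_form_def deriv_linear(4)
    by (intro sum.cong refl) (use w in \<open>auto simp: deriv_linear(6) mono_deriv_variable[OF c]\<close>)
  also have "\<dots> = (if i' = i then l j' else 0)"
    using w by (auto simp: cox_vars_def)
  finally show "deriv ns x (i', j') (linear_form ns i l) = (if i' = i then l j' else 0)" .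
qed

text \<open>The product over a subset of the factors allows induction. Each linear form involves
  only variables of its own factor, so the Leibniz sum for a derivative has at most one nonzero
  term.\<close>

lemma form_prod_aux:
  assumes "finite I" "I \<subseteq> {..<length ns}"
  shows "form_prod ns I l \<in> sections ns (\<lambda>i. if i \<in> I then 1 else 0) {} \<and>
    val ns x (form_prod ns I l) = (\<Prod>i\<in>I. pairing ns i (l i) (x i)) \<and>
    (\<forall>(i, j)\<in>cox_vars ns. deriv ns x (i, j) (form_prod ns I l) =
      (if i \<in> I then l i j * (\<Prod>i'\<in>I - {i}. pairing ns i' (l i') (x i')) else 0))"
  using assms
proof (induction I)
  case empty
  then show ?case using sections_const[of 1 ns "{}"] by (simp add: form_prod_def)
next
  case (insert k I)
  have k: "k < length ns" using insert by simp
  have IH: "form_prod ns I l \<in> sections ns (\<lambda>i. if i \<in> I then 1 else 0) {}"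
    "val ns x (form_prod ns I l) = (\<Prod>i\<in>I. pairing ns i (l i) (x i))"
    "\<And>i j. (i, j) \<in> cox_vars ns \<Longrightarrow> deriv ns x (i, j) (form_prod ns I l) =
      (if i \<in> I then l i j * (\<Prod>i'\<in>I - {i}. pairing ns i' (l i') (x i')) else 0)"
    using insert by auto
  have e: "form_prod ns (insert k I) l = linear_form ns k (l k) * form_prod ns I l"
    using insert by (simp add: form_prod_def)
  note kf = linear_form_sections[OF k, of "l k"]
  have "form_prod ns (insert k I) l \<in> sections ns (\<lambda>i. if i \<in> insert k I then 1 else 0) {}"
    unfolding e using insert(2) by (intro sections_mult[OF kf IH(1)]) auto
  moreover have "val ns x (form_prod ns (insert k I) l) = (\<Prod>i\<in>insert k I. pairing ns i (l i) (x i))"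
    unfolding e using insert(1,2)
    by (simp add: val_mult[OF kf IH(1)] IH(2) val_linear_form[OF k])
  moreover have "deriv ns x (i, j) (form_prod ns (insert k I) l) =
      (if i \<in> insert k I then l i j * (\<Prod>i'\<in>insert k I - {i}. pairing ns i' (l i') (x i')) else 0)"
    if w: "(i, j) \<in> cox_vars ns" for i j
  proof -
    have d: "deriv ns x (i, j) (form_prod ns (insert k I) l) =
        (if i = k then l k j else 0) * (\<Prod>i\<in>I. pairing ns i (l i) (x i)) +
        pairing ns k (l k) (x k) * (if i \<in> I then l i j * (\<Prod>i'\<in>I - {i}. pairing ns i' (l i') (x i')) else 0)"
      unfolding e by (simp add: deriv_mult[OF kf IH(1) nonzero_on_empty w] IH(2,3) w
        deriv_linear_form[OF k w] val_linear_form[OF k])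
    consider "i = k" | "i \<noteq> k" "i \<in> I" | "i \<noteq> k" "i \<notin> I" by blast
    then show ?thesis
    proof cases
      case 1
      then show ?thesis unfolding d using insert(2) by simp
    next
      case 2
      then have "insert k I - {i} = insert k (I - {i})" by auto
      then show ?thesis unfolding d using insert(1,2) 2 by simp
    next
      case 3
      then show ?thesis unfolding d by simp
    qed
  qed
  ultimately show ?case by auto
qed

abbreviation full_form :: "nat list \<Rightarrow> (nat \<Rightarrow> nat \<Rightarrow> 'a::field) \<Rightarrow> 'a laurent" where
  "full_form ns l \<equiv> form_prod ns {..<length ns} l"

lemma full_form_sections: "full_form ns l \<in> sections ns (\<lambda>_. 1) {}"
  using form_prod_aux[of "{..<length ns}" ns l] by (auto simp: sections_def adm_def subset_iff)

lemma val_full_form: "val ns x (full_form ns l) = (\<Prod>i<length ns. pairing ns i (l i) (x i))"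
  using form_prod_aux[of "{..<length ns}" ns l x] by auto

lemma deriv_full_form:
  "(i, j) \<in> cox_vars ns \<Longrightarrow> deriv ns x (i, j) (full_form ns l) =
    l i j * (\<Prod>i'\<in>{..<length ns} - {i}. pairing ns i' (l i') (x i'))"
  using form_prod_aux[of "{..<length ns}" ns l x] by (auto simp: cox_vars_def)

text \<open>A derivative in a variable of factor \<open>a\<close> removes only the linear form of
  that factor, so one of the two vanishing forms remains.\<close>

lemma full_form_jet_zero:
  assumes i: "i < length ns" "pairing ns i (l i) (lift p i) = 0"
    and j: "j < length ns" "pairing ns j (l j) (lift p j) = 0" and ij: "i \<noteq> j"
    and e: "e \<in> jet_index ns p"
  shows "jet ns p e (full_form ns l) = 0"
proof (cases e)
  case None
  then show ?thesis using i by (auto simp: jet_def val_full_form)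
next
  case (Some w)
  obtain a b where w: "w = (a, b)" by (cases w)
  have ab: "(a, b) \<in> cox_vars ns" using e Some w by (auto simp: jet_index_def jet_vars_def)
  have "\<exists>i'\<in>{..<length ns} - {a}. pairing ns i' (l i') (lift p i') = 0"
    using i j ij by (cases "a = i") auto
  then have "(\<Prod>i'\<in>{..<length ns} - {a}. pairing ns i' (l i') (lift p i')) = 0"
    by (intro prod_zero) auto
  then show ?thesis using Some w by (simp add: jet_def deriv_full_form[OF ab])
qed

definition coord_form :: "nat \<Rightarrow> nat \<Rightarrow> 'a::field" where
  "coord_form t = (\<lambda>s. if s = t then 1 else 0)"

lemma pairing_coord_form: "t \<le> ns ! i \<Longrightarrow> pairing ns i (coord_form t) v = v t"
proof -
  assume t: "t \<le> ns ! i"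
  have "pairing ns i (coord_form t) v = (\<Sum>j\<le>ns ! i. if j = t then v t else 0)"
    unfolding pairing_def coord_form_def by (intro sum.cong) auto
  then show ?thesis using t by simp
qed

lemma pairing_add: "pairing ns i (\<lambda>s. l s + l' s) v = pairing ns i l v + pairing ns i l' v"
  by (simp add: pairing_def sum.distrib distrib_right)

lemma pairing_diff_scale: "pairing ns i (\<lambda>s. l s - c * l' s) v = pairing ns i l v - c * pairing ns i l' v"
  by (simp add: pairing_def left_diff_distrib sum_subtractf sum_distrib_left mult.assoc)

text \<open>For \<open>t\<close> equal to the pivot this form is 0, and for the other
  \<open>t\<close> these forms are a basis of the linear forms vanishing at \<open>p i\<close>. This
  is why indices different from the pivot are chosen below.\<close>

definition vanishing_form :: "'a::field mpoint \<Rightarrow> nat \<Rightarrow> nat \<Rightarrow> nat \<Rightarrow> 'a" where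
  "vanishing_form p i t = (\<lambda>s. coord_form t s - lift p i t * coord_form (pivot p i) s)"

lemma pairing_vanishing_form:
  assumes "p \<in> mproj ns" "i < length ns" "t \<le> ns ! i"
  shows "pairing ns i (vanishing_form p i t) v = v t - lift p i t * v (pivot p i)"
  unfolding vanishing_form_def using assms pivot_le[OF assms(1,2)]
  by (simp add: pairing_diff_scale pairing_coord_form)

lemma pairing_vanishing_form_self:
  assumes "p \<in> mproj ns" "i < length ns" "t \<le> ns ! i"
  shows "pairing ns i (vanishing_form p i t) (lift p i) = 0"
  using pairing_vanishing_form[OF assms] lift_pivot[OF assms(1,2)] by simp

lemma exists_separating_form:
  assumes "p \<in> mproj ns" "q \<in> mproj ns" "i < length ns" "p i \<noteq> q i"
  shows "\<exists>l. pairing ns i l (lift p i) = 0 \<and> pairing ns i l (lift q i) \<noteq> 0"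
proof -
  obtain j where "j \<le> ns ! i" "lift q i j \<noteq> lift p i j * lift q i (pivot p i)"
    using separating_form[OF assms(2,1,3)] assms(4) by metis
  then show ?thesis using pairing_vanishing_form[OF assms(1,3)] pairing_vanishing_form_self[OF assms(1,3)]
    by (intro exI[of _ "vanishing_form p i j"]) auto
qed

text \<open>If each pivot coordinate vanishes at the other point, their sum has the value 1 at both
  points; otherwise one of the two coordinates serves.\<close>

lemma exists_nonvanishing_form:
  fixes p q :: "'a::field mpoint"
  assumes "p \<in> mproj ns" "q \<in> mproj ns" "i < length ns"
  shows "\<exists>l. pairing ns i l (lift p i) \<noteq> 0 \<and> pairing ns i l (lift q i) \<noteq> 0"
proof -
  have c: "pairing ns i (coord_form (pivot p i)) v = v (pivot p i)"
    "pairing ns i (coord_form (pivot q i)) v = v (pivot q i)" for v :: "nat \<Rightarrow> 'a"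
    by (rule pairing_coord_form, rule pivot_le[OF _ assms(3)], rule assms)+
  have pv: "lift p i (pivot p i) = 1" "lift q i (pivot q i) = 1" using lift_pivot assms by auto
  consider "lift q i (pivot p i) \<noteq> 0" | "lift p i (pivot q i) \<noteq> 0"
    | "lift q i (pivot p i) = 0" "lift p i (pivot q i) = 0" by blast
  then show ?thesis
  proof cases
    case 1
    then show ?thesis using c pv by (intro exI[of _ "coord_form (pivot p i)"]) simp
  next
    case 2
    then show ?thesis using c pv by (intro exI[of _ "coord_form (pivot q i)"]) simp
  next
    case 3
    then show ?thesis using c pv
      by (intro exI[of _ "\<lambda>s. coord_form (pivot p i) s + coord_form (pivot q i) s"]) (simp add: pairing_add)
  qed
qed

section \<open>Lower bounds for the rank of the jet map\<close>

context
  fixes ns :: "nat list" and S :: "'a::field mpoint set"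
  assumes pos: "\<forall>d\<in>set ns. d > 0" and S: "S \<subseteq> mproj ns" and finS: "finite S"
begin

lemma rank_ge_card:
  assumes p: "p \<in> S" and T: "fvec.independent T" "T \<subseteq> global_jets ns S"
    and z: "\<And>t e. t \<in> T \<Longrightarrow> e \<in> jet_index ns p \<Longrightarrow> t (p, e) = 0"
  shows "card T + (sum_list ns + 1) \<le> fvec.dim (global_jets ns S)"
proof -
  let ?I = "Pair p ` jet_index ns p"
  have pY: "p \<in> mproj ns" using p S by blast
  have "card T + card ?I \<le> fvec.dim (global_jets ns S)"
  proof (rule card_add_card_le_dim[OF finite_jets_index[OF finS, of ns] _ _ T])
    show "global_jets ns S \<subseteq> supported (jets_index ns S)"
      using jets_supported by (auto simp: global_jets_def[OF pos S finS])
    show "?I \<subseteq> jets_index ns S" using p by (auto simp: jets_index_def)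
    show "t i = 0" if "t \<in> T" "i \<in> ?I" for t i using that z by auto
    fix i assume "i \<in> ?I"
    then obtain e where e: "i = (p, e)" "e \<in> jet_index ns p" by auto
    obtain s where s: "s \<in> sections ns (\<lambda>_. 1) {}"
      "\<And>e'. e' \<in> jet_index ns p \<Longrightarrow> jet ns p e' s = (if e' = e then 1 else 0)"
      using section_with_jet[OF pY, of "\<lambda>e'. if e' = e then 1 else 0"] by blast
    have "jets ns S (\<lambda>_. s) \<in> global_jets ns S"
      using s(1) by (auto simp: global_jets_def[OF pos S finS])
    moreover have "\<forall>j\<in>?I. jets ns S (\<lambda>_. s) j = (if j = i then 1 else 0)"
      using s(2) p e by (auto simp: jets_def jets_index_def)
    ultimately show "\<exists>u\<in>global_jets ns S. \<forall>j\<in>?I. u j = (if j = i then 1 else 0)" by blast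
  qed
  moreover have "card ?I = sum_list ns + 1"
    using card_jet_index[OF pY] by (simp add: card_image inj_on_def)
  ultimately show ?thesis by simp
qed

text \<open>Derivatives in the pivot variables of \<open>q\<close> vanish too. So a jet may be
  tested at \<open>q\<close> in a variable chosen to avoid the pivot of \<open>p\<close>, even if it
  is the pivot of \<open>q\<close>.\<close>

lemma jets_eq_0D:
  assumes "f \<in> sections ns (\<lambda>_. 1) {}" "jets ns S (\<lambda>_. f) = 0" "q \<in> S" "w \<in> cox_vars ns"
  shows "deriv ns (lift q) w f = 0"
proof (rule jet_zero_imp_deriv_zero[OF _ assms(1) _ assms(4)])
  show "q \<in> mproj ns" using assms(3) S by blast
  fix e assume "e \<in> jet_index ns q"
  then show "jet ns q e f = 0"
    using fun_cong[OF assms(2), of "(q, e)"] assms(3) by (simp add: jets_def jets_index_def)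
qed

lemma rank_ge_1:
  assumes p: "p \<in> S" and f: "f \<in> sections ns (\<lambda>_. 1) {}" "\<And>e. e \<in> jet_index ns p \<Longrightarrow> jet ns p e f = 0"
    and q: "q \<in> S" "w \<in> cox_vars ns" "deriv ns (lift q) w f \<noteq> 0"
  shows "sum_list ns + 2 \<le> fvec.dim (global_jets ns S)"
proof -
  let ?t = "jets ns S (\<lambda>_. f)"
  have "?t \<noteq> 0" using jets_eq_0D[OF f(1)] q by blast
  then have "fvec.independent {?t}" unfolding fvec.dependent_single by simp
  moreover have "{?t} \<subseteq> global_jets ns S" using f(1) by (auto simp: global_jets_def[OF pos S finS])
  moreover have "t (p, e) = 0" if "t \<in> {?t}" "e \<in> jet_index ns p" for t e
    using that f(2) by (auto simp: jets_def)
  ultimately show ?thesis using rank_ge_card[OF p, of "{?t}"] by simp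
qed

lemma rank_ge_2:
  assumes p: "p \<in> S" and f: "f \<in> sections ns (\<lambda>_. 1) {}" "\<And>e. e \<in> jet_index ns p \<Longrightarrow> jet ns p e f = 0"
    and g: "g \<in> sections ns (\<lambda>_. 1) {}" "\<And>e. e \<in> jet_index ns p \<Longrightarrow> jet ns p e g = 0"
    and ind: "\<And>\<alpha> \<beta>. (\<And>q w. q \<in> S \<Longrightarrow> w \<in> cox_vars ns \<Longrightarrow>
      \<alpha> * deriv ns (lift q) w f + \<beta> * deriv ns (lift q) w g = 0) \<Longrightarrow> \<alpha> = 0 \<and> \<beta> = 0"
  shows "sum_list ns + 3 \<le> fvec.dim (global_jets ns S)"
proof -
  let ?s = "jets ns S (\<lambda>_. f)" and ?t = "jets ns S (\<lambda>_. g)"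
  have "fvec.independent {?s, ?t} \<and> card {?s, ?t} = 2"
  proof (rule independent_pair)
    fix \<alpha> \<beta> assume *: "fscale \<alpha> ?s + fscale \<beta> ?t = 0"
    have h: "cst \<alpha> * f + cst \<beta> * g \<in> sections ns (\<lambda>_. 1) {}"
      by (intro sections_add sections_scale f g)
    have "jets ns S (\<lambda>_. cst \<alpha> * f + cst \<beta> * g) = fscale \<alpha> ?s + fscale \<beta> ?t"
      by (auto simp: jets_def jet_add jet_scale fun_eq_iff)
    then have "jets ns S (\<lambda>_. cst \<alpha> * f + cst \<beta> * g) = 0" using * by simp
    from jets_eq_0D[OF h this] show "\<alpha> = 0 \<and> \<beta> = 0"
      by (intro ind) (simp add: deriv_linear(1,5))
  qed
  moreover have "{?s, ?t} \<subseteq> global_jets ns S" using f(1) g(1) by (auto simp: global_jets_def[OF pos S finS])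
  moreover have "t (p, e) = 0" if "t \<in> {?s, ?t}" "e \<in> jet_index ns p" for t e
    using that f(2) g(2) by (auto simp: jets_def)
  ultimately show ?thesis using rank_ge_card[OF p, of "{?s, ?t}"] by simp
qed

lemma exists_nonpivot:
  assumes "p \<in> S" "j < length ns"
  shows "\<exists>t\<le>ns ! j. t \<noteq> pivot p j"
proof (cases "pivot p j = 0")
  case True
  have "ns ! j > 0" using pos assms(2) nth_mem by blast
  then show ?thesis using True by (intro exI[of _ 1]) auto
qed auto

text \<open>The forms below vanish doubly at \<open>p\<close> because they have two linear factors, in different sets of
  variables, that vanish at \<open>p\<close>.\<close>

lemma rank_lower_bound:
  assumes p: "p \<in> S" and q: "q \<in> S" and i: "i < length ns" "p i \<noteq> q i" and j: "j < length ns" "j \<noteq> i"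
  shows "sum_list ns + 2 \<le> fvec.dim (global_jets ns S)"
proof -
  have pY: "p \<in> mproj ns" and qY: "q \<in> mproj ns" using p q S by auto
  obtain l where l: "pairing ns i l (lift p i) = 0" "pairing ns i l (lift q i) \<noteq> 0"
    using exists_separating_form[OF pY qY i] by blast
  obtain t where t: "t \<le> ns ! j" "t \<noteq> pivot p j" using exists_nonpivot[OF p j(1)] by blast
  \<comment> \<open>The other factors carry the pivot coordinate of \<open>q\<close>, which is 1 at
    \<open>q\<close>. The derivative in \<open>(j, t)\<close> replaces the form of factor
    \<open>j\<close> by its coefficient 1, so it is nonzero at \<open>q\<close> even if that form
    vanishes there, as it does when \<open>p j = q j\<close>.\<close>
  define L where "L = (\<lambda>k. coord_form (pivot q k))(i := l, j := vanishing_form p j t)"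
  have Li: "L i = l" "L j = vanishing_form p j t" using j(2) by (auto simp: L_def)
  have w: "(j, t) \<in> cox_vars ns" using j t by (simp add: cox_vars_def)
  have "pairing ns k (L k) (lift q k) \<noteq> 0" if "k \<in> {..<length ns} - {j}" for k
    using that l j pivot_le[OF qY] lift_pivot[OF qY] by (auto simp: L_def pairing_coord_form)
  then have "(\<Prod>k\<in>{..<length ns} - {j}. pairing ns k (L k) (lift q k)) \<noteq> 0" by simp
  then have "deriv ns (lift q) (j, t) (full_form ns L) \<noteq> 0"
    unfolding deriv_full_form[OF w] Li using t(2) by (simp add: vanishing_form_def coord_form_def)
  moreover have "jet ns p e (full_form ns L) = 0" if "e \<in> jet_index ns p" for e
    using Li l(1) pairing_vanishing_form_self[OF pY j(1) t(1)] i j that by (intro full_form_jet_zero[of i ns L p j]) auto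
  ultimately show ?thesis using rank_ge_1[OF p full_form_sections _ q w] by blast
qed

text \<open>A factor of dimension at least 2 has two coordinates besides the pivot. The two
  resulting forms differ only in factor \<open>j\<close>, and their derivatives in these two
  variables at \<open>q\<close> form a nonzero multiple of the identity matrix.\<close>

lemma rank_large_factor:
  assumes p: "p \<in> S" and q: "q \<in> S" and i: "i < length ns" "p i \<noteq> q i" and j: "j < length ns" "j \<noteq> i"
    and large: "ns ! j \<ge> 2"
  shows "sum_list ns + 3 \<le> fvec.dim (global_jets ns S)"
proof -
  have pY: "p \<in> mproj ns" and qY: "q \<in> mproj ns" using p q S by auto
  obtain l where l: "pairing ns i l (lift p i) = 0" "pairing ns i l (lift q i) \<noteq> 0"
    using exists_separating_form[OF pY qY i] by blast
  have "\<exists>t t'. t \<le> ns ! j \<and> t' \<le> ns ! j \<and> t \<noteq> pivot p j \<and> t' \<noteq> pivot p j \<and> t \<noteq> t'"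
  proof -
    consider "pivot p j = 0" | "pivot p j = 1" | "pivot p j \<ge> 2" by linarith
    then show ?thesis
    proof cases
      case 1 then show ?thesis using large by (intro exI[of _ 1] exI[of _ 2]) auto
    next
      case 2 then show ?thesis using large by (intro exI[of _ 0] exI[of _ 2]) auto
    next
      case 3 then show ?thesis using large by (intro exI[of _ 0] exI[of _ 1]) auto
    qed
  qed
  then obtain t t' where t: "t \<le> ns ! j" "t' \<le> ns ! j" "t \<noteq> pivot p j" "t' \<noteq> pivot p j" "t \<noteq> t'" by blast
  define L where "L u = (\<lambda>k. coord_form (pivot q k))(i := l, j := vanishing_form p j u)" for u
  have Li: "L u i = l" "L u j = vanishing_form p j u" for u using j(2) by (auto simp: L_def)
  define c where "c = (\<Prod>k\<in>{..<length ns} - {j}. pairing ns k (L t k) (lift q k))"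
  have "pairing ns k (L t k) (lift q k) \<noteq> 0" if "k \<in> {..<length ns} - {j}" for k
    using that l j pivot_le[OF qY] lift_pivot[OF qY] by (auto simp: L_def pairing_coord_form)
  then have c: "c \<noteq> 0" by (simp add: c_def)
  have c': "c = (\<Prod>k\<in>{..<length ns} - {j}. pairing ns k (L u k) (lift q k))" for u
    unfolding c_def by (intro prod.cong refl) (auto simp: L_def)
  have d: "deriv ns (lift q) (j, s) (full_form ns (L u)) = vanishing_form p j u s * c" if "s \<le> ns ! j" for s u
    using that j by (subst deriv_full_form) (auto simp: cox_vars_def Li c'[of u, symmetric])
  have jz: "jet ns p e (full_form ns (L u)) = 0" if "e \<in> jet_index ns p" "u \<le> ns ! j" for e u
    using Li l(1) pairing_vanishing_form_self[OF pY j(1) that(2)] i j that by (intro full_form_jet_zero[of i ns "L u" p j]) auto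
  show ?thesis
  proof (rule rank_ge_2[OF p full_form_sections jz[OF _ t(1)] full_form_sections jz[OF _ t(2)]])
    fix \<alpha> \<beta>
    assume *: "\<And>q w. q \<in> S \<Longrightarrow> w \<in> cox_vars ns \<Longrightarrow>
      \<alpha> * deriv ns (lift q) w (full_form ns (L t)) + \<beta> * deriv ns (lift q) w (full_form ns (L t')) = 0"
    have "(j, t) \<in> cox_vars ns" "(j, t') \<in> cox_vars ns" using t j by (auto simp: cox_vars_def)
    then have "\<alpha> * (vanishing_form p j t t * c) + \<beta> * (vanishing_form p j t' t * c) = 0"
      "\<alpha> * (vanishing_form p j t t' * c) + \<beta> * (vanishing_form p j t' t' * c) = 0"
      using *[OF q, of "(j, t)"] *[OF q, of "(j, t')"] d[OF t(1)] d[OF t(2)] by auto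
    then show "\<alpha> = 0 \<and> \<beta> = 0" using t c by (auto simp: vanishing_form_def coord_form_def)
  qed
qed

text \<open>Both forms vanish at \<open>p\<close> in factor \<open>i\<close>; the second vanishing
  linear form sits in factor \<open>j\<close> for one and in factor \<open>k\<close> for the other.
  The remaining one of these two factors carries a form that is nonzero at both \<open>p\<close> and
  \<open>q\<close>.\<close>

lemma rank_three_factors:
  assumes p: "p \<in> S" and q: "q \<in> S" and i: "i < length ns" "p i \<noteq> q i"
    and j: "j < length ns" "j \<noteq> i" and k: "k < length ns" "k \<noteq> i" "k \<noteq> j"
  shows "sum_list ns + 3 \<le> fvec.dim (global_jets ns S)"
proof -
  have pY: "p \<in> mproj ns" and qY: "q \<in> mproj ns" using p q S by auto
  obtain l where l: "pairing ns i l (lift p i) = 0" "pairing ns i l (lift q i) \<noteq> 0"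
    using exists_separating_form[OF pY qY i] by blast
  obtain t where t: "t \<le> ns ! j" "t \<noteq> pivot p j" using exists_nonpivot[OF p j(1)] by blast
  obtain u where u: "u \<le> ns ! k" "u \<noteq> pivot p k" using exists_nonpivot[OF p k(1)] by blast
  obtain m where m: "pairing ns j m (lift p j) \<noteq> 0" "pairing ns j m (lift q j) \<noteq> 0"
    using exists_nonvanishing_form[OF pY qY j(1)] by blast
  obtain m' where m': "pairing ns k m' (lift p k) \<noteq> 0" "pairing ns k m' (lift q k) \<noteq> 0"
    using exists_nonvanishing_form[OF pY qY k(1)] by blast
  let ?vj = "vanishing_form p j t" and ?vk = "vanishing_form p k u"
  define L where "L f g = (\<lambda>h. coord_form (pivot q h))(i := l, j := f, k := g)" for f g
  have Li: "L f g i = l" "L f g j = f" "L f g k = g" for f g using j k by (auto simp: L_def)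
  define c where "c = (\<Prod>h\<in>{..<length ns} - {j, k}. pairing ns h (L m m' h) (lift q h))"
  have "pairing ns h (L m m' h) (lift q h) \<noteq> 0" if "h \<in> {..<length ns} - {j, k}" for h
    using that l pivot_le[OF qY] lift_pivot[OF qY] by (auto simp: L_def pairing_coord_form)
  then have c: "c \<noteq> 0" by (simp add: c_def)
  have c': "c = (\<Prod>h\<in>{..<length ns} - {j, k}. pairing ns h (L f g h) (lift q h))" for f g
    unfolding c_def by (intro prod.cong refl) (auto simp: L_def)
  have remj: "(\<Prod>h\<in>{..<length ns} - {j}. pairing ns h (L f g h) (lift q h)) = pairing ns k g (lift q k) * c" for f g
  proof -
    have "{..<length ns} - {j} - {k} = {..<length ns} - {j, k}" by auto
    then show ?thesis using k by (subst prod.remove[of _ k]) (auto simp: Li c'[of f g])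
  qed
  have remk: "(\<Prod>h\<in>{..<length ns} - {k}. pairing ns h (L f g h) (lift q h)) = pairing ns j f (lift q j) * c" for f g
  proof -
    have "{..<length ns} - {k} - {j} = {..<length ns} - {j, k}" by auto
    then show ?thesis using j k by (subst prod.remove[of _ j]) (auto simp: Li c'[of f g])
  qed
  have dj: "deriv ns (lift q) (j, s) (full_form ns (L f g)) = f s * (pairing ns k g (lift q k) * c)"
    if "s \<le> ns ! j" for s f g
    using that j by (subst deriv_full_form) (auto simp: cox_vars_def Li remj)
  have dk: "deriv ns (lift q) (k, s) (full_form ns (L f g)) = g s * (pairing ns j f (lift q j) * c)"
    if "s \<le> ns ! k" for s f g
    using that k by (subst deriv_full_form) (auto simp: cox_vars_def Li remk)
  have z1: "jet ns p e (full_form ns (L ?vj m')) = 0" if "e \<in> jet_index ns p" for e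
    using Li l(1) pairing_vanishing_form_self[OF pY j(1) t(1)] i j that
    by (intro full_form_jet_zero[of i ns "L ?vj m'" p j]) auto
  have z2: "jet ns p e (full_form ns (L m ?vk)) = 0" if "e \<in> jet_index ns p" for e
    using Li l(1) pairing_vanishing_form_self[OF pY k(1) u(1)] i k that
    by (intro full_form_jet_zero[of i ns "L m ?vk" p k]) auto
  show ?thesis
  proof (rule rank_ge_2[OF p full_form_sections z1 full_form_sections z2])
    fix \<alpha> \<beta>
    assume *: "\<And>q w. q \<in> S \<Longrightarrow> w \<in> cox_vars ns \<Longrightarrow>
      \<alpha> * deriv ns (lift q) w (full_form ns (L ?vj m')) + \<beta> * deriv ns (lift q) w (full_form ns (L m ?vk)) = 0"
    \<comment> \<open>Along factor \<open>j\<close>, the derivatives at \<open>q\<close> give a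
      relation between the linear forms \<open>?vj\<close> and \<open>m\<close>, with coefficients
      \<open>A\<close> and \<open>B\<close>. At \<open>p\<close> the first vanishes and the second
      does not, so B = 0, and then A = 0 by the coefficient at \<open>t\<close>. Factor
      \<open>k\<close> gives A' = B' = 0 likewise. Of these, \<open>A\<close> and \<open>B'\<close>
      are nonzero multiples of \<open>\<alpha>\<close> and \<open>\<beta>\<close>.\<close>
    define A where "A = \<alpha> * (pairing ns k m' (lift q k) * c)"
    define B where "B = \<beta> * (pairing ns k ?vk (lift q k) * c)"
    define A' where "A' = \<alpha> * (pairing ns j ?vj (lift q j) * c)"
    define B' where "B' = \<beta> * (pairing ns j m (lift q j) * c)"
    have 1: "A * ?vj s + B * m s = 0" if "s \<le> ns ! j" for s
      using *[OF q, of "(j, s)"] j that by (simp add: dj cox_vars_def A_def B_def mult_ac)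
    have 2: "A' * m' s + B' * ?vk s = 0" if "s \<le> ns ! k" for s
      using *[OF q, of "(k, s)"] k that by (simp add: dk cox_vars_def A'_def B'_def mult_ac)
    have "A * pairing ns j ?vj (lift p j) + B * pairing ns j m (lift p j) =
        (\<Sum>s\<le>ns ! j. (A * ?vj s + B * m s) * lift p j s)"
      by (simp add: pairing_def sum_distrib_left sum.distrib algebra_simps)
    also have "\<dots> = 0" using 1 by (intro sum.neutral) auto
    finally have "B = 0" using m(1) pairing_vanishing_form_self[OF pY j(1) t(1)] by simp
    then have "A = 0" using 1[OF t(1)] t(2) by (simp add: vanishing_form_def coord_form_def)
    have "A' * pairing ns k m' (lift p k) + B' * pairing ns k ?vk (lift p k) =
        (\<Sum>s\<le>ns ! k. (A' * m' s + B' * ?vk s) * lift p k s)"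
      by (simp add: pairing_def sum_distrib_left sum.distrib algebra_simps)
    also have "\<dots> = 0" using 2 by (intro sum.neutral) auto
    finally have "A' = 0" using m'(1) pairing_vanishing_form_self[OF pY k(1) u(1)] by simp
    then have "B' = 0" using 2[OF u(1)] u(2) by (simp add: vanishing_form_def coord_form_def)
    then show "\<alpha> = 0 \<and> \<beta> = 0" using \<open>A = 0\<close> c m m' by (simp add: A_def B'_def)
  qed
qed

text \<open>The points of \<open>S\<close> differ only in factor \<open>i\<close>. If
  \<open>f\<close> is a linear form there that vanishes at \<open>p\<close>, its product with a
  vanishing form in factor \<open>j\<close> has at each x in \<open>S\<close> a derivative equal to
  the value of \<open>f\<close> at x. Choosing \<open>l\<close> zero at \<open>p\<close> but not at
  \<open>q\<close>, and \<open>l'\<close> zero at \<open>p\<close> and \<open>q\<close> but not at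
  \<open>r\<close>, gives a triangular system.\<close>

lemma rank_noncollinear:
  assumes p: "p \<in> S" and q: "q \<in> S" and r: "r \<in> S" and i: "i < length ns" "p i \<noteq> q i"
    and j: "j < length ns" "j \<noteq> i"
    and same: "\<And>h s. s \<in> S \<Longrightarrow> h < length ns \<Longrightarrow> h \<noteq> i \<Longrightarrow> s h = p h"
    and nc: "lift r i \<notin> fvec.span {lift p i, lift q i}"
  shows "sum_list ns + 3 \<le> fvec.dim (global_jets ns S)"
proof -
  have Y: "p \<in> mproj ns" "q \<in> mproj ns" "r \<in> mproj ns" using p q r S by auto
  obtain l where l: "pairing ns i l (lift p i) = 0" "pairing ns i l (lift q i) \<noteq> 0"
    using exists_separating_form[OF Y(1,2) i] by blast
  obtain t where t: "t \<le> ns ! j" "t \<noteq> pivot p j" using exists_nonpivot[OF p j(1)] by blast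
  define v w s a where "v = lift p i" "w = lift q i" "s = lift r i" "a = pivot p i"
  note defs = this
  have va: "v a = 1" "a \<le> ns ! i" using lift_pivot[OF Y(1) i(1)] pivot_le[OF Y(1) i(1)] by (auto simp: defs)
  obtain b where b: "b \<le> ns ! i" "w b \<noteq> v b * w a"
    using separating_form[OF Y(2,1) i(1)] i(2) by (auto simp: defs)
  define d where "d = w b - v b * w a"
  have d: "d \<noteq> 0" using b by (simp add: d_def)
  have ker: "\<forall>c>ns ! i. v c = 0 \<and> w c = 0 \<and> s c = 0"
    using lift_kspace[OF _ i(1)] Y by (auto simp: defs kspace_def)
  \<comment> \<open>Subtracting from a vector x the multiple x_a v makes its entry \<open>a\<close>
    vanish. If \<open>s\<close> were in the span of \<open>v\<close> and \<open>w\<close>, the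
    reduced \<open>s\<close> would be a multiple of the reduced \<open>w\<close>, and entry
    \<open>b\<close> forces the factor \<open>\<mu>\<close>; so some entry \<open>c\<close> must
    violate proportionality.\<close>
  define \<mu> where "\<mu> = (s b - v b * s a) / d"
  have "\<exists>c\<le>ns ! i. s c - v c * s a \<noteq> \<mu> * (w c - v c * w a)"
  proof (rule ccontr)
    assume "\<not> ?thesis"
    then have eq: "s c = (s a - \<mu> * w a) * v c + \<mu> * w c" for c
      using ker by (cases "c \<le> ns ! i") (auto simp: algebra_simps not_le)
    have "s = fscale (s a - \<mu> * w a) v + fscale \<mu> w"
      unfolding plus_fun_def by (rule ext, rule eq)
    also have "\<dots> \<in> fvec.span {v, w}"
      by (intro fvec.span_add fvec.span_scale fvec.span_base) auto
    finally show False using nc by (simp add: defs)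
  qed
  then obtain c where c: "c \<le> ns ! i" "s c - v c * s a \<noteq> \<mu> * (w c - v c * w a)" by blast
  \<comment> \<open>With this factor, the combination of the reduced entries \<open>c\<close> and
    \<open>b\<close> vanishes at \<open>w\<close>, and at \<open>s\<close> it is exactly the defect
    of proportionality at \<open>c\<close>.\<close>
  define \<kappa> where "\<kappa> = (w c - v c * w a) / d"
  define l' where "l' = (\<lambda>x. vanishing_form p i c x - \<kappa> * vanishing_form p i b x)"
  have pl': "pairing ns i l' x = (x c - v c * x a) - \<kappa> * (x b - v b * x a)" for x
    unfolding l'_def by (simp add: pairing_diff_scale pairing_vanishing_form[OF Y(1) i(1)] b c defs)
  have l'p: "pairing ns i l' (lift p i) = 0" using va by (simp add: pl' defs(1)[symmetric])
  have l'q: "pairing ns i l' (lift q i) = 0" using d by (simp add: pl' defs(2)[symmetric] \<kappa>_def d_def[symmetric])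
  have "\<kappa> * (s b - v b * s a) = \<mu> * (w c - v c * w a)" by (simp add: \<kappa>_def \<mu>_def)
  then have l'r: "pairing ns i l' (lift r i) \<noteq> 0" using c by (simp add: pl' defs(3)[symmetric])
  define L where "L f = (\<lambda>k. coord_form (pivot p k))(i := f, j := vanishing_form p j t)" for f
  have Li: "L f i = f" "L f j = vanishing_form p j t" for f using j(2) by (auto simp: L_def)
  \<comment> \<open>\<open>lift\<close> and \<open>pivot\<close> depend only on the component of the
    point in the given factor, so equal components have equal lifts.\<close>
  have sl: "lift x k = lift p k" if "x \<in> S" "k < length ns" "k \<noteq> i" for x k
    using same[OF that] by (simp add: lift_def pivot_def)
  have prod: "(\<Prod>k\<in>{..<length ns} - {j}. pairing ns k (L f k) (lift x k)) = pairing ns i f (lift x i)" if "x \<in> S" for x f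
  proof -
    have "(\<Prod>k\<in>{..<length ns} - {j} - {i}. pairing ns k (L f k) (lift x k)) = 1"
      using sl[OF that] lift_pivot[OF Y(1)] pivot_le[OF Y(1)]
      by (intro prod.neutral) (auto simp: L_def pairing_coord_form)
    then show ?thesis using i j by (subst prod.remove[of _ i]) (auto simp: Li)
  qed
  have jt: "(j, t) \<in> cox_vars ns" using j t by (simp add: cox_vars_def)
  have dv: "deriv ns (lift x) (j, t) (full_form ns (L f)) = pairing ns i f (lift x i)" if "x \<in> S" for x f
    using t(2) by (simp add: deriv_full_form[OF jt] prod[OF that] Li vanishing_form_def coord_form_def)
  have z: "jet ns p e (full_form ns (L f)) = 0" if "pairing ns i f (lift p i) = 0" "e \<in> jet_index ns p" for e f
    using Li pairing_vanishing_form_self[OF Y(1) j(1) t(1)] i j that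
    by (intro full_form_jet_zero[of i ns "L f" p j]) auto
  show ?thesis
  proof (rule rank_ge_2[OF p full_form_sections z[OF l(1)] full_form_sections z[OF l'p]])
    fix \<alpha> \<beta>
    assume *: "\<And>q w. q \<in> S \<Longrightarrow> w \<in> cox_vars ns \<Longrightarrow>
      \<alpha> * deriv ns (lift q) w (full_form ns (L l)) + \<beta> * deriv ns (lift q) w (full_form ns (L l')) = 0"
    have "\<alpha> = 0" using *[OF q jt] l(2) l'q by (simp add: dv q)
    then show "\<alpha> = 0 \<and> \<beta> = 0" using *[OF r jt] l'r by (simp add: dv r)
  qed
qed

end

section \<open>Global sections\<close>

text \<open>Nonnegative exponents with sum 1 in each factor: one variable per factor has exponent 1
  and all others have exponent 0.\<close>

lemma adm_one_chart_exp:
  assumes m: "m \<in> adm ns (\<lambda>_. 1) {}"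
  shows "\<exists>a\<in>charts ns. m = chart_exp ns a"
proof (intro bexI poly_mapping_eqI)
  let ?a = "positive_chart ns m"
  show a: "?a \<in> charts ns" by (rule positive_chart(1)[OF m])
  fix v :: "nat \<times> nat"
  have nn: "lookup m v \<ge> 0" for v using m by (cases v) (auto simp: adm_def not_less)
  obtain i j where v: "v = (i, j)" by (cases v)
  show "lookup m v = lookup (chart_exp ns ?a) v"
  proof (cases "i < length ns \<and> j \<le> ns ! i")
    case True
    have ai: "?a i \<le> ns ! i" using a True by (auto simp: charts_def PiE_iff)
    have p: "lookup m (i, ?a i) > 0"
      using True by (intro positive_chart(2)[OF m]) (auto simp: pivots_def)
    let ?R = "\<Sum>j\<in>{..ns ! i} - {?a i}. lookup m (i, j)"
    have "multideg ns m i = lookup m (i, ?a i) + ?R"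
      unfolding multideg_def using ai by (subst sum.remove[of _ "?a i"]) auto
    moreover have "multideg ns m i = 1" using m True by (auto simp: adm_def)
    moreover have "?R \<ge> 0" by (intro sum_nonneg nn)
    ultimately have "?R = 0" "lookup m (i, ?a i) = 1" using p by auto
    moreover from this(1) have "\<forall>j\<in>{..ns ! i} - {?a i}. lookup m (i, j) = 0"
      by (subst (asm) sum_nonneg_eq_0_iff) (auto simp: nn)
    ultimately show ?thesis using True by (auto simp: v lookup_chart_exp)
  next
    case False
    then have "v \<notin> cox_vars ns" by (auto simp: v cox_vars_def)
    then have "lookup m v = 0" using m by (auto simp: adm_def in_keys_iff)
    moreover have "?a i \<le> ns ! i" if "i < length ns" using a that by (auto simp: charts_def PiE_iff)
    ultimately show ?thesis using False by (auto simp: v lookup_chart_exp)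
  qed
qed

context
  fixes ns :: "nat list" and S :: "'a::field mpoint set"
  assumes pos: "\<forall>d\<in>set ns. d > 0" and S: "S \<subseteq> mproj ns" and finS: "finite S"
begin

lemmas cochain_of_eq = cochain_of_def[OF pos S finS]
lemmas cocycles_0 = cocycles_0_iff[OF pos S finS]

lemma cochain_of_add: "cochain_of ns (\<lambda>_. f + g) = cochain_of ns (\<lambda>_. f) + cochain_of ns (\<lambda>_. g)"
  for f g :: "'a laurent"
  by (auto simp: cochain_of_eq fun_eq_iff)

lemma cochain_of_scale: "cochain_of ns (\<lambda>_. cst c * f) = cochain_scale c (cochain_of ns (\<lambda>_. f))"
  for f :: "'a laurent"
  by (auto simp: cochain_of_eq cochain_scale_def fun_eq_iff)

lemma cochain_of_zero: "cochain_of ns (\<lambda>_. 0 :: 'a laurent) = 0"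
  by (auto simp: cochain_of_eq fun_eq_iff)

lemma cochain_of_sum: "cochain_of ns (\<lambda>_. \<Sum>i\<in>I. f i) = (\<Sum>i\<in>I. cochain_of ns (\<lambda>_. f i))"
  for f :: "'i \<Rightarrow> 'a laurent"
  by (induction I rule: infinite_finite_induct) (auto simp: cochain_of_add cochain_of_zero)

lemma cochain_of_eq_0: "cochain_of ns (\<lambda>_. f) = 0 \<Longrightarrow> f = 0"
  for f :: "'a laurent"
proof -
  assume *: "cochain_of ns (\<lambda>_. f) = 0"
  have "(\<lambda>i\<in>{..<length ns}. 0) \<in> charts ns" by (auto simp: charts_def)
  then show "f = 0" using fun_cong[OF *, of "[\<lambda>i\<in>{..<length ns}. 0]"] by (simp add: cochain_of_eq)
qed

lemma subspace_cocycles_0: "coch.subspace (cocycles ns (double_sections ns S) 0)"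
  unfolding coch.subspace_def
proof (intro conjI ballI allI)
  show "0 \<in> cocycles ns (double_sections ns S) 0" unfolding cocycles_0
    by (intro bexI[of _ 0]) (auto simp: cochain_of_zero jet_def val_def deriv_def split: option.split)
  fix c assume "c \<in> cocycles ns (double_sections ns S) 0"
  then obtain f where f: "f \<in> sections ns (\<lambda>_. 1) {}" "\<forall>p\<in>S. \<forall>e\<in>jet_index ns p. jet ns p e f = 0"
    "c = cochain_of ns (\<lambda>_. f)" unfolding cocycles_0 by blast
  show "c + c' \<in> cocycles ns (double_sections ns S) 0" if "c' \<in> cocycles ns (double_sections ns S) 0" for c'
  proof -
    from that obtain g where g: "g \<in> sections ns (\<lambda>_. 1) {}" "\<forall>p\<in>S. \<forall>e\<in>jet_index ns p. jet ns p e g = 0"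
      "c' = cochain_of ns (\<lambda>_. g)" unfolding cocycles_0 by blast
    show ?thesis unfolding cocycles_0 using f g
      by (intro bexI[of _ "f + g"]) (auto simp: cochain_of_add jet_add intro: sections_add)
  qed
  show "cochain_scale r c \<in> cocycles ns (double_sections ns S) 0" for r
    unfolding cocycles_0 using f
    by (intro bexI[of _ "cst r * f"]) (auto simp: cochain_of_scale jet_scale intro: sections_scale)
qed

lemma h0_basis:
  obtains X where "quot_basis cochain_scale (cocycles ns (double_sections ns S) 0) {0} X"
    "h_coh ns (double_sections ns S) 0 = card X"
proof -
  have "0 \<in> cocycles ns (double_sections ns S) 0" using subspace_cocycles_0 by (rule coch.subspace_0)
  then have "\<exists>X. quot_basis cochain_scale (cocycles ns (double_sections ns S) 0) {0} X"
    using coch.quot_basis_exists[OF subspace_cocycles_0, of "{0}"] by blast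
  from someI_ex[OF this] that show ?thesis by (simp add: h_coh_def quot_dim_def)
qed

text \<open>This yields the finiteness of a basis. It matters because \<open>h_coh\<close> is a
  \<open>card\<close>, which would be 0 for an infinite basis and so could not show that
  \<open>h_coh\<close> is positive.\<close>

lemma cocycles_0_span:
  "cocycles ns (double_sections ns S) 0 \<subseteq>
    coch.span ((\<lambda>a. cochain_of ns (\<lambda>_. single (chart_exp ns a) 1)) ` charts ns)"
proof
  fix c assume "c \<in> cocycles ns (double_sections ns S) 0"
  then obtain f where f: "f \<in> sections ns (\<lambda>_. 1) {}" "c = cochain_of ns (\<lambda>_. f)"
    unfolding cocycles_0 by blast
  have "c = cochain_of ns (\<lambda>_. \<Sum>m\<in>keys f. cst (lookup f m) * single m 1)"
    unfolding f(2) by (subst sum_single_keys[of f]) (simp add: mult_single)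
  also have "\<dots> = (\<Sum>m\<in>keys f. cochain_scale (lookup f m)
      (cochain_of ns (\<lambda>_. single m 1)))"
    by (simp only: cochain_of_sum cochain_of_scale)
  also have "\<dots> \<in> coch.span ((\<lambda>a. cochain_of ns (\<lambda>_. single (chart_exp ns a) 1)) ` charts ns)"
  proof (intro coch.span_sum coch.span_scale coch.span_base)
    fix m assume "m \<in> keys f"
    then have "m \<in> adm ns (\<lambda>_. 1) {}" using f(1) by (auto simp: sections_def)
    then show "cochain_of ns (\<lambda>_. single m 1) \<in>
      (\<lambda>a. cochain_of ns (\<lambda>_. single (chart_exp ns a) 1)) ` charts ns"
      using adm_one_chart_exp by blast
  qed
  finally show "c \<in> coch.span ((\<lambda>a. cochain_of ns (\<lambda>_. single (chart_exp ns a) 1)) ` charts ns)" .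
qed

lemma h0_pos:
  assumes f: "f \<in> sections ns (\<lambda>_. 1) {}" "f \<noteq> 0" "\<And>p e. p \<in> S \<Longrightarrow> e \<in> jet_index ns p \<Longrightarrow> jet ns p e f = 0"
  shows "h_coh ns (double_sections ns S) 0 > 0"
proof -
  obtain X where X: "quot_basis cochain_scale (cocycles ns (double_sections ns S) 0) {0} X"
    "h_coh ns (double_sections ns S) 0 = card X" using h0_basis .
  have XZ: "X \<subseteq> cocycles ns (double_sections ns S) 0" and
    sp: "coch.span ({0} \<union> X) = cocycles ns (double_sections ns S) 0" and
    ni: "\<And>x. x \<in> X \<Longrightarrow> x \<notin> coch.span ({0} \<union> (X - {x}))"
    using X(1) by (auto simp: quot_basis_def)
  have "coch.independent X"
    unfolding coch.dependent_def
  proof clarify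
    fix x assume "x \<in> X" "x \<in> coch.span (X - {x})"
    then show False using ni[of x] coch.span_mono[of "X - {x}" "{0} \<union> (X - {x})"] by blast
  qed
  moreover have "X \<subseteq> coch.span ((\<lambda>a. cochain_of ns (\<lambda>_. single (chart_exp ns a) 1)) ` charts ns)"
    using XZ cocycles_0_span by (rule subset_trans)
  ultimately have "finite X"
    using coch.independent_span_bound[OF finite_imageI[OF finite_charts]] by blast
  moreover have "X \<noteq> {}"
  proof
    assume "X = {}"
    then have "cocycles ns (double_sections ns S) 0 = {0}" using sp by simp
    moreover have "cochain_of ns (\<lambda>_. f) \<in> cocycles ns (double_sections ns S) 0"
      unfolding cocycles_0 using f by blast
    ultimately show False using cochain_of_eq_0[of f] f(2) by simp
  qed
  ultimately show ?thesis using X(2) by (simp add: card_gt_0_iff)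
qed

text \<open>On a single projective space a section is one linear form, and its derivatives at
  \<open>p\<close> are its coefficients.\<close>

lemma h0_zero:
  assumes len: "length ns = 1" and p: "p \<in> S"
  shows "h_coh ns (double_sections ns S) 0 = 0"
proof -
  have pY: "p \<in> mproj ns" using p S by blast
  have "f = 0" if f: "f \<in> sections ns (\<lambda>_. 1) {}" and j: "\<forall>e\<in>jet_index ns p. jet ns p e f = 0" for f
  proof (rule poly_mapping_eqI)
    fix m
    show "lookup f m = lookup 0 m"
    proof (rule ccontr)
      assume "lookup f m \<noteq> lookup 0 m"
      then have m: "m \<in> keys f" by (simp add: in_keys_iff)
      have *: "\<exists>a\<in>charts ns. m = chart_exp ns a" if "m \<in> keys f" for m
        using that f adm_one_chart_exp by (auto simp: sections_def)
      obtain a where a: "a \<in> charts ns" "m = chart_exp ns a" using *[OF m] by blast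
      have w: "(0, a 0) \<in> cox_vars ns" using a(1) len by (auto simp: charts_def cox_vars_def PiE_iff)
      have "deriv ns (lift p) (0, a 0) f = (\<Sum>m'\<in>keys f. if m' = m then lookup f m else 0)"
        unfolding deriv_def lin_ext_def
      proof (intro sum.cong refl)
        fix m' assume "m' \<in> keys f"
        then obtain a' where a': "a' \<in> charts ns" "m' = chart_exp ns a'" using * by blast
        show "lookup f m' * mono_deriv ns (lift p) (0, a 0) m' = (if m' = m then lookup f m else 0)"
        proof (cases "a' 0 = a 0")
          case True
          have "a' = a"
          proof (rule PiE_ext)
            show "a' \<in> (\<Pi>\<^sub>E i\<in>{..<length ns}. {..ns ! i})" "a \<in> (\<Pi>\<^sub>E i\<in>{..<length ns}. {..ns ! i})"
              using a a' by (auto simp: charts_def)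
          qed (use True len in auto)
          have "(\<Prod>v\<in>cox_vars ns - {(0, a 0)}. lift p (fst v) (snd v) powi lookup (chart_exp ns a) v) = 1"
            using len by (intro prod.neutral) (auto simp: lookup_chart_exp)
          then have "mono_deriv ns (lift p) (0, a 0) m' = 1"
            using len \<open>a' = a\<close> a' by (simp add: mono_deriv_def lookup_chart_exp)
          then show ?thesis using \<open>a' = a\<close> a a' by simp
        next
          case False
          then have l: "lookup m' (0, a 0) = 0" "lookup m (0, a 0) = 1"
            using len by (auto simp: a a' lookup_chart_exp)
          then have "m' \<noteq> m" by auto
          then show ?thesis using l by (simp add: mono_deriv_def)
        qed
      qed
      also have "\<dots> = lookup f m" using m by simp
      finally have "deriv ns (lift p) (0, a 0) f = lookup f m" .
      moreover have "deriv ns (lift p) (0, a 0) f = 0"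
        using j by (intro jet_zero_imp_deriv_zero[OF pY f _ w]) blast
      ultimately show False using m by (simp add: in_keys_iff)
    qed
  qed
  then have Z: "cocycles ns (double_sections ns S) 0 \<subseteq> {0}"
    unfolding cocycles_0 subset_iff using p by (metis cochain_of_zero singleton_iff)
  obtain X where X: "quot_basis cochain_scale (cocycles ns (double_sections ns S) 0) {0} X"
    "h_coh ns (double_sections ns S) 0 = card X" using h0_basis .
  have "X \<subseteq> {0}" "\<And>x. x \<in> X \<Longrightarrow> x \<notin> coch.span ({0} \<union> (X - {x}))"
    using X(1) Z by (auto simp: quot_basis_def)
  moreover have "0 \<in> coch.span ({0} \<union> (X - {0}))" by (rule coch.span_zero)
  ultimately have "X = {}" by blast
  then show ?thesis using X(2) by simp
qed

section \<open>The minimal rank\<close>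

lemma two_points:
  assumes "card S \<ge> 2"
  obtains p q i where "p \<in> S" "q \<in> S" "i < length ns" "p i \<noteq> q i"
proof -
  obtain p q where pq: "p \<in> S" "q \<in> S" "p \<noteq> q"
    using assms by (metis One_nat_def card_le_Suc0_iff_eq finS not_less_eq_eq numeral_2_eq_2)
  then have "p \<in> mproj ns" "q \<in> mproj ns" using S by auto
  then obtain i where "i < length ns" "p i \<noteq> q i" using mproj_neqE pq(3) by metis
  then show ?thesis using that pq(1,2) by blast
qed

lemma rank_bound:
  assumes "card S \<ge> 2" "length ns \<ge> 2"
  shows "sum_list ns + 2 \<le> fvec.dim (global_jets ns S)"
proof -
  obtain p q i where pq: "p \<in> S" "q \<in> S" "i < length ns" "p i \<noteq> q i" using two_points[OF assms(1)] .
  have "\<exists>j<length ns. j \<noteq> i"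
    using assms(2) by (intro exI[of _ "if i = 0 then 1 else 0"]) auto
  then show ?thesis using rank_lower_bound[OF pos S finS pq] by blast
qed

lemma minimal_rank_structure:
  assumes r: "card S \<ge> 2" and len: "length ns \<ge> 2" and n: "sum_list ns = n" "n \<ge> 3"
    and rank: "fvec.dim (global_jets ns S) < n + 3"
  shows "\<exists>i j. {i, j} = {0, 1} \<and> length ns = 2 \<and> ns ! i = n - 1 \<and> ns ! j = 1 \<and>
          (\<exists>L pt. proj_line (n - 1) L \<and> pt \<in> proj_space 1 \<and>
             S \<subseteq> {p \<in> mproj ns. p i \<in> L \<and> p j = pt} \<and>
             proj_span (n - 1) ((\<lambda>p. p i) ` S) = L)"
proof -
  obtain p q i where pq: "p \<in> S" "q \<in> S" and i: "i < length ns" "p i \<noteq> q i" using two_points[OF r] .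
  \<comment> \<open>Stated for every pair of points and every factor in which they differ, since it
    is used twice: for \<open>p\<close> and \<open>q\<close> to get n_j = 1, and then to show that
    \<open>S\<close> is constant in factor \<open>j\<close>.\<close>
  have small: "ns ! k = 1" if "x \<in> S" "y \<in> S" "h < length ns" "x h \<noteq> y h" "k < length ns" "k \<noteq> h" for x y h k
  proof -
    have "\<not> ns ! k \<ge> 2"
      using rank_large_factor[OF pos S finS that] rank n(1) by linarith
    moreover have "ns ! k > 0" using pos that(5) nth_mem by blast
    ultimately show ?thesis by linarith
  qed
  have three: "\<not> (j < length ns \<and> j \<noteq> i \<and> k < length ns \<and> k \<noteq> i \<and> k \<noteq> j)" for j k
    using rank_three_factors[OF pos S finS pq i, of j k] rank n(1) by linarith
  have len2: "length ns = 2"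
  proof (rule ccontr)
    assume "length ns \<noteq> 2"
    then have "length ns \<ge> 3" using len by simp
    then show False using three[of 0 1] three[of 0 2] three[of 1 2] by (cases "i = 0"; cases "i = 1") auto
  qed
  define j where "j = 1 - i"
  have ij: "{i, j} = {0, 1}" "j < length ns" "j \<noteq> i" using i(1) len2 by (cases "i = 0"; auto simp: j_def)+
  have nj: "ns ! j = 1" using small[OF pq i ij(2,3)] .
  obtain a b where ab: "ns = [a, b]" using len2 by (auto simp: length_Suc_conv numeral_2_eq_2)
  have "ns ! i + ns ! j = n" using n(1) i(1) by (auto simp: ab j_def less_Suc_eq)
  then have ni: "ns ! i = n - 1" using nj by simp
  \<comment> \<open>A second point with another component in factor \<open>j\<close> would exchange
    the roles of the factors and give n_i = 1, but n_i = n - 1 is at least 2.\<close>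
  have same: "s j = p j" if "s \<in> S" for s
  proof (rule ccontr)
    assume "s j \<noteq> p j"
    then have "ns ! i = 1" using small[OF that pq(1) ij(2) _ i(1)] ij(3) by metis
    then show False using ni n(2) by simp
  qed
  have same': "s h = p h" if "s \<in> S" "h < length ns" "h \<noteq> i" for s h
    using same[OF that(1)] that i(1) len2 by (cases "h = j") (auto simp: j_def)
  define v w where "v = lift p i" "w = lift q i"
  define W where "W = kvec.span {v, w}"
  have Y: "p \<in> mproj ns" "q \<in> mproj ns" using pq S by auto
  have lW: "lift s i \<in> W" if "s \<in> S" for s
  proof (rule ccontr)
    assume "lift s i \<notin> W"
    then have nc: "lift s i \<notin> fvec.span {lift p i, lift q i}" by (simp only: W_def v_w_def not_False_eq_True)
    have "sum_list ns + 3 \<le> fvec.dim (global_jets ns S)"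
      by (rule rank_noncollinear[OF pos S finS pq that i ij(2,3) _ nc]) (rule same')
    then show False using rank n(1) by linarith
  qed
  have subW: "kvec.subspace W" unfolding W_def by (rule kvec.subspace_span)
  have sW: "s i \<subseteq> W" if "s \<in> S" for s
  proof -
    have "s \<in> mproj ns" using that S by blast
    then show ?thesis
      using point_eq[OF _ i(1), of s] lW[OF that] kvec.subspace_scale[OF subW] by auto
  qed
  have vw: "v \<in> p i" "w \<in> q i" using lift_in[OF _ i(1)] Y by (auto simp: v_w_def)
  have kW: "W \<subseteq> kspace (n - 1)"
  proof -
    have "kvec.subspace (kspace (n - 1))" by (auto simp: kvec.subspace_def kspace_def)
    moreover have "{v, w} \<subseteq> kspace (n - 1)" using lift_kspace[OF _ i(1)] Y ni by (auto simp: v_w_def)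
    ultimately show ?thesis unfolding W_def by (intro kvec.span_minimal)
  qed
  have dW: "kvec.dim W = 2"
  proof -
    have v0: "v \<noteq> 0" using lift_pivot[OF Y(1) i(1)] by (auto simp: v_w_def)
    have "w \<notin> kvec.span {v}"
    proof
      assume "w \<in> kvec.span {v}"
      then obtain c where c: "w = (\<lambda>k. c * v k)" unfolding kvec.span_singleton by auto
      obtain k where "w k \<noteq> v k * w (pivot p i)"
        using separating_form[OF Y(2,1) i(1)] i(2) by (auto simp: v_w_def)
      then show False using c lift_pivot[OF Y(1) i(1)] by (simp add: v_w_def mult.commute)
    qed
    moreover have "kvec.independent {v}" using v0 unfolding kvec.dependent_single by simp
    ultimately have "kvec.independent {w, v}" by (rule kvec.independent_insertI)
    moreover have "w \<noteq> v" using \<open>w \<notin> kvec.span {v}\<close> kvec.span_base[of v "{v}"] by auto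
    ultimately show ?thesis unfolding W_def
      by (subst kvec.dim_span_eq_card_independent) (auto simp: insert_commute)
  qed
  have span: "kvec.span (\<Union> ((\<lambda>p. p i) ` S)) = W"
  proof
    show "kvec.span (\<Union> ((\<lambda>p. p i) ` S)) \<subseteq> W" using sW by (intro kvec.span_minimal subW) blast
    have "{v, w} \<subseteq> \<Union> ((\<lambda>p. p i) ` S)" using vw pq by blast
    then show "W \<subseteq> kvec.span (\<Union> ((\<lambda>p. p i) ` S))" unfolding W_def by (rule kvec.span_mono)
  qed
  define L where "L = proj_linear (n - 1) W"
  have "proj_line (n - 1) L" unfolding proj_line_def L_def using subW kW dW by blast
  moreover have coord: "s k \<in> proj_space (ns ! k)" if "s \<in> mproj ns" "k < length ns" for s :: "'a mpoint" and k
    using that by (auto simp: mproj_def)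
  moreover have "p j \<in> proj_space 1" using coord[OF Y(1) ij(2)] by (simp only: nj)
  moreover have "S \<subseteq> {s \<in> mproj ns. s i \<in> L \<and> s j = p j}"
  proof
    fix s assume s: "s \<in> S"
    then have "s \<in> mproj ns" using S by blast
    moreover from this have "s i \<in> proj_space (n - 1)" using coord[OF _ i(1), of s] by (simp only: ni)
    ultimately show "s \<in> {s \<in> mproj ns. s i \<in> L \<and> s j = p j}"
      using sW[OF s] same[OF s] by (simp add: L_def proj_linear_def)
  qed
  moreover have "proj_span (n - 1) ((\<lambda>p. p i) ` S) = L" by (simp add: proj_span_def span L_def)
  ultimately show ?thesis using ij(1) len2 ni nj by blast
qed

end

section \<open>An extremal set\<close>

definition line_vec :: "nat \<Rightarrow> nat \<Rightarrow> 'a::field" where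
  "line_vec t = (\<lambda>j. if j = 0 then 1 else if j = 1 then of_nat t else 0)"

definition line_point :: "nat \<Rightarrow> 'a::field mpoint" where
  "line_point t = (\<lambda>i\<in>{..<2}. range (\<lambda>c j. c * line_vec (if i = 0 then t else 0) j))"

lemma line_point_mproj:
  assumes "n \<ge> 3"
  shows "line_point t \<in> mproj [n - 1, 1]"
proof -
  have v: "line_vec u \<noteq> (0 :: nat \<Rightarrow> 'a)" for u by (auto simp: line_vec_def fun_eq_iff intro!: exI[of _ 0])
  have "line_vec u \<in> (kspace m :: (nat \<Rightarrow> 'a) set)" if "m \<ge> 1" for u m using that by (auto simp: line_vec_def kspace_def)
  then have "range (\<lambda>c j. c * line_vec u j :: 'a) \<in> proj_space m" if "m \<ge> 1" for u m
    unfolding proj_space_iff using v that by blast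
  then show ?thesis using assms by (auto simp: mproj_def line_point_def less_Suc_eq numeral_2_eq_2)
qed

text \<open>The first coordinates force the scalar to be 1, and in characteristic 0 the second
  coordinates \<open>of_nat t\<close> are distinct.\<close>

lemma line_point_inj: "inj (line_point :: nat \<Rightarrow> 'a::field_char_0 mpoint)"
proof
  fix t u assume "(line_point t :: 'a mpoint) = line_point u"
  from fun_cong[OF this, of 0]
  have "range (\<lambda>c j. c * line_vec t j :: 'a) = range (\<lambda>c j. c * line_vec u j)"
    by (simp add: line_point_def)
  moreover have "line_vec t \<in> range (\<lambda>c j. c * line_vec t j :: 'a)" by (rule range_eqI[of _ _ 1]) simp
  ultimately obtain c where c: "line_vec t = (\<lambda>j. c * line_vec u j :: 'a)" by auto
  have "c = 1" using fun_cong[OF c, of 0] by (simp add: line_vec_def)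
  then show "t = u" using fun_cong[OF c, of 1] by (simp add: line_vec_def)
qed

lemma line_point_lift:
  fixes n :: nat
  assumes n: "n \<ge> 3"
  shows "x \<ge> 2 \<Longrightarrow> lift (line_point t) 0 x = (0::'a::field_char_0)"
    and "lift (line_point t) 1 1 = (0::'a)"
proof -
  have "lift (line_point t) 0 \<in> (line_point t 0 :: 'a ppoint)" "lift (line_point t) 1 \<in> (line_point t 1 :: 'a ppoint)"
    using lift_in[OF line_point_mproj[OF n, of t]] by auto
  then show "x \<ge> 2 \<Longrightarrow> lift (line_point t) 0 x = (0::'a)" "lift (line_point t) 1 1 = (0::'a)"
    by (auto simp: line_point_def line_vec_def)
qed

text \<open>A derivative removes at most one of the two variables that vanish at
  \<open>p\<close>.\<close>

lemma monomial_two_zeros: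
  assumes "v \<in> cox_vars ns" "v' \<in> cox_vars ns" "v \<noteq> v'"
    and z: "lift p (fst v) (snd v) = 0" "lift p (fst v') (snd v') = 0"
    and m: "lookup m v = 1" "lookup m v' = 1"
  shows "jet ns p e (single m 1) = 0"
proof (cases e)
  case None
  have "mono_val ns (lift p) m = 0"
    unfolding mono_val_def using assms by (intro prod_zero bexI[of _ v]) auto
  then show ?thesis using None by (simp add: jet_def val_linear)
next
  case (Some w)
  have "(\<Prod>u\<in>cox_vars ns - {w}. lift p (fst u) (snd u) powi lookup m u) = 0"
    using assms by (intro prod_zero bexI[of _ "if w = v then v' else v"]) auto
  then show ?thesis using Some by (simp add: jet_def deriv_linear mono_deriv_def)
qed

definition chart_of :: "nat \<Rightarrow> nat \<Rightarrow> chart" where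
  "chart_of x y = (\<lambda>i\<in>{..<2}. if i = 0 then x else y)"

lemma line_points_jet:
  assumes n: "n \<ge> 3" and x: "2 \<le> x" "x \<le> n - 1"
  shows "jet [n - 1, 1] (line_point t :: 'a::field_char_0 mpoint) e
    (single (chart_exp [n - 1, 1] (chart_of x 1)) 1) = 0"
  by (rule monomial_two_zeros[of "(0, x)" _ "(1, 1)"])
    (use x line_point_lift[OF n] in \<open>auto simp: cox_vars_def lookup_chart_exp chart_of_def\<close>)

text \<open>The jets of the monomials span all global jets, and those of x_a y_1 with a \<ge> 2
  vanish at every point of the line.\<close>

lemma line_points_rank:
  fixes S :: "'a::field_char_0 mpoint set"
  assumes n: "n \<ge> 3" and S: "S = line_point ` {..<r}"
  shows "fvec.dim (global_jets [n - 1, 1] S) \<le> n + 2"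
proof -
  let ?ns = "[n - 1, 1 :: nat]"
  have pos: "\<forall>d\<in>set ?ns. d > 0" and SY: "S \<subseteq> mproj ?ns" and fin: "finite S"
    using n line_point_mproj[OF n] by (auto simp: S)
  \<comment> \<open>The index pairs of the other monomials: the n monomials x_a y_0, together with
    x_0 y_1 and x_1 y_1.\<close>
  define P where "P = (\<lambda>x. (x, 0::nat)) ` {..n - 1} \<union> {(0, 1), (1, 1)}"
  define g where "g xy = jets ?ns S (\<lambda>_. single (chart_exp ?ns (chart_of (fst xy) (snd xy))) 1)" for xy
  have mono: "jets ?ns S (\<lambda>_. single m 1) \<in> fvec.span (g ` P)" if m: "m \<in> adm ?ns (\<lambda>_. 1) {}" for m
  proof -
    obtain a where a: "a \<in> charts ?ns" "m = chart_exp ?ns a" using adm_one_chart_exp[OF m] by blast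
    have "a i \<le> ?ns ! i" if "i < 2" for i using a(1) that by (auto simp: charts_def PiE_iff)
    from this[of 0] this[of 1] have bd: "a 0 \<le> n - 1" "a 1 \<le> 1" by auto
    have "a = chart_of (a 0) (a 1)"
      using a(1) by (auto simp: charts_def chart_of_def fun_eq_iff PiE_iff extensional_def less_Suc_eq numeral_2_eq_2)
    then have e: "jets ?ns S (\<lambda>_. single m 1) = g (a 0, a 1)" using a(2) by (simp add: g_def)
    show ?thesis
    proof (cases "(a 0, a 1) \<in> P")
      case True
      then show ?thesis unfolding e by (intro fvec.span_base imageI)
    next
      case False
      then have x: "2 \<le> a 0" "a 1 = 1" using bd by (auto simp: P_def le_Suc_eq)
      have "g (a 0, a 1) = 0"
        using line_points_jet[OF n x(1) bd(1)] by (auto simp: g_def jets_def jets_index_def S x(2)[unfolded One_nat_def] fun_eq_iff)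
      then show ?thesis unfolding e by (simp add: fvec.span_zero)
    qed
  qed
  have "global_jets ?ns S \<subseteq> fvec.span (g ` P)"
  proof
    fix u assume "u \<in> global_jets ?ns S"
    then obtain f where f: "f \<in> sections ?ns (\<lambda>_. 1) {}" "u = jets ?ns S (\<lambda>_. f)"
      unfolding global_jets_def[OF pos SY fin] by blast
    have "u = (\<Sum>m\<in>keys f. fscale (lookup f m) (jets ?ns S (\<lambda>_. single m 1)))"
    proof
      fix k
      have "jet ?ns (fst k) (snd k) f = (\<Sum>m\<in>keys f. lookup f m *
          jet ?ns (fst k) (snd k) (single m 1))"
      proof -
        have "f = (\<Sum>m\<in>keys f. cst (lookup f m) * single m 1)"
          by (subst sum_single_keys[of f]) (simp add: mult_single)
        then have "jet ?ns (fst k) (snd k) f =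
          jet ?ns (fst k) (snd k) (\<Sum>m\<in>keys f. cst (lookup f m) * single m 1)"
          by (rule arg_cong)
        then show ?thesis by (simp only: jet_sum jet_scale)
      qed
      moreover have "(\<Sum>m\<in>I. F m) k = (\<Sum>m\<in>I. F m k)" for I and F :: "(nat \<times> nat \<Rightarrow>\<^sub>0 int) \<Rightarrow> _ \<Rightarrow> 'a"
        by (induction I rule: infinite_finite_induct) auto
      ultimately show "u k = (\<Sum>m\<in>keys f. fscale (lookup f m) (jets ?ns S (\<lambda>_. single m 1))) k"
        by (simp add: f(2) jets_def)
    qed
    also have "\<dots> \<in> fvec.span (g ` P)"
      using f(1) by (intro fvec.span_sum fvec.span_scale mono) (auto simp: sections_def)
    finally show "u \<in> fvec.span (g ` P)" .
  qed
  then have "fvec.dim (global_jets ?ns S) \<le> card (g ` P)"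
    by (intro fvec.dim_le_card) (auto simp: P_def)
  also have "\<dots> \<le> card P" by (intro card_image_le) (simp add: P_def)
  also have "\<dots> \<le> card ((\<lambda>x. (x, 0::nat)) ` {..n - 1}) + card {(0::nat, 1::nat), (1, 1)}"
    unfolding P_def by (rule card_Un_le)
  also have "\<dots> \<le> n + 2" using card_image_le[of "{..n - 1}" "\<lambda>x. (x, 0::nat)"] n by simp
  finally show ?thesis .
qed

text \<open>The left side is the total length of the double points minus the minimal rank n + 2; for
  r \<ge> 2 the subtractions of natural numbers are exact.\<close>

lemma mult_add_one_diff:
  "r \<ge> 2 \<Longrightarrow> r * (n + 1) - (n + 2) = (r - 1) * (n + 1) - (1::nat)"
  by (cases r) auto

section \<open>The maximum of \<open>delta\<close> and the pairs that attain it\<close>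

lemma Epairs_delta:
  fixes S :: "'a::field mpoint set"
  assumes n: "n \<ge> 3" and r: "r \<ge> 2" and E: "(ns, S) \<in> Epairs n r"
  shows "\<forall>d\<in>set ns. d > 0" "S \<subseteq> mproj ns" "finite S" "card S = r" "sum_list ns = n" "length ns \<ge> 2"
    "delta ns S + fvec.dim (global_jets ns S) = r * (n + 1)"
proof -
  show *: "\<forall>d\<in>set ns. d > 0" "S \<subseteq> mproj ns" "finite S" "card S = r" "sum_list ns = n"
    using E by (auto simp: Epairs_def mproj_spaces_def T1_def point_sets_def)
  show "delta ns S + fvec.dim (global_jets ns S) = r * (n + 1)"
    using delta_eq[OF *(1-3)] *(4,5) by simp
  have h: "h_coh ns (double_sections ns S) 0 > 0" using E by (auto simp: Epairs_def T1_def)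
  obtain p where "p \<in> S" using *(4) r by (metis card.empty ex_in_conv not_numeral_le_zero)
  then have "length ns \<noteq> 1" using h0_zero[OF *(1-3)] h by auto
  moreover have "length ns \<noteq> 0" using *(5) n by auto
  ultimately show "length ns \<ge> 2" by linarith
qed

lemma line_points_extremal:
  assumes n: "n \<ge> 3" and r: "r \<ge> 2"
  shows "\<exists>S :: 'a::field_char_0 mpoint set. ([n - 1, 1], S) \<in> Epairs n r \<and>
    delta [n - 1, 1] S = (r - 1) * (n + 1) - 1"
proof -
  let ?ns = "[n - 1, 1 :: nat]"
  define S :: "'a mpoint set" where "S = line_point ` {..<r}"
  have pos: "\<forall>d\<in>set ?ns. d > 0" and SY: "S \<subseteq> mproj ?ns" and fin: "finite S"
    using n line_point_mproj[OF n] by (auto simp: S_def)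
  have card: "card S = r"
    unfolding S_def using inj_on_subset[OF line_point_inj subset_UNIV] by (subst card_image) auto
  have "delta ?ns S + fvec.dim (global_jets ?ns S) = r * (n + 1)"
    using delta_eq[OF pos SY fin] card n by simp
  moreover have "fvec.dim (global_jets ?ns S) = n + 2"
    using line_points_rank[OF n S_def] rank_bound[OF pos SY fin] card r n by simp
  ultimately have d: "delta ?ns S = (r - 1) * (n + 1) - 1"
    using mult_add_one_diff[OF r, of n] by linarith
  \<comment> \<open>The monomial x_2 y_1, available because n - 1 is at least 2, vanishes doubly at
    all points of the line and witnesses that h^0 is positive.\<close>
  let ?m = "chart_exp ?ns (chart_of 2 1)"
  have "h_coh ?ns (double_sections ?ns S) 0 > 0"
  proof (rule h0_pos[OF pos SY fin])
    show "single ?m 1 \<in> (sections ?ns (\<lambda>_. 1) {} :: 'a laurent set)"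
      using n by (intro sections_single chart_exp_adm charts_pivots)
        (auto simp: charts_def chart_of_def numeral_2_eq_2 less_Suc_eq)
    have "lookup (single ?m (1::'a)) ?m = 1" by simp
    then show "single ?m (1::'a) \<noteq> 0" by (metis lookup_zero zero_neq_one)
    show "jet ?ns p e (single ?m 1) = 0" if "p \<in> S" for p e
      using that line_points_jet[OF n order_refl, where 'a = 'a and e = e] n unfolding S_def by fastforce
  qed
  moreover have "(r - 1) * (n + 1) - 1 > 0" using n r by (cases r) (auto simp: le_Suc_eq)
  ultimately have "(?ns, S) \<in> Epairs n r"
    using pos SY fin card d n by (auto simp: Epairs_def mproj_spaces_def T1_def point_sets_def)
  then show ?thesis using d by blast
qed

theorem theorem5p7:
  fixes n r :: nat
  assumes "n \<ge> 3" and "r \<ge> 2"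
  shows "delta1 TYPE('a::{alg_closed_field, field_char_0}) n r = (r - 1) * (n + 1) - 1 \<and>
    (\<forall>ns (S :: 'a mpoint set).
       (ns, S) \<in> Epairs n r \<and> delta ns S = delta1 TYPE('a) n r \<longrightarrow>
       (\<exists>i j. {i, j} = {0, 1} \<and> length ns = 2 \<and> ns ! i = n - 1 \<and> ns ! j = 1 \<and>
          (\<exists>L pt. proj_line (n - 1) L \<and> pt \<in> proj_space 1 \<and>
             S \<subseteq> {p \<in> mproj ns. p i \<in> L \<and> p j = pt} \<and>
             proj_span (n - 1) ((\<lambda>p. p i) ` S) = L)))"
proof -
  have le: "delta ns S \<le> (r - 1) * (n + 1) - 1" if E: "(ns, S) \<in> Epairs n r" for ns and S :: "'a mpoint set"
  proof -
    note e = Epairs_delta[OF assms E]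
    have "n + 2 \<le> fvec.dim (global_jets ns S)"
      using rank_bound[OF e(1-3)] e(4-6) assms by simp
    then show ?thesis using e(7) mult_add_one_diff[OF assms(2), of n] by linarith
  qed
  let ?D = "{delta ns S | ns (S :: 'a mpoint set). (ns, S) \<in> Epairs n r}"
  have bound: "d \<le> (r - 1) * (n + 1) - 1" if "d \<in> ?D" for d
    using that le by blast
  obtain S0 :: "'a mpoint set" where "([n - 1, 1], S0) \<in> Epairs n r" "delta [n - 1, 1] S0 = (r - 1) * (n + 1) - 1"
    using line_points_extremal[OF assms] by blast
  then have "(r - 1) * (n + 1) - 1 \<in> ?D" by (intro CollectI exI[of _ "[n - 1, 1]"] exI[of _ S0]) simp
  moreover have "finite ?D"
    by (rule finite_subset[of _ "{..(r - 1) * (n + 1) - 1}"]) (rule subsetI, rule atMost_iff[THEN iffD2], erule bound, simp)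
  ultimately have max: "delta1 TYPE('a) n r = (r - 1) * (n + 1) - 1"
    unfolding delta1_def by (intro Max_eqI bound)
  show ?thesis
  proof (intro conjI allI impI max)
    fix ns and S :: "'a mpoint set"
    assume *: "(ns, S) \<in> Epairs n r \<and> delta ns S = delta1 TYPE('a) n r"
    note e = Epairs_delta[OF assms conjunct1[OF *]]
    \<comment> \<open>Solving for the rank gives n + 2; the inequality (r - 1) (n + 1) \<ge> 1
      ensures that the subtraction of 1 is not truncated.\<close>
    have "(r - 1) * (n + 1) - 1 + fvec.dim (global_jets ns S) = r * (n + 1)"
      using e(7) * max by simp
    moreover have "r * (n + 1) = (r - 1) * (n + 1) + (n + 1)" using assms(2) by (cases r) auto
    moreover have "(r - 1) * (n + 1) \<ge> 1" using assms by (cases r) auto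
    ultimately have "fvec.dim (global_jets ns S) < n + 3" by linarith
    then show "\<exists>i j. {i, j} = {0, 1} \<and> length ns = 2 \<and> ns ! i = n - 1 \<and> ns ! j = 1 \<and>
          (\<exists>L pt. proj_line (n - 1) L \<and> pt \<in> proj_space 1 \<and>
             S \<subseteq> {p \<in> mproj ns. p i \<in> L \<and> p j = pt} \<and>
             proj_span (n - 1) ((\<lambda>p. p i) ` S) = L)"
      using e(4,6) assms(2) by (intro minimal_rank_structure[OF e(1-3) _ _ e(5) assms(1)]) auto
  qed
qed

end
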